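(* Consider an exponentially stable system $\dot x(t)=Ax(t)+Bu(t)$ with scalar input on an infinite-dimensional Hilbert space $H$, where $A$ generates a $C_0$ semigroup and has a Riesz basis of generalized eigenvectors, with eigenvalues $(\lambda_n)_{n\ge1}$ in $\mathbb{C}_-$, each distinct eigenvalue listed exactly once. Suppose that all but finitely many of the $\lambda_n$ have algebraic multiplicity $1$, and that every eigenvalue has only one Jordan block (so that there is exactly one Jordan block per eigenvalue, all blocks are finite, and all but finitely many blocks have size $1$). Then the system is exactly controllable if and only if $$\nu:=\sum_{n=1}^\infty\frac{|\operatorname{Re}\lambda_n|^2}{|b_n|^2d_n^2}\,\delta_{-\lambda_n}$$ is a Carleson measure on $\mathbb{C}_+$, where each eigenvalue is taken exactly once and $$d_n=\prod_{k\ne n}\left|\frac{\lambda_k-\lambda_n}{\lambda_k+\overline{\lambda_n}}\right|\qquad\text{for each } n.$$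
   Context: $\mathbb{C}_\pm=\{z\in\mathbb{C}:\pm\operatorname{Re}z>0\}$, and $\delta_w$ is the unit point mass at $w$. A Carleson measure on $\mathbb{C}_+$ is a positive Borel measure $\nu$ for which there is $C$ with $\int_{\mathbb{C}_+}|f|^2\,d\nu\le C\|f\|^2_{H^2(\mathbb{C}_+)}$ for all $f$ in the Hardy space $H^2(\mathbb{C}_+)$. If some $b_n$ or $d_n$ is $0$, the corresponding weight is $+\infty$ and $\nu$ is not a Carleson measure. Jordan structure: for each $n$ let $N_n$ be the size of the Jordan block of $\lambda_n$; the Riesz basis consists of vectors $\phi_{n,j}$ ($n\ge1$, $1\le j\le N_n$) with $A\phi_{n,1}=\lambda_n\phi_{n,1}$ and $A\phi_{n,j}=\lambda_n\phi_{n,j}+\phi_{n,j-1}$ for $2\le j\le N_n$. The control operator is $Bz=z\sum_{n,j}b_{n,j}\phi_{n,j}$, $z\in\mathbb{C}$, with complex numbers $b_{n,j}$. The number $b_n$ denotes $b_{n,N_n}$, the component corresponding to the last generalized eigenvector of the block (for a simple eigenvalue, $b_n$ is just the coefficient of the eigenvector). $B$ maps $\mathbb{C}$ into a larger space $\widetilde H$: enumerating the basis vectors as $(\psi_m)_{m\ge1}$ with corresponding coefficients $(\beta_m)$ of $B$, $\widetilde H$ is the completion of the span of $(\psi_m)$ under the norm $\left\|\sum_m a_m\psi_m\right\|_1^2=\sum_m\frac{|a_m|^2}{m^2(1+|\beta_m|^2)}$; the semigroup $(T(t))_{t\ge0}$ generated by $A$ is extended to $\widetilde H$ in the obvious way.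 The controllability operator $\mathcal{B}_\infty:L^2(0,\infty)\to\widetilde H$ is $\mathcal{B}_\infty u=\int_0^\infty T(s)Bu(s)\,ds$, and the system is exactly controllable if its range contains $H$. *)

theory Defs
  imports "HOL-Analysis.Analysis"
begin

subsection \<open>Complex Banach and Hilbert spaces\<close>

text \<open>The real scalar multiplication of the library class is required to be the restriction of
  the complex one.\<close>

class complex_banach = banach +
  fixes scaleC :: "complex \<Rightarrow> 'a \<Rightarrow> 'a" (infixr "*\<^sub>C" 75)
  assumes scaleC_add_right: "c *\<^sub>C (x + y) = c *\<^sub>C x + c *\<^sub>C y"
    and scaleC_add_left: "(c + d) *\<^sub>C x = c *\<^sub>C x + d *\<^sub>C x"
    and scaleC_scaleC: "c *\<^sub>C d *\<^sub>C x = (c * d) *\<^sub>C x"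
    and scaleR_scaleC: "r *\<^sub>R x = complex_of_real r *\<^sub>C x"
    and norm_scaleC: "norm (c *\<^sub>C x) = cmod c * norm x"

class complex_hilbert = complex_banach +
  fixes cinner :: "'a \<Rightarrow> 'a \<Rightarrow> complex"
  assumes cinner_commute: "cinner x y = cnj (cinner y x)"
    and cinner_add_left: "cinner (x + y) z = cinner x z + cinner y z"
    and cinner_scaleC_left: "cinner (c *\<^sub>C x) y = c * cinner x y"
    and cinner_self: "cinner x x = complex_of_real ((norm x)\<^sup>2)"

lemma vector_space_scaleC: "vector_space (scaleC :: complex \<Rightarrow> 'a::complex_banach \<Rightarrow> 'a)"
proof
  show "1 *\<^sub>C x = x" for x :: 'a
    using scaleR_scaleC[of 1 x] by simp
qed (simp_all add: scaleC_add_right scaleC_add_left scaleC_scaleC)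

definition cspan :: "'a::complex_banach set \<Rightarrow> 'a set"
  where "cspan = module.span scaleC"

definition bounded_clinear :: "('a::complex_banach \<Rightarrow> 'b::complex_banach) \<Rightarrow> bool"
  where "bounded_clinear S \<longleftrightarrow> bounded_linear S \<and> (\<forall>c x. S (c *\<^sub>C x) = c *\<^sub>C S x)"

definition riesz_basis :: "'i set \<Rightarrow> ('i \<Rightarrow> 'a::complex_hilbert) \<Rightarrow> bool"
  where "riesz_basis I \<phi> \<longleftrightarrow>
    closure (cspan (\<phi> ` I)) = UNIV \<and>
    (\<exists>m M. 0 < m \<and> 0 < M \<and>
      (\<forall>F a. finite F \<and> F \<subseteq> I \<longrightarrow>
        m * (\<Sum>i\<in>F. (cmod (a i))\<^sup>2) \<le> (norm (\<Sum>i\<in>F. a i *\<^sub>C \<phi> i))\<^sup>2 \<and>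
        (norm (\<Sum>i\<in>F. a i *\<^sub>C \<phi> i))\<^sup>2 \<le> M * (\<Sum>i\<in>F. (cmod (a i))\<^sup>2)))"


subsection \<open>Semigroups and generators\<close>

definition C0_semigroup :: "(real \<Rightarrow> 'a::complex_banach \<Rightarrow> 'a) \<Rightarrow> bool"
  where "C0_semigroup T \<longleftrightarrow>
    (\<forall>t\<ge>0. bounded_clinear (T t)) \<and>
    T 0 = id \<and>
    (\<forall>s\<ge>0. \<forall>t\<ge>0. T (s + t) = T s \<circ> T t) \<and>
    (\<forall>x. ((\<lambda>t. T t x) \<longlongrightarrow> x) (at_right 0))"

definition exponentially_stable :: "(real \<Rightarrow> 'a::complex_banach \<Rightarrow> 'a) \<Rightarrow> bool"
  where "exponentially_stable T \<longleftrightarrow>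
    (\<exists>M. \<exists>\<omega>>0. \<forall>t\<ge>0. \<forall>x. norm (T t x) \<le> M * exp (- \<omega> * t) * norm x)"

text \<open>An unbounded operator is given by its domain \<open>D\<close> and a function \<open>A\<close> whose values outside
  \<open>D\<close> are irrelevant.\<close>

definition is_generator ::
    "'a set \<Rightarrow> ('a \<Rightarrow> 'a) \<Rightarrow> (real \<Rightarrow> 'a::complex_banach \<Rightarrow> 'a) \<Rightarrow> bool"
  where "is_generator D A T \<longleftrightarrow>
    D = {x. \<exists>y. ((\<lambda>t. (1 / t) *\<^sub>R (T t x - x)) \<longlongrightarrow> y) (at_right 0)} \<and>
    (\<forall>x\<in>D. ((\<lambda>t. (1 / t) *\<^sub>R (T t x - x)) \<longlongrightarrow> A x) (at_right 0))"


subsection \<open>Jordan chains\<close>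

definition jordan_index :: "(nat \<Rightarrow> nat) \<Rightarrow> (nat \<times> nat) set"
  where "jordan_index N = {(n, j). 1 \<le> j \<and> j \<le> N n}"

definition jordan_chain ::
    "'a set \<Rightarrow> ('a \<Rightarrow> 'a) \<Rightarrow> complex \<Rightarrow> nat \<Rightarrow> (nat \<Rightarrow> 'a::complex_banach) \<Rightarrow> bool"
  where "jordan_chain D A \<mu> N \<phi> \<longleftrightarrow>
    (\<forall>j\<in>{1..N}. \<phi> j \<in> D) \<and>
    A (\<phi> 1) = \<mu> *\<^sub>C \<phi> 1 \<and>
    (\<forall>j\<in>{2..N}. A (\<phi> j) = \<mu> *\<^sub>C \<phi> j + \<phi> (j - 1))"


subsection \<open>The larger space and the controllability operator\<close>

text \<open>A map \<open>\<iota>\<close> from \<open>H\<close> to a complex Banach space exhibits the latter as the completion of the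
  span of the vectors \<open>\<psi> m\<close> under the weighted norm: it is isometric for that norm on the span and
  the image of the span is dense. As the weighted norm is dominated by the norm of \<open>H\<close> on the
  span, the canonical map of the span is bounded and \<open>\<iota>\<close> is its continuous extension to \<open>H\<close>, the
  inclusion of \<open>H\<close>. The enumeration starts at \<open>0\<close>, whence the weight \<open>(Suc m)\<^sup>2\<close>.\<close>

definition is_extended_space ::
    "(nat \<Rightarrow> 'h::complex_hilbert) \<Rightarrow> (nat \<Rightarrow> complex) \<Rightarrow> ('h \<Rightarrow> 'k::complex_banach) \<Rightarrow> bool"
  where "is_extended_space \<psi> \<beta> \<iota> \<longleftrightarrow>
    bounded_clinear \<iota> \<and>
    (\<forall>M a. (norm (\<iota> (\<Sum>m<M. a m *\<^sub>C \<psi> m)))\<^sup>2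
         = (\<Sum>m<M. (cmod (a m))\<^sup>2 / ((real (Suc m))\<^sup>2 * (1 + (cmod (\<beta> m))\<^sup>2)))) \<and>
    closure (\<iota> ` cspan (range \<psi>)) = UNIV"

text \<open>Unique if it exists, as the range of \<open>\<iota>\<close> is dense.\<close>

definition extend_op ::
    "('h::complex_banach \<Rightarrow> 'k::complex_banach) \<Rightarrow> ('h \<Rightarrow> 'h) \<Rightarrow> 'k \<Rightarrow> 'k"
  where "extend_op \<iota> S = (THE S'. bounded_clinear S' \<and> (\<forall>x. S' (\<iota> x) = \<iota> (S x)))"

text \<open>The series converges in the larger space, in general not in \<open>H\<close>.\<close>

definition control_op ::
    "('h::complex_banach \<Rightarrow> 'k::complex_banach) \<Rightarrow> 'i set \<Rightarrow> ('i \<Rightarrow> 'h) \<Rightarrow> ('i \<Rightarrow> complex)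
      \<Rightarrow> complex \<Rightarrow> 'k"
  where "control_op \<iota> I \<phi> b z = z *\<^sub>C (\<Sum>\<^sub>\<infinity>i\<in>I. b i *\<^sub>C \<iota> (\<phi> i))"

definition L2_halfline :: "(real \<Rightarrow> complex) set"
  where "L2_halfline = {u. set_borel_measurable lborel {0<..} u \<and>
    set_integrable lborel {0<..} (\<lambda>s. (cmod (u s))\<^sup>2)}"

definition controllability_op ::
    "(real \<Rightarrow> 'k \<Rightarrow> 'k) \<Rightarrow> (complex \<Rightarrow> 'k) \<Rightarrow> (real \<Rightarrow> complex)
      \<Rightarrow> 'k::{complex_banach, second_countable_topology}"
  where "controllability_op T B u = (LINT s:{0<..}|lborel. T s (B (u s)))"

definition exactly_controllable ::
    "('h \<Rightarrow> 'k) \<Rightarrow> (real \<Rightarrow> 'h::complex_hilbert \<Rightarrow> 'h) \<Rightarrow>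
      (complex \<Rightarrow> 'k::{complex_banach, second_countable_topology}) \<Rightarrow> bool"
  where "exactly_controllable \<iota> T B \<longleftrightarrow>
    range \<iota> \<subseteq> controllability_op (\<lambda>s. extend_op \<iota> (T s)) B ` L2_halfline"


subsection \<open>Carleson measures on the right half-plane\<close>

definition right_half_plane :: "complex set"
  where "right_half_plane = {z. 0 < Re z}"

text \<open>The customary factor \<open>1 / (2 * pi)\<close> is omitted; it does not affect Carleson measures.\<close>

definition H2_norm_sq :: "(complex \<Rightarrow> complex) \<Rightarrow> ennreal"
  where "H2_norm_sq f = (SUP x\<in>{0<..}. \<integral>\<^sup>+ y. ennreal ((cmod (f (Complex x y)))\<^sup>2) \<partial>lborel)"

definition hardy_H2 :: "(complex \<Rightarrow> complex) set"
  where "hardy_H2 = {f. f holomorphic_on right_half_plane \<and> H2_norm_sq f < \<infinity>}"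

definition carleson_measure :: "complex measure \<Rightarrow> bool"
  where "carleson_measure \<nu> \<longleftrightarrow>
    sets \<nu> = sets borel \<and>
    (\<exists>C::real. \<forall>f\<in>hardy_H2.
      (\<integral>\<^sup>+ z\<in>right_half_plane. ennreal ((cmod (f z))\<^sup>2) \<partial>\<nu>) \<le> ennreal C * H2_norm_sq f)"

text \<open>The sum of the point masses \<open>w n\<close> at \<open>p n\<close>, as the image under \<open>p\<close> of the measure on the
  index set with weights \<open>w\<close>.\<close>

definition point_masses :: "(nat \<Rightarrow> ennreal) \<Rightarrow> (nat \<Rightarrow> complex) \<Rightarrow> complex measure"
  where "point_masses w p = distr (density (count_space UNIV) w) borel p"

lemma emeasure_point_masses:
  assumes "E \<in> sets borel"
  shows "emeasure (point_masses w p) E = (\<Sum>n. w n * indicator E (p n))"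
proof -
  have "emeasure (point_masses w p) E
      = emeasure (density (count_space UNIV) w) (p -` E)"
    unfolding point_masses_def using assms by (subst emeasure_distr) auto
  also have "\<dots> = (\<integral>\<^sup>+ n. w n * indicator (p -` E) n \<partial>count_space UNIV)"
    by (subst emeasure_density) auto
  also have "\<dots> = (\<Sum>n. w n * indicator E (p n))"
    by (subst nn_integral_count_space_nat) (simp add: indicator_def)
  finally show ?thesis .
qed

text \<open>The partial products decrease, so the limit exists in \<open>[0, 1]\<close>; \<^const>\<open>prodinf\<close> would not
  do, since a product tending to \<open>0\<close> does not count as convergent there.\<close>

definition blaschke_dist :: "(nat \<Rightarrow> complex) \<Rightarrow> nat \<Rightarrow> real"
  where "blaschke_dist ev n =
    lim (\<lambda>K. \<Prod>k\<in>{..<K} - {n}. cmod ((ev k - ev n) / (ev k + cnj (ev n))))"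

text \<open>Division in \<^typ>\<open>ennreal\<close> gives the weight \<open>\<infinity>\<close> when \<open>\<beta> n\<close> or the product vanishes and
  \<open>Re (ev n) \<noteq> 0\<close>.\<close>

definition control_measure :: "(nat \<Rightarrow> complex) \<Rightarrow> (nat \<Rightarrow> complex) \<Rightarrow> complex measure"
  where "control_measure ev \<beta> = point_masses
    (\<lambda>n. ennreal (\<bar>Re (ev n)\<bar>\<^sup>2) / ennreal ((cmod (\<beta> n))\<^sup>2 * (blaschke_dist ev n)\<^sup>2))
    (\<lambda>n. - ev n)"

end

theory Submission
  imports Defs "HOL-Complex_Analysis.Complex_Analysis" "HOL-Real_Asymp.Real_Asymp"
begin

text \<open>Put \<open>z n = - ev n\<close>, a sequence in the right half-plane. On a Jordan block the semigroup is
\<open>exp (ev n * s)\<close> times a polynomial in \<open>s\<close>, so the coordinates of a state reached by an input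
\<open>u\<close> are, block by block, triangular combinations of the moments of \<open>u\<close> against
\<open>s ^ i * exp (- z n * s)\<close>, that is, of derivatives of the Laplace transform of \<open>u\<close> at \<open>z n\<close>.
As the coordinates of the vectors of \<open>H\<close> are exactly the square-summable sequences, exact
controllability says that this moment problem is solvable for all square-summable data
(\<open>exactly_controllable_iff\<close>).

When all blocks are simple, the problem asks for \<open>u\<close> with \<open>b n * U (z n) = y n\<close>, where \<open>U\<close> is the
Laplace transform. By duality it is solvable for all square-summable \<open>y\<close> if and only if the
exponentials \<open>cnj (b n) * exp (- cnj (z n) * s)\<close> satisfy a lower Riesz inequality
(\<open>riesz_lower_bound\<close>): necessity is the uniform boundedness principle
(\<open>lower_bound_of_interpolation\<close>); for sufficiency the minimal solutions of the finite sections
are bounded and converge (\<open>interpolation_of_lower_bound\<close>).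

The lower inequality is turned into the Carleson inequality by a reflection. Let \<open>B\<close> be the Blaschke
product with the first \<open>K\<close> nodes as zeros. On the imaginary axis \<open>f \<mapsto> B * cnj f\<close> is isometric, and
it maps the span of the reproducing kernels \<open>1 / (w + cnj (z n))\<close>, \<open>n < K\<close>, onto itself. It
exchanges coefficients and values: if \<open>a n\<close> are the coefficients of \<open>f\<close>, then the image takes the
value \<open>- cnj (a n) * B' (z n)\<close> at \<open>z n\<close>, where \<open>\<bar>B' (z n)\<bar>\<close> is the \<open>K\<close>-th partial product of \<open>d n\<close>
divided by \<open>2 * Re (z n)\<close>. So a lower bound for the norm in terms of the coefficients is an upper
bound for the weighted values in terms of the norm, which is the Carleson inequality on the span of the
kernels. By the reproducing property (\<open>hardy_dual_bound\<close>) it then holds on the whole Hardy space, and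
\<open>K \<longlonglongrightarrow> \<infinity>\<close> replaces the partial products by \<open>d n\<close>. On finitely many nodes the reflection
is an identity between rational functions, the inversion of a Cauchy matrix.

Finitely many nontrivial blocks change nothing. The coordinates at the ends of the blocks are
\<open>b (n, N n) * U (z n)\<close>, which gives the condition on \<open>b (n, N n)\<close>. Conversely, the remaining finitely
many coordinates can be corrected one after another: subtracting from an input a multiple of
its delay multiplies \<open>U w\<close> by \<open>1 - exp ((\<mu> - w) * \<tau>)\<close>, which adds a simple zero at \<open>\<mu>\<close>, keeps all
other zeros and, for suitable \<open>\<tau>\<close>, creates none at a given further node
(\<open>raise_order\<close>, \<open>block_interpolation\<close>).\<close>

section \<open>Extension, series and uniform boundedness in Banach spaces\<close>

text \<open>The closure of the graph is again the graph of a linear map: the bound survives the limit and makes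
  it single-valued, and density together with completeness makes it total. Giving the map by its
  graph allows it to be prescribed on vectors that are themselves given as images.\<close>

lemma bounded_linear_extension:
  fixes G :: "('k::real_normed_vector \<times> 'l::banach) set"
  assumes add: "\<And>x y x' y'. (x, y) \<in> G \<Longrightarrow> (x', y') \<in> G \<Longrightarrow> (x + x', y + y') \<in> G"
    and scale: "\<And>c x y. (x, y) \<in> G \<Longrightarrow> (c *\<^sub>R x, c *\<^sub>R y) \<in> G"
    and bound: "\<And>x y. (x, y) \<in> G \<Longrightarrow> norm y \<le> C * norm x"
    and dense: "closure (fst ` G) = UNIV"
  shows "\<exists>F. bounded_linear F \<and> (\<forall>x y. (x, y) \<in> G \<longrightarrow> F x = y) \<and> (\<forall>x. norm (F x) \<le> C * norm x)"
proof -
  define R where "R = closure G"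
  have R_seq: "(x, y) \<in> R \<longleftrightarrow> (\<exists>s t. (\<forall>n. (s n, t n) \<in> G) \<and> s \<longlonglongrightarrow> x \<and> t \<longlonglongrightarrow> y)" for x y
  proof
    assume "(x, y) \<in> R"
    then obtain p where p: "\<And>n. p n \<in> G" "p \<longlonglongrightarrow> (x, y)"
      unfolding R_def closure_sequential by blast
    from tendsto_fst[OF p(2)] tendsto_snd[OF p(2)] p(1)
    show "\<exists>s t. (\<forall>n. (s n, t n) \<in> G) \<and> s \<longlonglongrightarrow> x \<and> t \<longlonglongrightarrow> y"
      by (intro exI[of _ "\<lambda>n. fst (p n)"] exI[of _ "\<lambda>n. snd (p n)"]) auto
  next
    assume "\<exists>s t. (\<forall>n. (s n, t n) \<in> G) \<and> s \<longlonglongrightarrow> x \<and> t \<longlonglongrightarrow> y"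
    then obtain s t where "\<forall>n. (s n, t n) \<in> G" "s \<longlonglongrightarrow> x" "t \<longlonglongrightarrow> y" by blast
    then show "(x, y) \<in> R"
      unfolding R_def closure_sequential
      by (intro exI[of _ "\<lambda>n. (s n, t n)"]) (auto intro: tendsto_Pair)
  qed
  have R_add: "(x + x', y + y') \<in> R" if xy: "(x, y) \<in> R" and xy': "(x', y') \<in> R" for x y x' y'
  proof -
    obtain s t where st: "\<And>n. (s n, t n) \<in> G" "s \<longlonglongrightarrow> x" "t \<longlonglongrightarrow> y"
      using xy R_seq by blast
    obtain s' t' where st': "\<And>n. (s' n, t' n) \<in> G" "s' \<longlonglongrightarrow> x'" "t' \<longlonglongrightarrow> y'"
      using xy' R_seq by blast
    show ?thesis unfolding R_seq
      by (intro exI[of _ "\<lambda>n. s n + s' n"] exI[of _ "\<lambda>n. t n + t' n"])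
        (use st st' add in \<open>auto intro!: tendsto_add\<close>)
  qed
  have R_scale: "(c *\<^sub>R x, c *\<^sub>R y) \<in> R" if xy: "(x, y) \<in> R" for c x y
  proof -
    obtain s t where st: "\<And>n. (s n, t n) \<in> G" "s \<longlonglongrightarrow> x" "t \<longlonglongrightarrow> y"
      using xy R_seq by blast
    show ?thesis unfolding R_seq
      by (intro exI[of _ "\<lambda>n. c *\<^sub>R s n"] exI[of _ "\<lambda>n. c *\<^sub>R t n"])
        (use st scale in \<open>auto intro!: tendsto_intros\<close>)
  qed
  have R_bound: "norm y \<le> C * norm x" if xy: "(x, y) \<in> R" for x y
  proof -
    obtain s t where st: "\<And>n. (s n, t n) \<in> G" "s \<longlonglongrightarrow> x" "t \<longlonglongrightarrow> y"
      using xy R_seq by blast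
    show ?thesis
      by (rule LIMSEQ_le[of "\<lambda>n. norm (t n)" _ "\<lambda>n. C * norm (s n)"])
        (use st bound in \<open>auto intro!: tendsto_intros\<close>)
  qed
  have R_unique: "y = y'" if "(x, y) \<in> R" "(x, y') \<in> R" for x y y'
    using R_bound[OF R_add[OF that(1) R_scale[OF that(2), of "-1"]]] by simp
  have R_total: "\<exists>y. (x, y) \<in> R" for x
  proof -
    have "x \<in> closure (fst ` G)" using dense by simp
    then obtain s where s: "\<And>n. s n \<in> fst ` G" "s \<longlonglongrightarrow> x"
      unfolding closure_sequential by blast
    from s(1) have "\<forall>n. \<exists>y. (s n, y) \<in> G" by (metis imageE prod.collapse)
    then obtain t where t: "\<And>n. (s n, t n) \<in> G" by metis
    have diff: "norm (t m - t n) \<le> (\<bar>C\<bar> + 1) * norm (s m - s n)" for m n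
    proof -
      have "(s m - s n, t m - t n) \<in> G"
        using add[OF t[of m] scale[OF t[of n], of "-1"]] by simp
      from bound[OF this] have "norm (t m - t n) \<le> C * norm (s m - s n)" .
      also have "\<dots> \<le> (\<bar>C\<bar> + 1) * norm (s m - s n)" by (intro mult_right_mono) auto
      finally show ?thesis .
    qed
    have "Cauchy t"
    proof (rule CauchyI)
      fix e :: real assume "0 < e"
      have "Cauchy s" using s(2) by (rule LIMSEQ_imp_Cauchy)
      then obtain M where M: "\<And>m n. m \<ge> M \<Longrightarrow> n \<ge> M \<Longrightarrow> norm (s m - s n) < e / (\<bar>C\<bar> + 1)"
        using CauchyD[of s "e / (\<bar>C\<bar> + 1)"] \<open>0 < e\<close> by (auto simp: add_pos_nonneg)
      have "norm (t m - t n) < e" if "m \<ge> M" "n \<ge> M" for m n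
      proof -
        have "(\<bar>C\<bar> + 1) * norm (s m - s n) < e"
          using M[OF that] by (simp add: pos_less_divide_eq mult.commute)
        then show ?thesis using diff[of m n] by linarith
      qed
      then show "\<exists>M. \<forall>m\<ge>M. \<forall>n\<ge>M. norm (t m - t n) < e" by blast
    qed
    then obtain y where "t \<longlonglongrightarrow> y" using Cauchy_convergent_iff convergent_def by blast
    with s t show ?thesis using R_seq by blast
  qed
  define F where "F x = (SOME y. (x, y) \<in> R)" for x
  have FR: "(x, F x) \<in> R" for x unfolding F_def using R_total by (rule someI_ex)
  have F_eq: "F x = y" if "(x, y) \<in> R" for x y using FR R_unique that by blast
  have "bounded_linear F"
  proof (rule bounded_linear_intro)
    show "F (x + y) = F x + F y" for x y by (intro F_eq R_add FR)
    show "F (r *\<^sub>R x) = r *\<^sub>R F x" for r x by (intro F_eq R_scale FR)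
    show "norm (F x) \<le> norm x * C" for x using R_bound[OF FR[of x]] by (simp add: mult.commute)
  qed
  moreover have "F x = y" if "(x, y) \<in> G" for x y
    using that closure_subset F_eq unfolding R_def by blast
  ultimately show ?thesis using R_bound[OF FR] by blast
qed

text \<open>The bound makes the net of finite sums Cauchy, even when the series does not converge absolutely.\<close>

lemma has_sum_of_square_bound:
  fixes y :: "nat \<Rightarrow> 'a::banach" and t :: "nat \<Rightarrow> real"
  assumes bound: "\<And>F. finite F \<Longrightarrow> (norm (\<Sum>i\<in>F. y i))\<^sup>2 \<le> (\<Sum>i\<in>F. t i)"
    and "summable t" and t0: "\<And>i. 0 \<le> t i"
  obtains s where "(y has_sum s) UNIV"
proof -
  have tail: "\<exists>N. \<forall>F. finite F \<longrightarrow> F \<inter> {..<N} = {} \<longrightarrow> norm (\<Sum>i\<in>F. y i) < e" if "0 < e" for e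
  proof -
    obtain N where N: "\<And>m n. m \<ge> N \<Longrightarrow> norm (sum t {m..<n}) < e\<^sup>2"
      using \<open>summable t\<close> \<open>0 < e\<close> unfolding summable_Cauchy by (meson zero_less_power)
    have "norm (\<Sum>i\<in>F. y i) < e" if F: "finite F" "F \<inter> {..<N} = {}" for F
    proof -
      obtain n where n: "F \<subseteq> {..<n}" using F(1) finite_nat_iff_bounded by blast
      have "F \<subseteq> {N..<n}" using F n by force
      then have "(\<Sum>i\<in>F. t i) \<le> sum t {N..<n}" by (intro sum_mono2) (auto simp: t0)
      also have "\<dots> < e\<^sup>2" using N[of N n] by simp
      finally have "(norm (\<Sum>i\<in>F. y i))\<^sup>2 < e\<^sup>2" using bound[OF F(1)] by linarith
      then show ?thesis using \<open>0 < e\<close> by (simp add: power_less_imp_less_base)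
    qed
    then show ?thesis by blast
  qed
  have "Cauchy (\<lambda>n. \<Sum>i<n. y i)"
  proof (rule CauchyI')
    fix e :: real assume "0 < e"
    from tail[OF this] obtain N where
      N: "\<And>F. finite F \<Longrightarrow> F \<inter> {..<N} = {} \<Longrightarrow> norm (\<Sum>i\<in>F. y i) < e" by blast
    have "dist (\<Sum>i<m. y i) (\<Sum>i<n. y i) < e" if "m \<ge> N" "n > m" for m n
    proof -
      have eq: "(\<Sum>i<n. y i) - (\<Sum>i<m. y i) = (\<Sum>i\<in>{m..<n}. y i)"
        using that sum_diff_nat_ivl[of 0 m n y] by (simp add: atLeast0LessThan)
      have "norm (sum y {m..<n}) < e" using that by (intro N) auto
      then show ?thesis by (subst dist_commute) (simp only: dist_norm eq)
    qed
    then show "\<exists>M. \<forall>m\<ge>M. \<forall>n>m. dist (\<Sum>i<m. y i) (\<Sum>i<n. y i) < e" by blast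
  qed
  then obtain s where s: "(\<lambda>n. \<Sum>i<n. y i) \<longlonglongrightarrow> s"
    using Cauchy_convergent_iff convergent_def by blast
  have "(y has_sum s) UNIV"
    unfolding has_sum_def
  proof (rule tendstoI)
    fix e :: real assume "0 < e"
    then have "0 < e / 2" by simp
    from tail[OF this] obtain N where
      N: "\<And>F. finite F \<Longrightarrow> F \<inter> {..<N} = {} \<Longrightarrow> norm (\<Sum>i\<in>F. y i) < e / 2" by blast
    from s \<open>0 < e / 2\<close> obtain M where M: "\<And>n. n \<ge> M \<Longrightarrow> norm ((\<Sum>i<n. y i) - s) < e / 2"
      unfolding LIMSEQ_iff by blast
    have "dist (sum y F) s < e" if "finite F" "{..<max M N} \<subseteq> F" for F
    proof -
      have "sum y F = (\<Sum>i<max M N. y i) + sum y (F - {..<max M N})"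
        using that by (metis add.commute sum.subset_diff)
      then have "norm (sum y F - s) \<le> norm ((\<Sum>i<max M N. y i) - s) + norm (sum y (F - {..<max M N}))"
        by (metis (no_types, lifting) add_diff_eq add.commute diff_add_eq norm_triangle_ineq)
      also have "\<dots> < e" using M[of "max M N"] N[of "F - {..<max M N}"] that by fastforce
      finally show ?thesis by (simp add: dist_norm)
    qed
    then show "\<forall>\<^sub>F F in finite_subsets_at_top UNIV. dist (sum y F) s < e"
      unfolding eventually_finite_subsets_at_top by (intro exI[of _ "{..<max M N}"]) auto
  qed
  then show thesis by (rule that)
qed

text \<open>The closed sets of points where all \<open>f i\<close> are bounded by \<open>k\<close> cover the space, so by Baire one of
  them contains a ball.\<close>

lemma uniform_boundedness:
  fixes f :: "'i \<Rightarrow> 'a::banach \<Rightarrow> 'b::real_normed_vector"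
  assumes lin: "\<And>i. i \<in> I \<Longrightarrow> bounded_linear (f i)"
    and pointwise: "\<And>x. \<exists>k. \<forall>i\<in>I. norm (f i x) \<le> k"
  obtains C where "0 < C" "\<And>i x. i \<in> I \<Longrightarrow> norm (f i x) \<le> C * norm x"
proof -
  define E where "E k = {x. \<forall>i\<in>I. norm (f i x) \<le> real k}" for k :: nat
  have closed_E: "closed (E k)" for k
  proof -
    have "E k = (\<Inter>i\<in>I. {x. norm (f i x) \<le> real k})" unfolding E_def by auto
    moreover have "closed {x. norm (f i x) \<le> real k}" if "i \<in> I" for i
      by (intro closed_Collect_le continuous_on_norm continuous_on_const
          linear_continuous_on lin[OF that])
    ultimately show ?thesis by auto
  qed
  have "\<exists>k. closure (- E k) \<noteq> UNIV"
  proof (rule ccontr)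
    assume "\<not> ?thesis"
    then have dense: "closure (- E k) = UNIV" for k by blast
    have "completely_metrizable_space (euclidean :: 'a topology)"
      by (rule completely_metrizable_space_euclidean)
    then have "euclidean closure_of \<Inter>(range (\<lambda>k. - E k)) = topspace (euclidean :: 'a topology)"
        by (intro Baire_category) (use dense closed_E in \<open>auto simp: open_Compl\<close>)
    moreover have "\<Inter>(range (\<lambda>k. - E k)) = {}"
    proof -
      have "\<exists>k. x \<in> E k" for x
      proof -
        obtain k where k: "\<forall>i\<in>I. norm (f i x) \<le> k" using pointwise by blast
        have "norm (f i x) \<le> real (nat \<lceil>k\<rceil>)" if "i \<in> I" for i
          by (rule order_trans[OF bspec[OF k that] real_nat_ceiling_ge])
        then have "x \<in> E (nat \<lceil>k\<rceil>)" unfolding E_def by simp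
        then show ?thesis ..
      qed
      then show ?thesis by auto
    qed
    ultimately show False by simp
  qed
  then obtain k x where "x \<notin> closure (- E k)" by auto
  then have "x \<in> interior (E k)" by (simp add: closure_complement)
  then obtain r where r: "0 < r" "ball x r \<subseteq> E k" unfolding mem_interior by blast
  have main: "norm (f i y) \<le> (4 * real k / r + 1) * norm y" if i: "i \<in> I" for i y
  proof (cases "y = 0")
    case True
    then show ?thesis using bounded_linear.linear[OF lin[OF i]] linear_0 by simp
  next
    case False
    interpret bounded_linear "f i" by (rule lin[OF i])
    define c where "c = r / (2 * norm y)"
    have c: "c > 0" using r(1) False unfolding c_def by simp
     have cy: "norm (c *\<^sub>R y) = r / 2" unfolding c_def using False r(1) by simp
    have "x + c *\<^sub>R y \<in> ball x r" "x \<in> ball x r" using cy r(1) by (simp_all add: dist_norm)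
    then have "x + c *\<^sub>R y \<in> E k" "x \<in> E k" using r(2) by blast+
    then have "norm (f i (x + c *\<^sub>R y)) \<le> k" "norm (f i x) \<le> k" using i unfolding E_def by auto
    moreover have "norm (f i (c *\<^sub>R y)) = norm (f i (x + c *\<^sub>R y) - f i x)" by (simp add: add)
    ultimately have "norm (f i (c *\<^sub>R y)) \<le> 2 * real k"
      using norm_triangle_ineq4[of "f i (x + c *\<^sub>R y)" "f i x"] by linarith
    then have "c * norm (f i y) \<le> 2 * real k" using c by (simp add: scaleR)
    then have "norm (f i y) \<le> 2 * real k / c" using c by (simp add: pos_le_divide_eq mult.commute)
    also have "\<dots> = (4 * real k / r) * norm y" unfolding c_def using r(1) False by simp
    also have "\<dots> \<le> (4 * real k / r + 1) * norm y" by (simp add: distrib_right)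
    finally show ?thesis .
  qed
  show thesis
    by (rule that[of "4 * real k / r + 1"]) (use main r(1) in \<open>auto intro!: add_nonneg_pos\<close>)
qed

section \<open>Square-integrable functions\<close>

text \<open>Functions rather than classes modulo null sets, because admissible inputs are functions.\<close>

definition L2 :: "'a measure \<Rightarrow> ('a \<Rightarrow> complex) set"
  where "L2 M = {f \<in> borel_measurable M. integrable M (\<lambda>x. (cmod (f x))\<^sup>2)}"

definition L2_norm_sq :: "'a measure \<Rightarrow> ('a \<Rightarrow> complex) \<Rightarrow> real"
  where "L2_norm_sq M f = (\<integral>x. (cmod (f x))\<^sup>2 \<partial>M)"

lemma L2_norm_sq_nonneg: "0 \<le> L2_norm_sq M f"
  unfolding L2_norm_sq_def by simp

lemma L2_measurable: "f \<in> L2 M \<Longrightarrow> f \<in> borel_measurable M"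
  unfolding L2_def by simp

lemma L2_integrable: "f \<in> L2 M \<Longrightarrow> integrable M (\<lambda>x. (cmod (f x))\<^sup>2)"
  unfolding L2_def by simp

lemma L2_bound:
  assumes "f \<in> borel_measurable M" "integrable M g" "\<And>x. x \<in> space M \<Longrightarrow> (cmod (f x))\<^sup>2 \<le> g x"
  shows "f \<in> L2 M"
proof -
  have "integrable M (\<lambda>x. (cmod (f x))\<^sup>2)"
  proof (rule Bochner_Integration.integrable_bound[OF assms(2)])
    show "AE x in M. norm ((cmod (f x))\<^sup>2) \<le> norm (g x)"
      using assms(3) by (intro AE_I2) force
  qed (use assms(1) in measurable)
  then show ?thesis using assms(1) unfolding L2_def by simp
qed

lemma L2_mult_const: "f \<in> L2 M \<Longrightarrow> (\<lambda>x. c * f x) \<in> L2 M"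
  unfolding L2_def by (auto simp: norm_mult power_mult_distrib)

lemma norm_add_sq_le: "(norm (a + b))\<^sup>2 \<le> 2 * (norm a)\<^sup>2 + 2 * (norm b)\<^sup>2" for a b :: "'a::real_normed_vector"
proof -
  have "(norm (a + b))\<^sup>2 \<le> (norm a + norm b)\<^sup>2" by (intro power_mono norm_triangle_ineq) simp
  also have "\<dots> \<le> 2 * (norm a)\<^sup>2 + 2 * (norm b)\<^sup>2"
    using sum_squares_bound[of "norm a" "norm b"] by (simp add: power2_sum)
  finally show ?thesis .
qed

lemma L2_add:
  assumes f: "f \<in> L2 M" and g: "g \<in> L2 M"
  shows "(\<lambda>x. f x + g x) \<in> L2 M"
proof (rule L2_bound[where g = "\<lambda>x. 2 * (cmod (f x))\<^sup>2 + 2 * (cmod (g x))\<^sup>2"])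
  show "(\<lambda>x. f x + g x) \<in> borel_measurable M"
    by (intro borel_measurable_add L2_measurable f g)
qed (use f g in \<open>auto simp: L2_integrable norm_add_sq_le\<close>)

lemma L2_diff: "f \<in> L2 M \<Longrightarrow> g \<in> L2 M \<Longrightarrow> (\<lambda>x. f x - g x) \<in> L2 M"
  using L2_add[OF _ L2_mult_const[of g M "-1"]] by simp

lemma L2_zero: "(\<lambda>x. 0) \<in> L2 M"
  unfolding L2_def by simp

lemma L2_sum: "(\<And>i. i \<in> I \<Longrightarrow> f i \<in> L2 M) \<Longrightarrow> (\<lambda>x. \<Sum>i\<in>I. f i x) \<in> L2 M"
  by (induction I rule: infinite_finite_induct) (auto intro: L2_add simp: L2_zero)

lemma L2_cnj: "f \<in> L2 M \<Longrightarrow> (\<lambda>x. cnj (f x)) \<in> L2 M"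
  unfolding L2_def by (auto intro!: borel_measurable_continuous_on[where f = cnj] continuous_intros)

lemma L2_integrable_mult:
  assumes "f \<in> L2 M" "g \<in> L2 M"
  shows "integrable M (\<lambda>x. f x * g x)"
proof (rule Bochner_Integration.integrable_bound)
  show "integrable M (\<lambda>x. (cmod (f x))\<^sup>2 + (cmod (g x))\<^sup>2)"
    using assms by (auto simp: L2_integrable)
  show "AE x in M. cmod (f x * g x) \<le> norm ((cmod (f x))\<^sup>2 + (cmod (g x))\<^sup>2)"
  proof (rule AE_I2)
    fix x
    have "2 * (cmod (f x) * cmod (g x)) \<le> (cmod (f x))\<^sup>2 + (cmod (g x))\<^sup>2"
      using sum_squares_bound[of "cmod (f x)" "cmod (g x)"] by simp
    moreover have "0 \<le> cmod (f x) * cmod (g x)" by simp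
    ultimately show "cmod (f x * g x) \<le> norm ((cmod (f x))\<^sup>2 + (cmod (g x))\<^sup>2)"
      by (simp only: norm_mult real_norm_def abs_of_nonneg[OF add_nonneg_nonneg[OF zero_le_power2 zero_le_power2]])
  qed
qed (intro borel_measurable_times L2_measurable assms)

lemma L2_Cauchy_Schwarz:
  assumes f: "f \<in> L2 M" and g: "g \<in> L2 M"
  shows "(cmod (\<integral>x. f x * g x \<partial>M))\<^sup>2 \<le> L2_norm_sq M f * L2_norm_sq M g"
proof -
  have "cmod (\<integral>x. f x * g x \<partial>M) \<le> (\<integral>x. cmod (f x) * cmod (g x) \<partial>M)"
    using integral_norm_bound[of M "\<lambda>x. f x * g x"] by (simp add: norm_mult)
  then have "(cmod (\<integral>x. f x * g x \<partial>M))\<^sup>2 \<le> (\<integral>x. cmod (f x) * cmod (g x) \<partial>M)\<^sup>2"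
    by (simp add: power_mono)
  also have "\<dots> \<le> L2_norm_sq M f * L2_norm_sq M g"
  proof -
    have int: "integrable M (\<lambda>x. cmod (f x) * cmod (g x))"
      using integrable_norm[OF L2_integrable_mult[OF f g]] by (simp add: norm_mult)
    have "ennreal ((\<integral>x. cmod (f x) * cmod (g x) \<partial>M)\<^sup>2) = (\<integral>\<^sup>+x. ennreal (cmod (f x)) * ennreal (cmod (g x)) \<partial>M)\<^sup>2"
      using nn_integral_eq_integral[OF int] by (simp add: ennreal_mult ennreal_power)
    also have "\<dots> \<le> (\<integral>\<^sup>+x. (ennreal (cmod (f x)))\<^sup>2 \<partial>M) * (\<integral>\<^sup>+x. (ennreal (cmod (g x)))\<^sup>2 \<partial>M)"
      using L2_measurable[OF f] L2_measurable[OF g] by (intro Cauchy_Schwarz_nn_integral) auto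
    also have "\<dots> = ennreal (L2_norm_sq M f) * ennreal (L2_norm_sq M g)"
      using nn_integral_eq_integral[OF L2_integrable[OF f]] nn_integral_eq_integral[OF L2_integrable[OF g]]
      by (simp add: L2_norm_sq_def ennreal_power)
    also have "\<dots> = ennreal (L2_norm_sq M f * L2_norm_sq M g)"
      by (simp add: ennreal_mult L2_norm_sq_nonneg)
    finally show ?thesis
      by (subst (asm) ennreal_le_iff) (simp_all add: L2_norm_sq_nonneg)
  qed
  finally show ?thesis .
qed

lemma L2_norm_sq_eq: "f \<in> L2 M \<Longrightarrow> complex_of_real (L2_norm_sq M f) = (\<integral>x. f x * cnj (f x) \<partial>M)"
  unfolding L2_norm_sq_def by (subst integral_complex_of_real[symmetric]) (simp add: complex_norm_square del: of_real_power)

text \<open>Along a subsequence with increments of squared norm at most \<open>(1/4) ^ j\<close> the weighted sum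
  of the squared increments is integrable, which forces absolute convergence almost everywhere;
  Fatou's lemma identifies the pointwise limit with the limit in norm.\<close>

lemma L2_complete:
  fixes u :: "nat \<Rightarrow> 'a \<Rightarrow> complex"
  assumes u: "\<And>n. u n \<in> L2 M"
    and Cauchy: "\<And>e. 0 < e \<Longrightarrow> \<exists>N. \<forall>m\<ge>N. \<forall>n\<ge>N. L2_norm_sq M (\<lambda>x. u m x - u n x) \<le> e"
  obtains v where "v \<in> L2 M" "(\<lambda>n. L2_norm_sq M (\<lambda>x. u n x - v x)) \<longlonglongrightarrow> 0"
proof -
  note [measurable] = L2_measurable[OF u]
  have nn: "(\<integral>\<^sup>+x. ennreal ((cmod (u m x - u n x))\<^sup>2) \<partial>M) = ennreal (L2_norm_sq M (\<lambda>x. u m x - u n x))" for m n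
    unfolding L2_norm_sq_def using L2_integrable[OF L2_diff[OF u u]] by (intro nn_integral_eq_integral) auto
  have "\<forall>j. \<exists>N. \<forall>m\<ge>N. \<forall>n\<ge>N. L2_norm_sq M (\<lambda>x. u m x - u n x) \<le> (1/4) ^ j"
    using Cauchy by simp
  then obtain r0 where r0: "\<And>j m n. r0 j \<le> m \<Longrightarrow> r0 j \<le> n \<Longrightarrow> L2_norm_sq M (\<lambda>x. u m x - u n x) \<le> (1/4) ^ j"
    by metis
  define r where "r j = (\<Sum>i\<le>j. r0 i) + j" for j
  have r0_le: "r0 j \<le> (\<Sum>i\<le>j. r0 i)" for j
    by (rule member_le_sum) auto
  have r_ge: "r0 j \<le> r j" "r0 j \<le> r (Suc j)" "j \<le> r j" for j
    using r0_le[of j] unfolding r_def by auto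
  let ?V = "\<lambda>j x. u (r (Suc j)) x - u (r j) x"
  have "(\<integral>\<^sup>+x. (\<Sum>j. ennreal (2 ^ j * (cmod (?V j x))\<^sup>2)) \<partial>M) = (\<Sum>j. \<integral>\<^sup>+x. ennreal (2 ^ j * (cmod (?V j x))\<^sup>2) \<partial>M)"
    by (rule nn_integral_suminf) measurable
  also have "\<dots> = (\<Sum>j. ennreal (2 ^ j * L2_norm_sq M (?V j)))"
    by (simp add: ennreal_mult nn_integral_cmult nn L2_norm_sq_nonneg)
  also have "\<dots> \<le> (\<Sum>j. ennreal ((1/2) ^ j))"
  proof (intro suminf_le ennreal_leI)
    fix j
    have "2 ^ j * L2_norm_sq M (?V j) \<le> 2 ^ j * (1/4) ^ j"
      by (intro mult_left_mono r0) (auto simp: r_ge)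
    also have "\<dots> = (1/2::real) ^ j" by (simp add: power_mult_distrib[symmetric])
    finally show "2 ^ j * L2_norm_sq M (?V j) \<le> (1/2) ^ j" .
  qed auto
  also have "\<dots> < \<infinity>" by (subst suminf_ennreal2) (auto intro: summable_geometric)
  finally have "AE x in M. (\<Sum>j. ennreal (2 ^ j * (cmod (?V j x))\<^sup>2)) \<noteq> \<infinity>"
    by (intro nn_integral_PInf_AE) auto
  then have AE_conv: "AE x in M. convergent (\<lambda>j. u (r j) x)"
  proof (rule AE_mp, intro AE_I2 impI)
    fix x assume "(\<Sum>j. ennreal (2 ^ j * (cmod (?V j x))\<^sup>2)) \<noteq> \<infinity>"
    then have sm: "summable (\<lambda>j. 2 ^ j * (cmod (?V j x))\<^sup>2)"
      by (intro summable_suminf_not_top) (auto simp: infinity_ennreal_def)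
    have "summable (\<lambda>j. (1/2) ^ j + 2 ^ j * (cmod (?V j x))\<^sup>2)"
      by (intro summable_add sm summable_geometric) simp
    moreover have "norm (?V j x) \<le> (1/2) ^ j + 2 ^ j * (cmod (?V j x))\<^sup>2" for j
    proof (cases "cmod (?V j x) \<le> (1/2) ^ j")
      case True
      then show ?thesis by (simp add: add_increasing2)
    next
      case False
      then have "2 ^ j * (1/2) ^ j \<le> 2 ^ j * cmod (?V j x)" by (intro mult_left_mono) auto
      then have "1 \<le> 2 ^ j * cmod (?V j x)" by (simp add: power_mult_distrib[symmetric])
      then have "1 * cmod (?V j x) \<le> 2 ^ j * cmod (?V j x) * cmod (?V j x)" by (intro mult_right_mono) auto
      then have "cmod (?V j x) \<le> 2 ^ j * (cmod (?V j x))\<^sup>2" by (simp add: power2_eq_square mult_ac)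
      then show ?thesis by (simp add: add_increasing)
    qed
    ultimately have "summable (\<lambda>j. ?V j x)" by (rule summable_comparison_test')
    then have "convergent (\<lambda>n. \<Sum>j<n. ?V j x)" by (simp add: summable_iff_convergent)
    then have "convergent (\<lambda>n. u (r n) x - u (r 0) x)" 
      by (simp add: sum_lessThan_telescope[of "\<lambda>j. u (r j) x"])
    then show "convergent (\<lambda>j. u (r j) x)"
      using convergent_add[OF _ convergent_const[of "u (r 0) x"], of "\<lambda>n. u (r n) x - u (r 0) x"] by simp
  qed
  define v where "v x = lim (\<lambda>j. u (r j) x)" for x
  have v_meas[measurable]: "v \<in> borel_measurable M" unfolding v_def[abs_def] by measurable
  have est: "(\<integral>\<^sup>+x. ennreal ((cmod (u n x - v x))\<^sup>2) \<partial>M) \<le> ennreal e"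
    if N: "\<forall>m\<ge>N. \<forall>n\<ge>N. L2_norm_sq M (\<lambda>x. u m x - u n x) \<le> e" and n: "n \<ge> N" for n e N
  proof -
    have "(\<integral>\<^sup>+x. ennreal ((cmod (u n x - v x))\<^sup>2) \<partial>M)
        = (\<integral>\<^sup>+x. liminf (\<lambda>j. ennreal ((cmod (u n x - u (r j) x))\<^sup>2)) \<partial>M)"
    proof (rule nn_integral_cong_AE, use AE_conv in \<open>rule AE_mp\<close>, intro AE_I2 impI)
      fix x assume "convergent (\<lambda>j. u (r j) x)"
      then have "(\<lambda>j. u (r j) x) \<longlonglongrightarrow> v x" unfolding v_def by (simp add: convergent_LIMSEQ_iff)
      then have "(\<lambda>j. ennreal ((cmod (u n x - u (r j) x))\<^sup>2)) \<longlonglongrightarrow> ennreal ((cmod (u n x - v x))\<^sup>2)"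
        by (intro tendsto_intros) auto
      then show "ennreal ((cmod (u n x - v x))\<^sup>2) = liminf (\<lambda>j. ennreal ((cmod (u n x - u (r j) x))\<^sup>2))"
        by (rule lim_imp_Liminf[OF sequentially_bot, symmetric])
    qed
    also have "\<dots> \<le> liminf (\<lambda>j. \<integral>\<^sup>+x. ennreal ((cmod (u n x - u (r j) x))\<^sup>2) \<partial>M)"
      by (rule nn_integral_liminf) measurable
    also have "\<dots> \<le> ennreal e"
    proof (rule Liminf_le)
      have "\<forall>\<^sub>F j in sequentially. j \<ge> N" by (rule eventually_ge_at_top)
      then show "\<forall>\<^sub>F j in sequentially. (\<integral>\<^sup>+x. ennreal ((cmod (u n x - u (r j) x))\<^sup>2) \<partial>M) \<le> ennreal e"
      proof eventually_elim
        case (elim j)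
        then have "N \<le> r j" using r_ge(3)[of j] by linarith
        then show ?case using N n by (auto simp: nn intro!: ennreal_leI)
      qed
    qed simp
    finally show ?thesis .
  qed
  have diff: "(\<lambda>x. u n x - v x) \<in> L2 M" if "\<forall>m\<ge>n. \<forall>k\<ge>n. L2_norm_sq M (\<lambda>x. u m x - u k x) \<le> 1" for n
    unfolding L2_def using est[OF that order_refl]
    by (auto simp: integrable_iff_bounded power_abs intro: le_less_trans)
  obtain N1 where N1: "\<forall>m\<ge>N1. \<forall>k\<ge>N1. L2_norm_sq M (\<lambda>x. u m x - u k x) \<le> 1" using Cauchy[of 1] by auto
  have v: "v \<in> L2 M" using L2_diff[OF u[of N1] diff[OF N1]] by simp
  moreover have "(\<lambda>n. L2_norm_sq M (\<lambda>x. u n x - v x)) \<longlonglongrightarrow> 0"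
  proof (rule LIMSEQ_I)
    fix e :: real assume "0 < e"
    then obtain N where N: "\<forall>m\<ge>N. \<forall>n\<ge>N. L2_norm_sq M (\<lambda>x. u m x - u n x) \<le> e / 2"
      using Cauchy[of "e/2"] by auto
    have "norm (L2_norm_sq M (\<lambda>x. u n x - v x) - 0) < e" if "n \<ge> N" for n
    proof -
      have "ennreal (L2_norm_sq M (\<lambda>x. u n x - v x)) \<le> ennreal (e/2)"
        using est[OF N that] nn_integral_eq_integral[OF L2_integrable[OF L2_diff[OF u v]]]
        by (simp add: L2_norm_sq_def)
      then have "L2_norm_sq M (\<lambda>x. u n x - v x) \<le> e/2"
        using \<open>0 < e\<close> by (subst (asm) ennreal_le_iff) auto
      then show ?thesis using \<open>0 < e\<close> L2_norm_sq_nonneg[of M "\<lambda>x. u n x - v x"] by simp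
    qed
    then show "\<exists>N. \<forall>n\<ge>N. norm (L2_norm_sq M (\<lambda>x. u n x - v x) - 0) < e" by blast
  qed
  ultimately show thesis by (rule that)
qed

section \<open>Reflection in a finite Blaschke product\<close>

text \<open>A combination of the reproducing kernels of the Hardy space at the points \<open>z n\<close>.\<close>

definition kernel_sum :: "(nat \<Rightarrow> complex) \<Rightarrow> nat \<Rightarrow> (nat \<Rightarrow> complex) \<Rightarrow> complex \<Rightarrow> complex"
  where "kernel_sum z K a w = (\<Sum>n<K. a n / (w + cnj (z n)))"

text \<open>The Gram form of the kernels: the value of a function at \<open>z m\<close> is its inner product with the
  \<open>m\<close>-th kernel.\<close>

definition gram_form :: "(nat \<Rightarrow> complex) \<Rightarrow> nat \<Rightarrow> (nat \<Rightarrow> complex) \<Rightarrow> complex"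
  where "gram_form z K a = (\<Sum>m<K. cnj (a m) * kernel_sum z K a (z m))"

text \<open>The derivative at \<open>z n\<close> of the Blaschke product with zeros \<open>z k\<close>, \<open>k < K\<close>.\<close>

definition blaschke_deriv :: "(nat \<Rightarrow> complex) \<Rightarrow> nat \<Rightarrow> nat \<Rightarrow> complex"
  where "blaschke_deriv z K n = (\<Prod>k\<in>{..<K} - {n}. z n - z k) / (\<Prod>k<K. z n + cnj (z k))"

text \<open>The coefficients of \<open>B * cnj f\<close>, where \<open>f\<close> is the kernel sum with coefficients \<open>a\<close>. The
  reflection is an involution that exchanges coefficients and values, so the \<open>m\<close>-th new coefficient is
  read off from the old value at \<open>z m\<close>.\<close>

definition reflection :: "(nat \<Rightarrow> complex) \<Rightarrow> nat \<Rightarrow> (nat \<Rightarrow> complex) \<Rightarrow> nat \<Rightarrow> complex"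
  where "reflection z K a m = - cnj (kernel_sum z K a (z m) / blaschke_deriv z K m)"

lemma add_cnj_neq_0:
  assumes "0 < Re w" "0 < Re v"
  shows "w + cnj v \<noteq> 0" "cnj w + v \<noteq> 0"
  using assms by (auto simp: complex_eq_iff)

lemma kernel_sum_mult_prod:
  assumes "\<And>k. k < K \<Longrightarrow> w + cnj (z k) \<noteq> 0"
  shows "kernel_sum z K a w * (\<Prod>k<K. w + cnj (z k)) =
    (\<Sum>n<K. a n * (\<Prod>k\<in>{..<K} - {n}. w + cnj (z k)))"
  unfolding kernel_sum_def sum_distrib_right
proof (rule sum.cong[OF refl])
  fix n assume n: "n \<in> {..<K}"
  then have "(\<Prod>k<K. w + cnj (z k)) = (w + cnj (z n)) * (\<Prod>k\<in>{..<K} - {n}. w + cnj (z k))"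
    by (intro prod.remove) auto
  then show "a n / (w + cnj (z n)) * (\<Prod>k<K. w + cnj (z k)) = a n * (\<Prod>k\<in>{..<K} - {n}. w + cnj (z k))"
    using assms[of n] n by simp
qed

lemma blaschke_deriv_neq_0:
  assumes "inj_on z {..<K}" "\<And>k. k < K \<Longrightarrow> 0 < Re (z k)" "n < K"
  shows "blaschke_deriv z K n \<noteq> 0"
  using assms add_cnj_neq_0(1)[OF assms(2)[OF assms(3)] assms(2)] unfolding blaschke_deriv_def
  by (auto simp: inj_on_def)

text \<open>Partial fractions. After multiplication by \<open>\<Prod>k<K. w + cnj (z k)\<close> both sides are
  polynomials of degree less than \<open>K\<close>, so it suffices to compare them at the \<open>K\<close> points
  \<open>- cnj (z j)\<close>. There one term of the left-hand sum survives, and the right-hand side is, up to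
  conjugation and an explicit factor, a kernel sum at \<open>z j\<close>.\<close>

lemma kernel_sum_reflection:
  assumes inj: "inj_on z {..<K}" and pos: "\<And>k. k < K \<Longrightarrow> 0 < Re (z k)"
    and w: "\<And>k. k < K \<Longrightarrow> w + cnj (z k) \<noteq> 0"
  shows "kernel_sum z K (reflection z K a) w =
    - (\<Sum>n<K. cnj (a n) * (\<Prod>k\<in>{..<K} - {n}. w - z k)) / (\<Prod>k<K. w + cnj (z k))"
proof -
  let ?a' = "reflection z K a"
  define p where "p = - (\<Sum>n<K. smult (cnj (a n)) (\<Prod>k\<in>{..<K} - {n}. [:- z k, 1:]))"
  define q where "q = (\<Sum>n<K. smult (?a' n) (\<Prod>k\<in>{..<K} - {n}. [:cnj (z k), 1:]))"
  have poly_p: "poly p x = - (\<Sum>n<K. cnj (a n) * (\<Prod>k\<in>{..<K} - {n}. x - z k))" for x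
    unfolding p_def by (simp add: poly_sum poly_prod)
  have poly_q: "poly q x = (\<Sum>n<K. ?a' n * (\<Prod>k\<in>{..<K} - {n}. x + cnj (z k)))" for x
    unfolding q_def by (simp add: poly_sum poly_prod add.commute)
  have deg_prod: "degree (\<Prod>k\<in>{..<K} - {n}. [:c k, 1:]) \<le> K - 1" if "n < K" for c :: "nat \<Rightarrow> complex" and n
  proof -
    have "degree (\<Prod>k\<in>{..<K} - {n}. [:c k, 1:]) \<le> (\<Sum>k\<in>{..<K} - {n}. degree [:c k, 1:])"
      by (rule degree_prod_sum_le[unfolded comp_def]) simp
    also have "\<dots> = K - 1" using that by simp
    finally show ?thesis .
  qed
  have deg_smult: "degree (smult b (\<Prod>k\<in>{..<K} - {n}. [:c k, 1:])) \<le> K - 1"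
    if "n \<in> {..<K}" for b and c :: "nat \<Rightarrow> complex" and n
    using that by (intro order_trans[OF degree_smult_le deg_prod]) simp
  have deg_p: "degree p \<le> K - 1" unfolding p_def degree_minus
    by (intro degree_sum_le deg_smult) auto
  have deg_q: "degree q \<le> K - 1" unfolding q_def
    by (intro degree_sum_le deg_smult) auto
  have eq: "poly p (- cnj (z j)) = poly q (- cnj (z j))" if j: "j < K" for j
  proof -
    have z0: "cnj (z j) + z k \<noteq> 0" "z j + cnj (z k) \<noteq> 0" if "k < K" for k
      using add_cnj_neq_0[OF pos[OF j] pos[OF that]] by auto
    have neg: "(\<Prod>k\<in>{..<K} - {n}. - f k) = (- 1) ^ (K - 1) * (\<Prod>k\<in>{..<K} - {n}. f k)"
      if "n < K" for n and f :: "nat \<Rightarrow> complex"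
      using that by (simp add: prod.distrib[symmetric] prod_constant[symmetric] del: prod_constant)
         (simp add: prod_uminus)
    have D0: "(\<Prod>k\<in>{..<K} - {j}. cnj (z j) - cnj (z k)) \<noteq> 0"
      using inj j by (auto simp: inj_on_def)
    have "poly p (- cnj (z j)) =
        - (\<Sum>n<K. cnj (a n) * ((- 1) ^ (K - 1) * (\<Prod>k\<in>{..<K} - {n}. cnj (z j) + z k)))"
    proof -
      have "(\<Prod>k\<in>{..<K} - {n}. - cnj (z j) - z k) =
          (- 1) ^ (K - 1) * (\<Prod>k\<in>{..<K} - {n}. cnj (z j) + z k)" if "n < K" for n
        using neg[OF that, of "\<lambda>k. cnj (z j) + z k"] by (simp only: minus_add_distrib diff_conv_add_uminus)
      then show ?thesis unfolding poly_p by simp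
    qed
    also have "\<dots> = - ((- 1) ^ (K - 1) * cnj (\<Sum>n<K. a n * (\<Prod>k\<in>{..<K} - {n}. z j + cnj (z k))))"
      by (simp add: sum_distrib_left mult_ac)
    also have "\<dots> = - ((- 1) ^ (K - 1) * cnj (kernel_sum z K a (z j) * (\<Prod>k<K. z j + cnj (z k))))"
      by (subst kernel_sum_mult_prod) (use z0 in auto)
    also have "\<dots> = ?a' j * ((- 1) ^ (K - 1) * (\<Prod>k\<in>{..<K} - {j}. cnj (z j) - cnj (z k)))"
      unfolding reflection_def blaschke_deriv_def using D0 by simp
    also have "\<dots> = ?a' j * (\<Prod>k\<in>{..<K} - {j}. - cnj (z j) + cnj (z k))"
      using neg[OF j, of "\<lambda>k. cnj (z j) - cnj (z k)"] by simp
    also have "\<dots> = poly q (- cnj (z j))"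
    proof -
      have "(\<Prod>k\<in>{..<K} - {n}. - cnj (z j) + cnj (z k)) = 0" if "n < K" "n \<noteq> j" for n
        using that j by auto
      then have "poly q (- cnj (z j)) =
          (\<Sum>n<K. if n = j then ?a' j * (\<Prod>k\<in>{..<K} - {j}. - cnj (z j) + cnj (z k)) else 0)"
        unfolding poly_q by (intro sum.cong) auto
      then show ?thesis using j by simp
    qed
    finally show ?thesis .
  qed
  have "p = q"
  proof (cases "K = 0")
    case True
    then show ?thesis unfolding p_def q_def by simp
  next
    case False
    have "inj_on (\<lambda>j. - cnj (z j)) {..<K}" using inj by (auto simp: inj_on_def)
    then have "card ((\<lambda>j. - cnj (z j)) ` {..<K}) = K" by (simp add: card_image)
    then show ?thesis
      by (intro poly_eqI_degree[of "(\<lambda>j. - cnj (z j)) ` {..<K}"]) (use eq deg_p deg_q False in auto)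
  qed
  then have "kernel_sum z K ?a' w * (\<Prod>k<K. w + cnj (z k)) = poly p w"
    using kernel_sum_mult_prod[of K w z ?a'] w poly_q[of w] by simp
  moreover have "(\<Prod>k<K. w + cnj (z k)) \<noteq> 0" using w by simp
  ultimately show ?thesis unfolding poly_p by (simp add: field_simps)
qed

lemma kernel_sum_reflection_node:
  assumes inj: "inj_on z {..<K}" and pos: "\<And>k. k < K \<Longrightarrow> 0 < Re (z k)" and m: "m < K"
  shows "kernel_sum z K (reflection z K a) (z m) = - cnj (a m) * blaschke_deriv z K m"
proof -
  have "(\<Prod>k\<in>{..<K} - {n}. z m - z k) = 0" if "n \<noteq> m" for n
    using that m by auto
  then have "(\<Sum>n<K. cnj (a n) * (\<Prod>k\<in>{..<K} - {n}. z m - z k)) =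
      (\<Sum>n<K. if n = m then cnj (a m) * (\<Prod>k\<in>{..<K} - {m}. z m - z k) else 0)"
    by (intro sum.cong) auto
  then show ?thesis
    using m add_cnj_neq_0(1)[OF pos pos]
    by (subst kernel_sum_reflection[OF inj pos]) (auto simp: blaschke_deriv_def)
qed

text \<open>Termwise, coefficient and value trade places.\<close>

lemma gram_form_reflection:
  assumes inj: "inj_on z {..<K}" and pos: "\<And>k. k < K \<Longrightarrow> 0 < Re (z k)"
  shows "gram_form z K (reflection z K a) = gram_form z K a"
  unfolding gram_form_def
proof (rule sum.cong[OF refl])
  fix m assume "m \<in> {..<K}"
  then have m: "m < K" by simp
  show "cnj (reflection z K a m) * kernel_sum z K (reflection z K a) (z m) =
      cnj (a m) * kernel_sum z K a (z m)"
    using blaschke_deriv_neq_0[OF inj pos m]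
    by (simp add: kernel_sum_reflection_node[OF inj pos m]) (simp add: reflection_def)
qed

lemma norm_blaschke_deriv:
  assumes n: "n < K" and pos: "0 < Re (z n)"
  shows "cmod (blaschke_deriv z K n) =
    (\<Prod>k\<in>{..<K} - {n}. cmod ((z n - z k) / (z n + cnj (z k)))) / (2 * Re (z n))"
proof -
  have "(\<Prod>k<K. cmod (z n + cnj (z k))) = cmod (z n + cnj (z n)) * (\<Prod>k\<in>{..<K} - {n}. cmod (z n + cnj (z k)))"
    using n by (intro prod.remove) auto
  moreover have "cmod (z n + cnj (z n)) = 2 * Re (z n)"
    using pos by (simp add: complex_add_cnj)
  ultimately show ?thesis unfolding blaschke_deriv_def
    by (simp add: norm_divide prod_norm[symmetric] prod_dividef)
qed

section \<open>Two integrals and the half-line\<close>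

lemma DERIV_arctan_affine:
  fixes c d :: real
  assumes "0 < c"
  shows "((\<lambda>y. arctan ((y + d) / c)) has_real_derivative c / (c\<^sup>2 + (y + d)\<^sup>2)) (at y)"
proof -
  have pos: "0 < c\<^sup>2 + (y + d)\<^sup>2" using assms by (intro add_pos_nonneg) auto
  have "((\<lambda>y. arctan ((y + d) / c)) has_real_derivative inverse (1 + ((y + d) / c)\<^sup>2) * (1 / c)) (at y)"
    by (rule DERIV_chain2[OF DERIV_arctan]) (use assms in \<open>auto intro!: derivative_eq_intros\<close>)
  moreover have "1 + ((y + d) / c)\<^sup>2 = (c\<^sup>2 + (y + d)\<^sup>2) / c\<^sup>2"
    using assms by (simp add: power_divide add_divide_distrib[of "c\<^sup>2"])
  ultimately show ?thesis using assms pos by (simp add: power2_eq_square[of c])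
qed

lemma DERIV_ln_quadratic:
  fixes c d :: real
  assumes "0 < c"
  shows "((\<lambda>y. ln (c\<^sup>2 + (y + d)\<^sup>2) / 2) has_real_derivative (y + d) / (c\<^sup>2 + (y + d)\<^sup>2)) (at y)"
proof -
  have pos: "0 < c\<^sup>2 + (y + d)\<^sup>2" using assms by (intro add_pos_nonneg) auto
  have "((\<lambda>y. c\<^sup>2 + (y + d)\<^sup>2) has_real_derivative 2 * (y + d)) (at y)"
    by (auto intro!: derivative_eq_intros)
  from DERIV_cdivide[OF DERIV_chain2[OF DERIV_ln_divide[OF pos] this], of 2]
  have "((\<lambda>y. ln (c\<^sup>2 + (y + d)\<^sup>2) / 2) has_real_derivative
      1 / (c\<^sup>2 + (y + d)\<^sup>2) * (2 * (y + d)) / 2) (at y)" .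
  moreover have "1 / r * (2 * x) / 2 = x / r" for r x :: real
    by simp
  ultimately show ?thesis by (simp only:)
qed

lemma Re_Im_inverse_complex:
  "Re (1 / w) = Re w / (cmod w)\<^sup>2" "Im (1 / w) = - Im w / (cmod w)\<^sup>2"
  by (simp_all add: complex_div_cnj[of 1 w])

text \<open>The squared norm of a kernel on a vertical line.\<close>

lemma inverse_quadratic_integrable:
  fixes c d :: real
  assumes "0 < c"
  shows "integrable lborel (\<lambda>y. 1 / (c\<^sup>2 + (y + d)\<^sup>2))"
    and "(\<integral>y. 1 / (c\<^sup>2 + (y + d)\<^sup>2) \<partial>lborel) = pi / c"
proof -
  let ?f = "\<lambda>y. 1 / (c\<^sup>2 + (y + d)\<^sup>2)" and ?F = "\<lambda>y. arctan ((y + d) / c) / c"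
  have pos: "0 < c\<^sup>2 + (y + d)\<^sup>2" for y using assms by (intro add_pos_nonneg) auto
  have deriv: "DERIV ?F y :> ?f y" for y
    using DERIV_cdivide[OF DERIV_arctan_affine[OF assms], of d c y] assms by simp
  have lims: "((?F \<circ> real_of_ereal) \<longlongrightarrow> - (pi / 2) / c) (at_right (- \<infinity>))"
      "((?F \<circ> real_of_ereal) \<longlongrightarrow> (pi / 2) / c) (at_left \<infinity>)"
  proof -
    have "((\<lambda>y. arctan ((y + d) / c)) \<longlongrightarrow> - (pi / 2)) at_bot"
      "((\<lambda>y. arctan ((y + d) / c)) \<longlongrightarrow> pi / 2) at_top"
      using assms by real_asymp+
    from this[THEN tendsto_divide[OF _ tendsto_const, of _ _ _ c]]
    show "((?F \<circ> real_of_ereal) \<longlongrightarrow> - (pi / 2) / c) (at_right (- \<infinity>))"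
      "((?F \<circ> real_of_ereal) \<longlongrightarrow> (pi / 2) / c) (at_left \<infinity>)"
      unfolding ereal_tendsto_simps using assms by simp_all
  qed
  have cont: "isCont ?f y" for y using pos[of y] by (intro continuous_intros) auto
  note FTC = interval_integral_FTC_nonneg[of "- \<infinity>" "\<infinity>" ?F ?f, OF _ deriv cont _ lims]
  have "set_integrable lborel (einterval (- \<infinity>) \<infinity>) ?f"
    using pos by (intro FTC(1)) (auto intro!: AE_I2 less_imp_le)
  then show "integrable lborel ?f" by (simp add: set_integrable_def)
  have "(LBINT y=-\<infinity>..\<infinity>. ?f y) = (pi / 2) / c - (- (pi / 2) / c)"
    using pos by (intro FTC(2)) (auto intro!: AE_I2 less_imp_le)
  then show "(\<integral>y. ?f y \<partial>lborel) = pi / c"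
    by (simp add: interval_lebesgue_integral_def set_lebesgue_integral_def)
qed

lemma cmod_vertical_line:
  fixes p :: complex
  shows "(cmod (\<i> * of_real y + p))\<^sup>2 = (Re p)\<^sup>2 + (y + Im p)\<^sup>2"
  by (simp add: cmod_power2 add.commute)

lemma vertical_line_L2:
  fixes p :: complex
  assumes "0 < Re p"
  shows "(\<lambda>y. 1 / (\<i> * of_real y + p)) \<in> L2 lborel"
    and "L2_norm_sq lborel (\<lambda>y. 1 / (\<i> * of_real y + p)) = pi / Re p"
  using inverse_quadratic_integrable[OF assms, of "Im p"]
  by (auto simp: L2_def L2_norm_sq_def norm_divide power_divide cmod_vertical_line)

lemma has_vector_derivative_Complex_pair:
  assumes "(f has_real_derivative f') (at y)" "(g has_real_derivative g') (at y)"
  shows "((\<lambda>y. Complex (f y) (g y)) has_vector_derivative Complex f' g') (at y)"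
proof -
  have "((\<lambda>y. of_real (f y) + \<i> * of_real (g y)) has_vector_derivative of_real f' + \<i> * of_real g') (at y)"
    by (intro has_vector_derivative_add has_vector_derivative_mult_right has_vector_derivative_of_real assms)
  then show ?thesis by (simp only: complex_eq[symmetric] Complex_eq)
qed

text \<open>The inner product of two kernels on the imaginary axis. Partial fractions give an antiderivative
  in terms of real arctangents and logarithms; the logarithms cancel at both ends.\<close>

lemma vertical_line_integral:
  fixes p q :: complex
  assumes p: "0 < Re p" and q: "0 < Re q"
  shows "integrable lborel (\<lambda>y. 1 / ((\<i> * of_real y + p) * (q - \<i> * of_real y)))"
    and "(\<integral>y. 1 / ((\<i> * of_real y + p) * (q - \<i> * of_real y)) \<partial>lborel) = 2 * pi / (p + q)"
proof -
  let ?f = "\<lambda>y. 1 / ((\<i> * of_real y + p) * (q - \<i> * of_real y))"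
  have "?f y = 1 / (\<i> * of_real y + p) * cnj (1 / (\<i> * of_real y + cnj q))" for y
    by (simp add: algebra_simps)
  then show int: "integrable lborel ?f"
    using L2_integrable_mult[OF vertical_line_L2(1)[OF p] L2_cnj[OF vertical_line_L2(1)[of "cnj q"]]] q
    by simp
  define G where "G y = Complex (arctan ((y + Im p) / Re p) + arctan ((y - Im q) / Re q))
      (ln ((Re q)\<^sup>2 + (y - Im q)\<^sup>2) / 2 - ln ((Re p)\<^sup>2 + (y + Im p)\<^sup>2) / 2)" for y
  let ?F = "\<lambda>y. G y / (p + q)"
  have pq: "p + q \<noteq> 0" using p q by (auto simp: complex_eq_iff)
  have nz: "\<i> * of_real y + p \<noteq> 0" "q - \<i> * of_real y \<noteq> 0" for y
    using p q by (auto simp: complex_eq_iff)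
  have deriv: "(?F has_vector_derivative ?f y) (at y)" for y
  proof -
    have Pp: "(Re p)\<^sup>2 + (y + Im p)\<^sup>2 > 0" "(Re q)\<^sup>2 + (y - Im q)\<^sup>2 > 0"
      using p q by (auto intro: add_pos_nonneg)
    have 1: "((\<lambda>y. arctan ((y + Im p) / Re p) + arctan ((y - Im q) / Re q)) has_real_derivative
        Re p / ((Re p)\<^sup>2 + (y + Im p)\<^sup>2) + Re q / ((Re q)\<^sup>2 + (y - Im q)\<^sup>2)) (at y)"
      using DERIV_add[OF DERIV_arctan_affine[OF p, of "Im p"] DERIV_arctan_affine[OF q, of "- Im q"]]
      by simp
    have 2: "((\<lambda>y. ln ((Re q)\<^sup>2 + (y - Im q)\<^sup>2) / 2 - ln ((Re p)\<^sup>2 + (y + Im p)\<^sup>2) / 2) has_real_derivative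
        (y - Im q) / ((Re q)\<^sup>2 + (y - Im q)\<^sup>2) - (y + Im p) / ((Re p)\<^sup>2 + (y + Im p)\<^sup>2)) (at y)"
      using DERIV_diff[OF DERIV_ln_quadratic[OF q, of "- Im q"] DERIV_ln_quadratic[OF p, of "Im p"]]
      by simp
    have "(G has_vector_derivative Complex
        (Re p / ((Re p)\<^sup>2 + (y + Im p)\<^sup>2) + Re q / ((Re q)\<^sup>2 + (y - Im q)\<^sup>2))
        ((y - Im q) / ((Re q)\<^sup>2 + (y - Im q)\<^sup>2) - (y + Im p) / ((Re p)\<^sup>2 + (y + Im p)\<^sup>2))) (at y)"
      unfolding G_def[abs_def] by (rule has_vector_derivative_Complex_pair[OF 1 2])
    also have "Complex
        (Re p / ((Re p)\<^sup>2 + (y + Im p)\<^sup>2) + Re q / ((Re q)\<^sup>2 + (y - Im q)\<^sup>2))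
        ((y - Im q) / ((Re q)\<^sup>2 + (y - Im q)\<^sup>2) - (y + Im p) / ((Re p)\<^sup>2 + (y + Im p)\<^sup>2))
      = 1 / (\<i> * of_real y + p) + 1 / (q - \<i> * of_real y)"
    proof -
      have "(cmod (q - \<i> * of_real y))\<^sup>2 = (Re q)\<^sup>2 + (y - Im q)\<^sup>2"
        by (simp add: cmod_power2 power2_commute)
      then show ?thesis
        by (intro complex_eqI)
          (simp_all add: Re_Im_inverse_complex cmod_vertical_line diff_divide_distrib add_divide_distrib)
    qed
    also have "\<dots> = ?f y * (p + q)" using nz[of y] by (simp add: field_simps)
    finally have "((\<lambda>y. G y / (p + q)) has_vector_derivative (?f y * (p + q)) / (p + q)) (at y)"
      by (rule has_vector_derivative_divide)
    then show ?thesis using pq by simp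
  qed
  have G_lim: "(G \<longlongrightarrow> Complex pi 0) at_top" "(G \<longlongrightarrow> Complex (- pi) 0) at_bot"
    unfolding G_def[abs_def] using p q by (intro tendsto_Complex; real_asymp)+
  have lims: "((?F \<circ> real_of_ereal) \<longlongrightarrow> Complex (- pi) 0 / (p + q)) (at_right (- \<infinity>))"
      "((?F \<circ> real_of_ereal) \<longlongrightarrow> Complex pi 0 / (p + q)) (at_left \<infinity>)"
    unfolding ereal_tendsto_simps using G_lim pq by (auto intro!: tendsto_divide)
  have "(LBINT y=-\<infinity>..\<infinity>. ?f y) = Complex pi 0 / (p + q) - Complex (- pi) 0 / (p + q)"
  proof (rule interval_integral_FTC_integrable[OF _ deriv _ _ lims])
    show "isCont ?f y" for y using nz[of y] by (intro continuous_intros) auto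
    show "set_integrable lborel (einterval (- \<infinity>) \<infinity>) ?f" using int by (simp add: set_integrable_def)
  qed auto
  also have "\<dots> = 2 * pi / (p + q)"
    by (simp add: diff_divide_distrib[symmetric]) (simp add: complex_eq_iff)
  finally show "(\<integral>y. ?f y \<partial>lborel) = 2 * pi / (p + q)"
    by (simp add: interval_lebesgue_integral_def set_lebesgue_integral_def)
qed

abbreviation halfline :: "real measure"
  where "halfline \<equiv> restrict_space lborel {0<..}"

lemma integrable_halfline_iff:
  "integrable halfline f \<longleftrightarrow> set_integrable lborel {0<..} (f :: real \<Rightarrow> 'b::{banach, second_countable_topology})"
  unfolding set_integrable_def by (subst integrable_restrict_space) auto

lemma integral_halfline_eq:
  "(\<integral>x. f x \<partial>halfline) = (LINT x:{0<..}|lborel. (f x :: 'b::{banach, second_countable_topology}))"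
  unfolding set_lebesgue_integral_def by (subst integral_restrict_space) auto

lemma L2_halfline_eq: "L2_halfline = L2 halfline"
  unfolding L2_halfline_def L2_def
  by (auto simp: integrable_halfline_iff set_borel_measurable_def borel_measurable_restrict_space_iff)

lemma halfline_exp_real:
  fixes c :: real
  assumes "0 < c"
  shows "integrable halfline (\<lambda>s. exp (- (c * s)))"
proof -
  have "set_integrable lborel (einterval 0 \<infinity>) (\<lambda>s. exp (- (c * s)))"
  proof (rule interval_integral_FTC_nonneg(1)[where F = "\<lambda>s. - exp (- (c * s)) / c" and A = "- inverse c" and B = 0])
    show "DERIV (\<lambda>s. - exp (- (c * s)) / c) s :> exp (- (c * s))" for s
      using assms by (auto intro!: derivative_eq_intros)
    have "((\<lambda>s. - exp (- (c * s)) / c) \<longlongrightarrow> - inverse c) (at_right 0)"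
      using assms by real_asymp
    then show "(((\<lambda>s. - exp (- (c * s)) / c) \<circ> real_of_ereal) \<longlongrightarrow> - inverse c) (at_right 0)"
      unfolding zero_ereal_def ereal_tendsto_simps .
    have "((\<lambda>s. - exp (- (c * s)) / c) \<longlongrightarrow> 0) at_top"
      using assms by real_asymp
    then show "(((\<lambda>s. - exp (- (c * s)) / c) \<circ> real_of_ereal) \<longlongrightarrow> 0) (at_left \<infinity>)"
      unfolding ereal_tendsto_simps .
  qed auto
  moreover have "einterval 0 \<infinity> = {0<..}" by (auto simp: einterval_def)
  ultimately show ?thesis by (simp add: integrable_halfline_iff)
qed

text \<open>The inner product of two exponentials; with \<open>vertical_line_integral\<close> this is the
  Paley-Wiener isometry on the functions that are needed.\<close>

lemma halfline_exp:
  fixes w :: complex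
  assumes "0 < Re w"
  shows "integrable halfline (\<lambda>s. exp (- (w * of_real s)))"
    and "(\<integral>s. exp (- (w * of_real s)) \<partial>halfline) = 1 / w"
proof -
  show int: "integrable halfline (\<lambda>s. exp (- (w * of_real s)))"
  proof (rule Bochner_Integration.integrable_bound[OF halfline_exp_real[OF assms]])
    show "(\<lambda>s. exp (- (w * of_real s))) \<in> borel_measurable halfline"
      by (intro measurable_restrict_space1) (simp add: borel_measurable_continuous_onI continuous_intros)
  qed (auto simp: norm_exp_eq_Re)
  have w: "w \<noteq> 0" using assms by auto
  have "(LBINT s=0..\<infinity>. exp (- (w * of_real s))) = 0 - (- 1 / w)"
  proof (rule interval_integral_FTC_integrable[where F = "\<lambda>s. - exp (- (w * of_real s)) / w"])
    have E: "einterval 0 \<infinity> = {0<..}" by (auto simp: einterval_def)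
    show "set_integrable lborel (einterval 0 \<infinity>) (\<lambda>s. exp (- (w * of_real s)))"
      using int by (simp add: E integrable_halfline_iff)
    show "((\<lambda>s. - exp (- (w * of_real s)) / w) has_vector_derivative exp (- (w * of_real s))) (at s)" for s
      using w by (auto intro!: derivative_eq_intros has_vector_derivative_real_field)
    have "((\<lambda>s. - exp (- (w * of_real s)) / w) \<longlongrightarrow> - exp (- (w * of_real 0)) / w) (at_right 0)"
      using w by (intro tendsto_intros) auto
    then show "(((\<lambda>s. - exp (- (w * of_real s)) / w) \<circ> real_of_ereal) \<longlongrightarrow> - 1 / w) (at_right 0)"
      unfolding zero_ereal_def ereal_tendsto_simps by simp
    have "((\<lambda>s. exp (- (Re w * s))) \<longlongrightarrow> 0) at_top"
      using assms by real_asymp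
    then have "((\<lambda>s. exp (- (w * of_real s))) \<longlongrightarrow> 0) at_top"
      by - (rule tendsto_norm_zero_cancel, simp add: norm_exp_eq_Re)
    then have "((\<lambda>s. - exp (- (w * of_real s)) / w) \<longlongrightarrow> - 0 / w) at_top"
      using w by (intro tendsto_intros)
    then show "(((\<lambda>s. - exp (- (w * of_real s)) / w) \<circ> real_of_ereal) \<longlongrightarrow> 0) (at_left \<infinity>)"
      unfolding ereal_tendsto_simps by simp
  qed (auto intro!: continuous_intros)
  moreover have "einterval 0 \<infinity> = {0<..}" by (auto simp: einterval_def)
  ultimately show "(\<integral>s. exp (- (w * of_real s)) \<partial>halfline) = 1 / w"
    by (simp add: integral_halfline_eq interval_lebesgue_integral_def)
qed

section \<open>Exponential sums and reproducing kernels\<close>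

definition exp_sum :: "(nat \<Rightarrow> complex) \<Rightarrow> nat \<Rightarrow> (nat \<Rightarrow> complex) \<Rightarrow> real \<Rightarrow> complex"
  where "exp_sum z K a s = (\<Sum>n<K. a n * exp (- (cnj (z n) * of_real s)))"

lemma exp_L2_halfline:
  fixes w :: complex
  assumes "0 < Re w"
  shows "(\<lambda>s. exp (- (w * of_real s))) \<in> L2 halfline"
proof (rule L2_bound)
  show "(\<lambda>s. exp (- (w * of_real s))) \<in> borel_measurable halfline"
    using halfline_exp(1)[OF assms] by (rule borel_measurable_integrable)
  show "integrable halfline (\<lambda>s. exp (- (2 * Re w * s)))"
    using assms by (intro halfline_exp_real) simp
  show "(cmod (exp (- (w * complex_of_real s))))\<^sup>2 \<le> exp (- (2 * Re w * s))" for s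
    by (simp add: norm_exp_eq_Re exp_double[symmetric] mult.assoc)
qed

lemma exp_sum_L2:
  assumes "\<And>n. n < K \<Longrightarrow> 0 < Re (z n)"
  shows "exp_sum z K a \<in> L2 halfline"
  unfolding exp_sum_def[abs_def]
  by (intro L2_sum L2_mult_const exp_L2_halfline) (use assms in auto)

lemma laplace_exp_sum:
  assumes pos: "\<And>n. n < K \<Longrightarrow> 0 < Re (z n)" and w: "0 < Re w"
  shows "(\<integral>s. exp (- (w * of_real s)) * exp_sum z K a s \<partial>halfline) = kernel_sum z K a w"
proof -
  have eq: "exp (- (w * of_real s)) * exp_sum z K a s = (\<Sum>n<K. a n * exp (- ((w + cnj (z n)) * of_real s)))" for s
    unfolding exp_sum_def sum_distrib_left
    by (intro sum.cong refl) (simp add: exp_add[symmetric] algebra_simps)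
  have "(\<integral>s. exp (- (w * of_real s)) * exp_sum z K a s \<partial>halfline)
      = (\<Sum>n<K. \<integral>s. a n * exp (- ((w + cnj (z n)) * of_real s)) \<partial>halfline)"
    unfolding eq by (intro Bochner_Integration.integral_sum integrable_mult_right halfline_exp(1)) (use pos w in \<open>auto intro: add_pos_pos\<close>)
  also have "\<dots> = kernel_sum z K a w" unfolding kernel_sum_def
  proof (intro sum.cong refl)
    fix n assume "n \<in> {..<K}"
    then have "0 < Re (w + cnj (z n))" using pos w by (auto intro: add_pos_pos)
    then show "(\<integral>s. a n * exp (- ((w + cnj (z n)) * of_real s)) \<partial>halfline) = a n / (w + cnj (z n))"
      by (simp add: halfline_exp(2))
  qed
  finally show ?thesis .
qed

lemma gram_form_eq_norm:
  assumes pos: "\<And>n. n < K \<Longrightarrow> 0 < Re (z n)"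
  shows "gram_form z K a = of_real (L2_norm_sq halfline (exp_sum z K a))"
proof -
  have int: "integrable halfline (\<lambda>s. exp (- (z m * of_real s)) * exp_sum z K a s)" if "m < K" for m
    by (intro L2_integrable_mult exp_L2_halfline exp_sum_L2 pos that)
  have "of_real (L2_norm_sq halfline (exp_sum z K a)) = (\<integral>s. exp_sum z K a s * cnj (exp_sum z K a s) \<partial>halfline)"
    by (rule L2_norm_sq_eq[OF exp_sum_L2[OF pos]])
  also have "\<dots> = (\<integral>s. (\<Sum>m<K. cnj (a m) * (exp (- (z m * of_real s)) * exp_sum z K a s)) \<partial>halfline)"
    by (intro Bochner_Integration.integral_cong refl)
      (simp add: exp_sum_def[of z K a] exp_cnj sum_distrib_left mult_ac)
  also have "\<dots> = (\<Sum>m<K. cnj (a m) * (\<integral>s. exp (- (z m * of_real s)) * exp_sum z K a s \<partial>halfline))"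
    using int by (subst Bochner_Integration.integral_sum) auto
  also have "\<dots> = gram_form z K a"
    unfolding gram_form_def using laplace_exp_sum[OF pos pos] by simp
  finally show ?thesis ..
qed

text \<open>The kernel sum is the Laplace transform of the exponential sum, and both norms are the
  Gram form.\<close>

lemma kernel_sum_vertical_line:
  assumes pos: "\<And>n. n < K \<Longrightarrow> 0 < Re (z n)"
  shows "(\<lambda>y. kernel_sum z K a (\<i> * of_real y)) \<in> L2 lborel"
    and "L2_norm_sq lborel (\<lambda>y. kernel_sum z K a (\<i> * of_real y)) = 2 * pi * L2_norm_sq halfline (exp_sum z K a)"
proof -
  have "(\<lambda>y. \<Sum>n<K. a n * (1 / (\<i> * of_real y + cnj (z n)))) \<in> L2 lborel"
    by (intro L2_sum L2_mult_const vertical_line_L2(1)) (use pos in auto)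
  then show L2: "(\<lambda>y. kernel_sum z K a (\<i> * of_real y)) \<in> L2 lborel"
    unfolding kernel_sum_def by simp
  let ?k = "\<lambda>n m y. 1 / ((\<i> * of_real y + cnj (z n)) * (z m - \<i> * of_real y))"
  have "of_real (L2_norm_sq lborel (\<lambda>y. kernel_sum z K a (\<i> * of_real y)))
      = (\<integral>y. kernel_sum z K a (\<i> * of_real y) * cnj (kernel_sum z K a (\<i> * of_real y)) \<partial>lborel)"
    by (rule L2_norm_sq_eq[OF L2])
  also have "\<dots> = (\<integral>y. (\<Sum>m<K. \<Sum>n<K. cnj (a m) * a n * ?k n m y) \<partial>lborel)"
  proof (intro Bochner_Integration.integral_cong refl)
    fix y
    have "kernel_sum z K a (\<i> * of_real y) * cnj (kernel_sum z K a (\<i> * of_real y)) =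
        (\<Sum>n<K. a n / (\<i> * of_real y + cnj (z n))) * (\<Sum>m<K. cnj (a m) / (z m - \<i> * of_real y))"
      by (simp add: kernel_sum_def)
    also have "\<dots> = (\<Sum>m<K. \<Sum>n<K. cnj (a m) * a n * ?k n m y)"
      unfolding sum_product by (subst sum.swap) (intro sum.cong refl, simp add: mult_ac)
    finally show "kernel_sum z K a (\<i> * of_real y) * cnj (kernel_sum z K a (\<i> * of_real y)) =
        (\<Sum>m<K. \<Sum>n<K. cnj (a m) * a n * ?k n m y)" .
  qed
  also have "\<dots> = (\<Sum>m<K. \<Sum>n<K. cnj (a m) * a n * (\<integral>y. ?k n m y \<partial>lborel))"
  proof -
    have int: "integrable lborel (?k n m)" if "n < K" "m < K" for n m
      using vertical_line_integral(1)[of "cnj (z n)" "z m"] pos that by simp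
    have "(\<integral>y. (\<Sum>m<K. \<Sum>n<K. cnj (a m) * a n * ?k n m y) \<partial>lborel) =
        (\<Sum>m<K. \<integral>y. (\<Sum>n<K. cnj (a m) * a n * ?k n m y) \<partial>lborel)"
      by (intro Bochner_Integration.integral_sum Bochner_Integration.integrable_sum
          integrable_mult_right int) auto
    also have "\<dots> = (\<Sum>m<K. \<Sum>n<K. \<integral>y. cnj (a m) * a n * ?k n m y \<partial>lborel)"
      by (intro sum.cong refl Bochner_Integration.integral_sum integrable_mult_right int) auto
    also have "\<dots> = (\<Sum>m<K. \<Sum>n<K. cnj (a m) * a n * (\<integral>y. ?k n m y \<partial>lborel))"
      by (intro sum.cong refl integral_mult_right_zero)
    finally show ?thesis .
  qed
  also have "\<dots> = 2 * pi * gram_form z K a"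
    unfolding gram_form_def kernel_sum_def sum_distrib_left
  proof (intro sum.cong refl)
    fix m n assume "m \<in> {..<K}" "n \<in> {..<K}"
    then have "(\<integral>y. ?k n m y \<partial>lborel) = 2 * pi / (cnj (z n) + z m)"
      using vertical_line_integral(2)[of "cnj (z n)" "z m"] pos by simp
    then show "cnj (a m) * a n * (\<integral>y. ?k n m y \<partial>lborel) = 2 * pi * (cnj (a m) * (a n / (z m + cnj (z n))))"
      by (simp add: add.commute)
  qed
  finally have "complex_of_real (L2_norm_sq lborel (\<lambda>y. kernel_sum z K a (\<i> * of_real y))) =
      of_real (2 * pi * L2_norm_sq halfline (exp_sum z K a))"
    using gram_form_eq_norm[of K z a, OF pos] by simp
  then show "L2_norm_sq lborel (\<lambda>y. kernel_sum z K a (\<i> * of_real y)) = 2 * pi * L2_norm_sq halfline (exp_sum z K a)"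
    unfolding of_real_eq_iff .
qed

text \<open>Moving the vertical line to the right multiplies the exponential sum by a decaying factor, so
  the norm on the imaginary axis dominates.\<close>

lemma kernel_sum_hardy:
  assumes pos: "\<And>n. n < K \<Longrightarrow> 0 < Re (z n)"
  shows "kernel_sum z K a \<in> hardy_H2"
    and "H2_norm_sq (kernel_sum z K a) \<le> ennreal (2 * pi * L2_norm_sq halfline (exp_sum z K a))"
proof -
  show le: "H2_norm_sq (kernel_sum z K a) \<le> ennreal (2 * pi * L2_norm_sq halfline (exp_sum z K a))"
    unfolding H2_norm_sq_def
  proof (rule SUP_least)
    fix x :: real assume "x \<in> {0<..}"
    then have x: "0 < x" by simp
    let ?z = "\<lambda>n. z n + of_real x"
    have pos': "0 < Re (?z n)" if "n < K" for n using pos[OF that] x by simp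
    have shift: "kernel_sum z K a (Complex x y) = kernel_sum ?z K a (\<i> * of_real y)" for y
      by (simp add: kernel_sum_def Complex_eq algebra_simps)
    have "(\<integral>\<^sup>+ y. ennreal ((cmod (kernel_sum z K a (Complex x y)))\<^sup>2) \<partial>lborel)
        = ennreal (2 * pi * L2_norm_sq halfline (exp_sum ?z K a))"
      using nn_integral_eq_integral[OF L2_integrable[OF kernel_sum_vertical_line(1)[of K ?z a, OF pos']]]
        kernel_sum_vertical_line(2)[of K ?z a, OF pos']
      unfolding shift L2_norm_sq_def[of lborel] by simp
    also have "\<dots> \<le> ennreal (2 * pi * L2_norm_sq halfline (exp_sum z K a))"
    proof (intro ennreal_leI mult_left_mono)
      have "exp_sum ?z K a s = exp (- (of_real x * of_real s)) * exp_sum z K a s" for s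
        unfolding exp_sum_def sum_distrib_left
        by (intro sum.cong refl) (simp add: exp_add[symmetric] algebra_simps)
      then have "(cmod (exp_sum ?z K a s))\<^sup>2 \<le> (cmod (exp_sum z K a s))\<^sup>2" if "0 < s" for s
        using x that by (auto simp: norm_mult norm_exp_eq_Re intro!: power_mono mult_left_le_one_le)
      then show "L2_norm_sq halfline (exp_sum ?z K a) \<le> L2_norm_sq halfline (exp_sum z K a)"
        unfolding L2_norm_sq_def
        by (intro integral_mono L2_integrable exp_sum_L2 pos pos') (auto simp: space_restrict_space)
    qed simp
    finally show "(\<integral>\<^sup>+ y. ennreal ((cmod (kernel_sum z K a (Complex x y)))\<^sup>2) \<partial>lborel) \<le> \<dots>" .
  qed
  have "kernel_sum z K a holomorphic_on right_half_plane"
    unfolding kernel_sum_def[abs_def] right_half_plane_def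
    by (intro holomorphic_intros) (use pos add_cnj_neq_0(1) in auto)
  moreover have "H2_norm_sq (kernel_sum z K a) < \<infinity>"
    using le by (rule order_le_less_trans) simp
  ultimately show "kernel_sum z K a \<in> hardy_H2" unfolding hardy_H2_def by simp
qed

section \<open>Reproducing property of the Hardy space\<close>

lemma hardy_holomorphic: "f \<in> hardy_H2 \<Longrightarrow> f holomorphic_on right_half_plane"
  unfolding hardy_H2_def by simp

lemma open_right_half_plane: "open right_half_plane"
  unfolding right_half_plane_def by (rule open_halfspace_Re_gt)

lemma hardy_measurable:
  fixes f :: "complex \<Rightarrow> complex"
  assumes "f \<in> hardy_H2"
  shows "(\<lambda>w. indicator right_half_plane w *\<^sub>R f w) \<in> borel_measurable borel"
  using open_right_half_plane holomorphic_on_imp_continuous_on[OF hardy_holomorphic[OF assms]]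
  by (intro borel_measurable_continuous_on_indicator) auto

lemma hardy_vertical_line:
  fixes f :: "complex \<Rightarrow> complex"
  assumes f: "f \<in> hardy_H2" and x: "0 < x"
  shows "(\<lambda>y. f (Complex x y)) \<in> L2 lborel"
    and "L2_norm_sq lborel (\<lambda>y. f (Complex x y)) \<le> enn2real (H2_norm_sq f)"
proof -
  have fin: "H2_norm_sq f < \<infinity>" using f unfolding hardy_H2_def by simp
  have le: "(\<integral>\<^sup>+ y. ennreal ((cmod (f (Complex x y)))\<^sup>2) \<partial>lborel) \<le> H2_norm_sq f"
    unfolding H2_norm_sq_def using x by (intro SUP_upper) simp
  have "continuous_on UNIV (\<lambda>y. f (Complex x y))"
    using x by (intro continuous_on_compose2[OF holomorphic_on_imp_continuous_on[OF hardy_holomorphic[OF f]]])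
      (auto simp: right_half_plane_def Complex_eq intro!: continuous_intros)
  then have meas: "(\<lambda>y. f (Complex x y)) \<in> borel_measurable lborel"
    by (simp add: borel_measurable_continuous_onI)
  then show L2: "(\<lambda>y. f (Complex x y)) \<in> L2 lborel"
    unfolding L2_def using le fin by (auto simp: integrable_iff_bounded power_abs)
  have "ennreal (L2_norm_sq lborel (\<lambda>y. f (Complex x y))) \<le> H2_norm_sq f"
    using le nn_integral_eq_integral[OF L2_integrable[OF L2]] by (simp add: L2_norm_sq_def)
  then show "L2_norm_sq lborel (\<lambda>y. f (Complex x y)) \<le> enn2real (H2_norm_sq f)"
    using fin enn2real_mono[of "ennreal (L2_norm_sq lborel (\<lambda>y. f (Complex x y)))" "H2_norm_sq f"]
    by (simp add: L2_norm_sq_nonneg)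
qed

text \<open>Heights at which a rectangle can be closed: the square of the modulus is integrable over the whole
  strip, so its mean over the segments at the heights \<open>Y\<close> and \<open>- Y\<close> together cannot exceed \<open>1\<close> for
  all large \<open>Y\<close>. This replaces pointwise bounds for functions in the Hardy space.\<close>

lemma hardy_good_height:
  fixes f :: "complex \<Rightarrow> complex"
  assumes f: "f \<in> hardy_H2" and x: "0 < x" and X: "x \<le> X"
  obtains Y where "R < Y" "\<And>s. s \<in> {Y, - Y} \<Longrightarrow>
    integral {0..1} (\<lambda>t. (cmod (f (Complex (x + t * (X - x)) s)))\<^sup>2) \<le> 1"
proof -
  let ?S = "{0..1::real}"
  have pos: "0 < x + t * (X - x)" if "0 \<le> t" for t
    using x X that by (intro add_pos_nonneg) auto
  define g where "g w = indicator right_half_plane w *\<^sub>R f w" for w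
  have g_meas: "g \<in> borel_measurable borel" unfolding g_def by (rule hardy_measurable[OF f])
  have g_eq: "g (Complex (x + t * (X - x)) s) = f (Complex (x + t * (X - x)) s)" if "t \<in> ?S" for t s
  proof -
    have "0 < x + t * (X - x)" using x X that by (intro add_pos_nonneg) auto
    then have "Complex (x + t * (X - x)) s \<in> right_half_plane" by (simp add: right_half_plane_def)
    then show ?thesis unfolding g_def by simp
  qed
  have cmeas: "(\<lambda>p. Complex (x + fst p * (X - x)) (snd p)) \<in> borel_measurable (lborel \<Otimes>\<^sub>M lborel)"
    unfolding lborel_prod measurable_cong_sets[OF sets_lborel refl]
    by (rule borel_measurable_continuous_onI) (auto simp: Complex_eq intro!: continuous_intros)
  define h where "h s = (\<integral>\<^sup>+ t. ennreal (indicator ?S t * (cmod (g (Complex (x + t * (X - x)) s)))\<^sup>2) \<partial>lborel)" for s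
  have gm: "(\<lambda>p. g (Complex (x + fst p * (X - x)) (snd p))) \<in> borel_measurable (lborel \<Otimes>\<^sub>M lborel)"
    by (rule measurable_compose[OF cmeas g_meas])
  have hm: "(\<lambda>(t, s). ennreal (indicator ?S t * (cmod (g (Complex (x + t * (X - x)) s)))\<^sup>2))
      \<in> borel_measurable (lborel \<Otimes>\<^sub>M lborel)"
    unfolding case_prod_beta
    using gm by measurable
  have h_integral: "(\<integral>\<^sup>+ s. h s \<partial>lborel) \<le> H2_norm_sq f"
  proof -
    have "(\<integral>\<^sup>+ s. h s \<partial>lborel) = (\<integral>\<^sup>+ t. (\<integral>\<^sup>+ s.
        ennreal (indicator ?S t * (cmod (g (Complex (x + t * (X - x)) s)))\<^sup>2) \<partial>lborel) \<partial>lborel)"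
      unfolding h_def using hm by (rule lborel_pair.Fubini')
    also have "\<dots> \<le> (\<integral>\<^sup>+ t. H2_norm_sq f * indicator ?S t \<partial>lborel)"
    proof (rule nn_integral_mono)
      fix t :: real
      show "(\<integral>\<^sup>+ s. ennreal (indicator ?S t * (cmod (g (Complex (x + t * (X - x)) s)))\<^sup>2) \<partial>lborel)
          \<le> H2_norm_sq f * indicator ?S t"
      proof (cases "t \<in> ?S")
        case True
        then have "0 < x + t * (X - x)" using x X by (auto intro: add_pos_nonneg)
        then show ?thesis using True unfolding H2_norm_sq_def
          by (auto simp: g_eq intro!: SUP_upper)
      qed simp
    qed
    also have "\<dots> = H2_norm_sq f" by (simp add: nn_integral_cmult_indicator)
    finally show ?thesis .
  qed
  have h_meas[measurable]: "h \<in> borel_measurable lborel"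
    unfolding h_def[abs_def]
    by (rule lborel.borel_measurable_nn_integral) (use measurable_pair_swap[OF hm] in simp)
  have "\<exists>Y>R. h Y + h (- Y) \<le> 1"
  proof (rule ccontr)
    assume "\<not> ?thesis"
    then have large: "1 \<le> h Y + h (- Y)" if "R < Y" for Y using that by (meson linear)
    obtain m where m: "H2_norm_sq f = ennreal m" "0 \<le> m"
      using f unfolding hardy_H2_def by (cases "H2_norm_sq f") auto
    have "ennreal (2 * m + 1) = (\<integral>\<^sup>+ s. indicator {R<..R + (2 * m + 1)} s \<partial>lborel)"
      using m(2) by simp
    also have "\<dots> \<le> (\<integral>\<^sup>+ s. h s + h (- s) \<partial>lborel)"
      by (intro nn_integral_mono) (auto simp: indicator_def large)
    also have "\<dots> = (\<integral>\<^sup>+ s. h s \<partial>lborel) + (\<integral>\<^sup>+ s. h (- s) \<partial>lborel)"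
      using h_meas by (intro nn_integral_add) measurable
    also have "(\<integral>\<^sup>+ s. h (- s) \<partial>lborel) = (\<integral>\<^sup>+ s. h s \<partial>lborel)"
      using nn_integral_real_affine[of h "-1" 0] h_meas by simp
    also have "(\<integral>\<^sup>+ s. h s \<partial>lborel) + (\<integral>\<^sup>+ s. h s \<partial>lborel) \<le> ennreal m + ennreal m"
      using h_integral unfolding m(1) by (intro add_mono)
    also have "\<dots> = ennreal (2 * m)" using m(2) by (simp add: ennreal_plus[symmetric])
    finally show False using m(2) by (subst (asm) ennreal_le_iff) auto
  qed
  then obtain Y where Y: "R < Y" "h Y + h (- Y) \<le> 1" by blast
  have "integral ?S (\<lambda>t. (cmod (f (Complex (x + t * (X - x)) s)))\<^sup>2) \<le> 1" if "s \<in> {Y, - Y}" for s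
  proof -
    have cont: "continuous_on ?S (\<lambda>t. (cmod (f (Complex (x + t * (X - x)) s)))\<^sup>2)"
      by (intro continuous_intros continuous_on_compose2[OF
            holomorphic_on_imp_continuous_on[OF hardy_holomorphic[OF f]]])
        (auto simp: right_half_plane_def Complex_eq pos intro!: continuous_intros)
    note int = borel_integrable_atLeastAtMost'[OF cont]
    have "ennreal (integral ?S (\<lambda>t. (cmod (f (Complex (x + t * (X - x)) s)))\<^sup>2)) =
        ennreal (LINT t:?S|lborel. (cmod (f (Complex (x + t * (X - x)) s)))\<^sup>2)"
      using set_borel_integral_eq_integral(2)[OF int] by simp
    also have "\<dots> = (\<integral>\<^sup>+ t. ennreal (indicator ?S t * (cmod (f (Complex (x + t * (X - x)) s)))\<^sup>2) \<partial>lborel)"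
      using nn_integral_eq_integral[OF int[unfolded set_integrable_def]]
      by (simp add: set_lebesgue_integral_def)
    also have "\<dots> = h s" unfolding h_def
      by (intro nn_integral_cong) (auto simp: indicator_def g_eq)
    also have "\<dots> \<le> 1" using that Y(2) by (auto intro: order_trans[rotated] simp: add_increasing add_increasing2)
    finally show ?thesis by (simp add: ennreal_le_1)
  qed
  with Y(1) show thesis by (rule that)
qed

lemma horizontal_edge_bound:
  fixes f :: "complex \<Rightarrow> complex"
  assumes cont: "continuous_on (closed_segment a b) f" and \<delta>: "0 < \<delta>"
    and dist: "\<And>w. w \<in> closed_segment a b \<Longrightarrow> \<delta> \<le> cmod (w - z)"
    and mean: "integral {0..1} (\<lambda>t. (cmod (f (linepath a b t)))\<^sup>2) \<le> 1"
  shows "cmod (contour_integral (linepath a b) (\<lambda>w. f w / (w - z))) \<le> cmod (b - a) / \<delta>"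
proof -
  have seg: "linepath a b t \<in> closed_segment a b" if "t \<in> {0..1}" for t
    using that by (rule linepath_in_path)
  have nz: "w - z \<noteq> 0" if "w \<in> closed_segment a b" for w using dist[OF that] \<delta> by auto
  have c1: "continuous_on {0..1} (\<lambda>t. f (linepath a b t))"
    by (intro continuous_on_compose2[OF cont] continuous_intros) (use seg in auto)
  have c2: "continuous_on {0..1} (\<lambda>t. f (linepath a b t) / (linepath a b t - z) * (b - a))"
    by (intro continuous_intros c1) (use seg nz in auto)
  have "contour_integral (linepath a b) (\<lambda>w. f w / (w - z)) =
      integral {0..1} (\<lambda>t. f (linepath a b t) / (linepath a b t - z) * (b - a))"
    by (simp add: contour_integral_integral)
  also have "cmod \<dots> \<le> integral {0..1} (\<lambda>t. cmod (b - a) / (2 * \<delta>) * (1 + (cmod (f (linepath a b t)))\<^sup>2))"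
  proof (rule integral_norm_bound_integral)
    show "(\<lambda>t. cmod (b - a) / (2 * \<delta>) * (1 + (cmod (f (linepath a b t)))\<^sup>2)) integrable_on {0..1}"
      by (intro integrable_continuous_real continuous_intros c1)
    fix t :: real assume t: "t \<in> {0..1}"
    have "cmod (f (linepath a b t)) \<le> (1 + (cmod (f (linepath a b t)))\<^sup>2) / 2"
      using sum_squares_bound[of 1 "cmod (f (linepath a b t))"] by simp
    then have "cmod (f (linepath a b t)) / cmod (linepath a b t - z) \<le> (1 + (cmod (f (linepath a b t)))\<^sup>2) / 2 / \<delta>"
      using dist[OF seg[OF t]] \<delta> by (intro frac_le) auto
    then have "cmod (f (linepath a b t)) / cmod (linepath a b t - z) * cmod (b - a)
        \<le> (1 + (cmod (f (linepath a b t)))\<^sup>2) / 2 / \<delta> * cmod (b - a)"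
      by (rule mult_right_mono) simp
    then show "cmod (f (linepath a b t) / (linepath a b t - z) * (b - a))
        \<le> cmod (b - a) / (2 * \<delta>) * (1 + (cmod (f (linepath a b t)))\<^sup>2)"
      by (simp add: norm_mult norm_divide mult_ac)
  qed (intro integrable_continuous_real c2)
  also have "\<dots> = cmod (b - a) / (2 * \<delta>) * (1 + integral {0..1} (\<lambda>t. (cmod (f (linepath a b t)))\<^sup>2))"
    by (subst integral_mult_right, subst Henstock_Kurzweil_Integration.integral_add)
      (auto intro!: integrable_continuous_real continuous_intros c1)
  also have "\<dots> \<le> cmod (b - a) / (2 * \<delta>) * (1 + 1)"
    using mean \<delta> by (intro mult_left_mono) auto
  finally show ?thesis by simp
qed

text \<open>Cauchy's integral formula on a rectangle, with its vertical edges as ordinary integrals.\<close>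

lemma hardy_rectangle:
  fixes f :: "complex \<Rightarrow> complex"
  assumes f: "f \<in> hardy_H2" and x: "0 < x" "x < Re z" and X: "Re z < X" and Y: "\<bar>Im z\<bar> < Y"
  shows "\<i> * integral {- Y..Y} (\<lambda>y. f (Complex X y) / (Complex X y - z))
      - \<i> * integral {- Y..Y} (\<lambda>y. f (Complex x y) / (Complex x y - z))
      + contour_integral (linepath (Complex x (- Y)) (Complex X (- Y))) (\<lambda>w. f w / (w - z))
      - contour_integral (linepath (Complex x Y) (Complex X Y)) (\<lambda>w. f w / (w - z))
    = 2 * pi * \<i> * f z"
proof -
  let ?g = "\<lambda>w. f w / (w - z)"
  let ?a1 = "Complex x (- Y)" and ?a2 = "Complex X (- Y)" and ?a3 = "Complex X Y" and ?a4 = "Complex x Y"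
  have Ypos: "- Y < Y" using Y by simp
  have "- Y < Im z" "Im z < Y" using Y by linarith+
  then have z_in: "z \<in> box ?a1 ?a3" using x X by (simp add: in_box_complex_iff)
  have sub: "path_image (rectpath ?a1 ?a3) \<subseteq> right_half_plane - {z}"
  proof -
    have "path_image (rectpath ?a1 ?a3) \<subseteq> cbox ?a1 ?a3 - box ?a1 ?a3"
      using x X Ypos by (subst path_image_rectpath_cbox_minus_box) auto
    moreover have "cbox ?a1 ?a3 \<subseteq> right_half_plane"
      using x by (auto simp: in_cbox_complex_iff right_half_plane_def)
    ultimately show ?thesis using z_in by blast
  qed
  have img: "path_image (rectpath ?a1 ?a3) =
      closed_segment ?a1 ?a2 \<union> closed_segment ?a2 ?a3 \<union> closed_segment ?a3 ?a4 \<union> closed_segment ?a4 ?a1"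
    unfolding rectpath_def Let_def by (simp add: path_image_join Un_assoc)
  have "continuous_on (right_half_plane - {z}) ?g"
    by (intro continuous_intros continuous_on_subset[OF holomorphic_on_imp_continuous_on[OF hardy_holomorphic[OF f]]]) auto
  then have cont: "continuous_on (closed_segment ?a1 ?a2) ?g" "continuous_on (closed_segment ?a2 ?a3) ?g"
    "continuous_on (closed_segment ?a3 ?a4) ?g" "continuous_on (closed_segment ?a4 ?a1) ?g"
    using sub unfolding img by (auto elim!: continuous_on_subset)
  note integrable = this[THEN contour_integrable_continuous_linepath]
  have "(?g has_contour_integral (2 * pi * \<i> * winding_number (rectpath ?a1 ?a3) z * f z)) (rectpath ?a1 ?a3)"
  proof (rule Cauchy_integral_formula_convex_simple[OF _ hardy_holomorphic[OF f]])
    show "convex right_half_plane" unfolding right_half_plane_def by (rule convex_halfspace_Re_gt)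
    show "z \<in> interior right_half_plane"
      using x open_right_half_plane by (simp add: interior_open right_half_plane_def)
  qed (use sub in auto)
  then have "2 * pi * \<i> * f z = contour_integral (rectpath ?a1 ?a3) ?g"
    using winding_number_rectpath[OF z_in] by (simp add: contour_integral_unique)
  also have "\<dots> = contour_integral (linepath ?a1 ?a2) ?g + (contour_integral (linepath ?a2 ?a3) ?g
      + (contour_integral (linepath ?a3 ?a4) ?g + contour_integral (linepath ?a4 ?a1) ?g))"
    unfolding rectpath_def Let_def using integrable by (simp add: contour_integrable_joinI)
  also have "contour_integral (linepath ?a3 ?a4) ?g = - contour_integral (linepath ?a4 ?a3) ?g"
    using cont(3) by (rule contour_integral_reverse_linepath)
  also have "contour_integral (linepath ?a4 ?a1) ?g = - contour_integral (linepath ?a1 ?a4) ?g"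
    using cont(4) by (rule contour_integral_reverse_linepath)
  also have "contour_integral (linepath ?a1 ?a4) ?g = \<i> * integral {- Y..Y} (\<lambda>y. ?g (Complex x y))"
    using Ypos by (intro contour_integral_linepath_same_Re) auto
  also have "contour_integral (linepath ?a2 ?a3) ?g = \<i> * integral {- Y..Y} (\<lambda>y. ?g (Complex X y))"
    using Ypos by (intro contour_integral_linepath_same_Re) auto
  finally show ?thesis by (simp add: algebra_simps)
qed

lemma vertical_kernel_L2:
  assumes "Re z \<noteq> c"
  shows "(\<lambda>y. 1 / (Complex c y - z)) \<in> L2 lborel"
    and "L2_norm_sq lborel (\<lambda>y. 1 / (Complex c y - z)) = pi / \<bar>c - Re z\<bar>"
proof -
  have "(cmod (Complex c y - z))\<^sup>2 = \<bar>c - Re z\<bar>\<^sup>2 + (y + - Im z)\<^sup>2" for y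
    by (simp add: cmod_power2)
  then have eq: "(cmod (1 / (Complex c y - z)))\<^sup>2 = 1 / (\<bar>c - Re z\<bar>\<^sup>2 + (y + - Im z)\<^sup>2)" for y
    by (simp add: norm_divide power_divide)
  have "(\<lambda>y. 1 / (Complex c y - z)) \<in> borel_measurable lborel"
    using assms by (intro borel_measurable_divide) (auto simp: Complex_eq intro!: borel_measurable_continuous_onI continuous_intros)
  moreover have "integrable lborel (\<lambda>y. (cmod (1 / (Complex c y - z)))\<^sup>2)"
    unfolding eq by (rule inverse_quadratic_integrable(1)) (use assms in simp)
  ultimately show "(\<lambda>y. 1 / (Complex c y - z)) \<in> L2 lborel"
    unfolding L2_def by blast
  show "L2_norm_sq lborel (\<lambda>y. 1 / (Complex c y - z)) = pi / \<bar>c - Re z\<bar>"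
    unfolding L2_norm_sq_def eq by (rule inverse_quadratic_integrable(2)) (use assms in simp)
qed

lemma hardy_cauchy_integrable:
  fixes f :: "complex \<Rightarrow> complex"
  assumes "f \<in> hardy_H2" "0 < c" "Re z \<noteq> c"
  shows "integrable lborel (\<lambda>y. f (Complex c y) / (Complex c y - z))"
  using L2_integrable_mult[OF hardy_vertical_line(1)[OF assms(1,2)] vertical_kernel_L2(1)[OF assms(3)]] by simp

lemma truncated_integral_tendsto:
  fixes g :: "real \<Rightarrow> complex"
  assumes g: "integrable lborel g" and Y: "filterlim Y at_top sequentially"
  shows "(\<lambda>k. integral {- Y k..Y k} g) \<longlonglongrightarrow> (\<integral>y. g y \<partial>lborel)"
proof -
  have sub: "set_integrable lborel {- Y k..Y k} g" for k
    using g unfolding set_integrable_def by (intro integrable_mult_indicator) auto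
  have "(\<lambda>k. \<integral>y. indicator {- Y k..Y k} y *\<^sub>R g y \<partial>lborel) \<longlonglongrightarrow> (\<integral>y. g y \<partial>lborel)"
  proof (rule integral_dominated_convergence)
    show "integrable lborel (\<lambda>y. cmod (g y))" using g by simp
    show "AE y in lborel. (\<lambda>k. indicator {- Y k..Y k} y *\<^sub>R g y) \<longlonglongrightarrow> g y"
    proof (rule AE_I2)
      fix y :: real
      have "\<forall>\<^sub>F k in sequentially. \<bar>y\<bar> \<le> Y k" using Y by (simp add: filterlim_at_top)
      then have "\<forall>\<^sub>F k in sequentially. indicator {- Y k..Y k} y *\<^sub>R g y = g y"
        by eventually_elim (auto simp: indicator_def)
      then show "(\<lambda>k. indicator {- Y k..Y k} y *\<^sub>R g y) \<longlonglongrightarrow> g y" by (rule tendsto_eventually)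
    qed
  qed (use g in \<open>auto simp: indicator_def\<close>)
  then show ?thesis
    using set_borel_integral_eq_integral(2)[OF sub] by (simp add: set_lebesgue_integral_def)
qed

text \<open>The rectangles grow vertically along heights at which the horizontal edges are negligible.\<close>

lemma hardy_strip:
  fixes f :: "complex \<Rightarrow> complex"
  assumes f: "f \<in> hardy_H2" and x: "0 < x" "x < Re z" and X: "Re z < X"
  shows "(\<integral>y. f (Complex X y) / (Complex X y - z) \<partial>lborel)
      - (\<integral>y. f (Complex x y) / (Complex x y - z) \<partial>lborel) = 2 * pi * f z"
proof -
  let ?g = "\<lambda>w. f w / (w - z)"
  have "\<forall>k. \<exists>Y. \<bar>Im z\<bar> + real (Suc k) < Y \<and> (\<forall>s\<in>{Y, - Y}.
      integral {0..1} (\<lambda>t. (cmod (f (Complex (x + t * (X - x)) s)))\<^sup>2) \<le> 1)"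
  proof
    fix k
    have "x \<le> X" using x X by simp
    from hardy_good_height[OF f x(1) this, of "\<bar>Im z\<bar> + real (Suc k)"]
    obtain Y where "\<bar>Im z\<bar> + real (Suc k) < Y" "\<And>s. s \<in> {Y, - Y} \<Longrightarrow>
        integral {0..1} (\<lambda>t. (cmod (f (Complex (x + t * (X - x)) s)))\<^sup>2) \<le> 1"
      by blast
    then show "\<exists>Y. \<bar>Im z\<bar> + real (Suc k) < Y \<and> (\<forall>s\<in>{Y, - Y}.
      integral {0..1} (\<lambda>t. (cmod (f (Complex (x + t * (X - x)) s)))\<^sup>2) \<le> 1)" by blast
  qed
  then obtain Y where Y: "\<And>k. \<bar>Im z\<bar> + real (Suc k) < Y k" "\<And>k s. s \<in> {Y k, - Y k} \<Longrightarrow>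
      integral {0..1} (\<lambda>t. (cmod (f (Complex (x + t * (X - x)) s)))\<^sup>2) \<le> 1"
    by metis
  have Ytop: "filterlim Y at_top sequentially"
  proof (rule filterlim_at_top_mono[OF filterlim_real_sequentially], intro always_eventually allI)
    show "real k \<le> Y k" for k using Y(1)[of k] by simp
  qed
  define E where "E s = contour_integral (linepath (Complex x s) (Complex X s)) ?g" for s
  have E_bound: "cmod (E s) \<le> (X - x) / real (Suc k)" if s: "s \<in> {Y k, - Y k}" for s k
  proof -
    have lin: "linepath (Complex x s) (Complex X s) t = Complex (x + t * (X - x)) s" for t
      by (simp add: linepath_def complex_eq_iff algebra_simps)
    have seg: "Im w = s \<and> 0 < Re w" if "w \<in> closed_segment (Complex x s) (Complex X s)" for w
      using that x X by (auto simp: closed_segment_same_Im closed_segment_eq_real_ivl)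
    have "cmod (E s) \<le> cmod (Complex X s - Complex x s) / real (Suc k)" unfolding E_def
    proof (rule horizontal_edge_bound)
      show "continuous_on (closed_segment (Complex x s) (Complex X s)) f"
        by (rule continuous_on_subset[OF holomorphic_on_imp_continuous_on[OF hardy_holomorphic[OF f]]])
          (use seg in \<open>auto simp: right_half_plane_def\<close>)
      show "integral {0..1} (\<lambda>t. (cmod (f (linepath (Complex x s) (Complex X s) t)))\<^sup>2) \<le> 1"
        unfolding lin using Y(2)[OF s] .
      fix w assume "w \<in> closed_segment (Complex x s) (Complex X s)"
      then have "Im w = s" using seg by simp
      then have "real (Suc k) \<le> \<bar>Im (w - z)\<bar>" using s Y(1)[of k] by auto
      then show "real (Suc k) \<le> cmod (w - z)" using abs_Im_le_cmod[of "w - z"] by linarith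
    qed simp
    also have "Complex X s - Complex x s = of_real (X - x)" by (simp add: complex_eq_iff)
    also have "cmod (of_real (X - x)) = X - x" unfolding norm_of_real using x X by simp
    finally show ?thesis .
  qed
  have E_lim: "(\<lambda>k. E (Y k)) \<longlonglongrightarrow> 0" "(\<lambda>k. E (- Y k)) \<longlonglongrightarrow> 0"
  proof -
    have L: "(\<lambda>k. (X - x) / real (Suc k)) \<longlonglongrightarrow> 0" by real_asymp
    have "\<forall>k. norm (E (Y k)) \<le> (X - x) / real (Suc k)" "\<forall>k. norm (E (- Y k)) \<le> (X - x) / real (Suc k)"
      by (intro allI E_bound; simp)+
    from this[THEN always_eventually, THEN Lim_null_comparison, OF L]
    show "(\<lambda>k. E (Y k)) \<longlonglongrightarrow> 0" "(\<lambda>k. E (- Y k)) \<longlonglongrightarrow> 0" .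
  qed
  have "(\<lambda>k. \<i> * integral {- Y k..Y k} (\<lambda>y. ?g (Complex X y)) - \<i> * integral {- Y k..Y k} (\<lambda>y. ?g (Complex x y))
      + E (- Y k) - E (Y k)) \<longlonglongrightarrow>
      \<i> * (\<integral>y. ?g (Complex X y) \<partial>lborel) - \<i> * (\<integral>y. ?g (Complex x y) \<partial>lborel) + 0 - 0"
    using x X by (intro tendsto_intros E_lim truncated_integral_tendsto hardy_cauchy_integrable f Ytop) auto
  moreover have "\<i> * integral {- Y k..Y k} (\<lambda>y. ?g (Complex X y)) - \<i> * integral {- Y k..Y k} (\<lambda>y. ?g (Complex x y))
      + E (- Y k) - E (Y k) = 2 * pi * \<i> * f z" for k
    unfolding E_def using Y(1)[of k] by (intro hardy_rectangle f x X) auto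
  ultimately have "2 * pi * \<i> * f z = \<i> * (\<integral>y. ?g (Complex X y) \<partial>lborel) - \<i> * (\<integral>y. ?g (Complex x y) \<partial>lborel) + 0 - 0"
    by (simp add: LIMSEQ_const_iff)
  then have "\<i> * (2 * pi * f z) = \<i> * ((\<integral>y. ?g (Complex X y) \<partial>lborel) - (\<integral>y. ?g (Complex x y) \<partial>lborel))"
    by (simp add: algebra_simps)
  then show ?thesis by (simp only: mult_cancel_left) simp
qed

text \<open>The right edge of the strip moves to infinity; its contribution vanishes because the norm of the
  Cauchy kernel on that line does.\<close>

lemma hardy_cauchy_formula:
  fixes f :: "complex \<Rightarrow> complex"
  assumes f: "f \<in> hardy_H2" and x: "0 < x" "x < Re z"
  shows "2 * pi * f z = - (\<integral>y. f (Complex x y) / (Complex x y - z) \<partial>lborel)"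
proof -
  define L where "L = 2 * pi * f z + (\<integral>y. f (Complex x y) / (Complex x y - z) \<partial>lborel)"
  have "(cmod L)\<^sup>2 \<le> enn2real (H2_norm_sq f) * (pi / t)" if "0 < t" for t
  proof -
    let ?X = "Re z + t"
    have X: "Re z < ?X" "0 < ?X" "Re z \<noteq> ?X" using that x by auto
    have "L = (\<integral>y. f (Complex ?X y) * (1 / (Complex ?X y - z)) \<partial>lborel)"
      using hardy_strip[OF f x X(1)] unfolding L_def by (simp add: algebra_simps)
    then have "(cmod L)\<^sup>2 \<le> L2_norm_sq lborel (\<lambda>y. f (Complex ?X y)) * L2_norm_sq lborel (\<lambda>y. 1 / (Complex ?X y - z))"
      using L2_Cauchy_Schwarz[OF hardy_vertical_line(1)[OF f X(2)] vertical_kernel_L2(1)[OF X(3)]] by simp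
    also have "\<dots> \<le> enn2real (H2_norm_sq f) * (pi / t)"
      using that unfolding vertical_kernel_L2(2)[OF X(3)]
      by (intro mult_mono hardy_vertical_line(2)[OF f X(2)]) auto
    finally show ?thesis .
  qed
  moreover have "((\<lambda>t. enn2real (H2_norm_sq f) * (pi / t)) \<longlongrightarrow> enn2real (H2_norm_sq f) * 0) at_top"
    by (intro tendsto_mult tendsto_const) real_asymp
  ultimately have "(cmod L)\<^sup>2 \<le> enn2real (H2_norm_sq f) * 0"
    by (intro tendsto_le[OF _ _ tendsto_const]) (auto intro: eventually_mono[OF eventually_gt_at_top[of 0]])
  then show ?thesis unfolding L_def by (simp add: eq_neg_iff_add_eq_0)
qed

text \<open>Evaluation at \<open>z n\<close> is the inner product with the \<open>n\<close>-th kernel. The proof works on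
  the line \<open>Re w = x\<close> and lets \<open>x\<close> tend to \<open>0\<close>, which avoids boundary values.\<close>

lemma hardy_dual_bound:
  fixes f :: "complex \<Rightarrow> complex"
  assumes f: "f \<in> hardy_H2" and pos: "\<And>n. n < K \<Longrightarrow> 0 < Re (z n)"
  shows "(cmod (\<Sum>n<K. cnj (a n) * f (z n)))\<^sup>2 \<le>
    enn2real (H2_norm_sq f) / (2 * pi) * L2_norm_sq halfline (exp_sum z K a)"
proof -
  let ?m = "enn2real (H2_norm_sq f)" and ?k = "\<lambda>y. kernel_sum z K a (\<i> * of_real y)"
  have shifted: "(cmod (\<Sum>n<K. cnj (a n) * f (z n + of_real x)))\<^sup>2 \<le> ?m / (2 * pi) * L2_norm_sq halfline (exp_sum z K a)"
    if x: "0 < x" for x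
  proof -
    have int: "integrable lborel (\<lambda>y. f (Complex x y) / (z n - \<i> * of_real y))"
      and cauchy: "2 * pi * f (z n + of_real x) = (\<integral>y. f (Complex x y) / (z n - \<i> * of_real y) \<partial>lborel)"
      if n: "n < K" for n
    proof -
      have eq: "f (Complex x y) / (z n - \<i> * of_real y) = - (f (Complex x y) / (Complex x y - (z n + of_real x)))" for y
        by (simp add: Complex_eq minus_divide_right)
      have "integrable lborel (\<lambda>y. f (Complex x y) / (Complex x y - (z n + of_real x)))"
        using pos[OF n] x by (intro hardy_cauchy_integrable f) auto
      then show "integrable lborel (\<lambda>y. f (Complex x y) / (z n - \<i> * of_real y))" unfolding eq by simp
      show "2 * pi * f (z n + of_real x) = (\<integral>y. f (Complex x y) / (z n - \<i> * of_real y) \<partial>lborel)"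
        unfolding eq using hardy_cauchy_formula[OF f x, of "z n + of_real x"] pos[OF n] x by simp
    qed
    have "2 * pi * (\<Sum>n<K. cnj (a n) * f (z n + of_real x)) =
        (\<Sum>n<K. cnj (a n) * (2 * pi * f (z n + of_real x)))"
      by (simp add: sum_distrib_left mult_ac)
    also have "\<dots> = (\<Sum>n<K. \<integral>y. cnj (a n) * (f (Complex x y) / (z n - \<i> * of_real y)) \<partial>lborel)"
    proof (rule sum.cong[OF refl])
      fix n assume "n \<in> {..<K}"
      then show "cnj (a n) * (2 * pi * f (z n + of_real x)) =
          (\<integral>y. cnj (a n) * (f (Complex x y) / (z n - \<i> * of_real y)) \<partial>lborel)"
        unfolding integral_mult_right_zero by (simp only: cauchy lessThan_iff)
    qed
    also have "\<dots> = (\<integral>y. (\<Sum>n<K. cnj (a n) * (f (Complex x y) / (z n - \<i> * of_real y))) \<partial>lborel)"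
      by (intro Bochner_Integration.integral_sum[symmetric] integrable_mult_right int) auto
    also have "\<dots> = (\<integral>y. f (Complex x y) * cnj (?k y) \<partial>lborel)"
      by (intro Bochner_Integration.integral_cong refl) (simp add: kernel_sum_def sum_distrib_left mult_ac)
    finally have eq: "2 * pi * (\<Sum>n<K. cnj (a n) * f (z n + of_real x)) = (\<integral>y. f (Complex x y) * cnj (?k y) \<partial>lborel)" .
    have "(2 * pi)\<^sup>2 * (cmod (\<Sum>n<K. cnj (a n) * f (z n + of_real x)))\<^sup>2
        = (cmod (2 * pi * (\<Sum>n<K. cnj (a n) * f (z n + of_real x))))\<^sup>2"
      by (simp add: norm_mult power_mult_distrib)
    also have "\<dots> \<le> L2_norm_sq lborel (\<lambda>y. f (Complex x y)) * L2_norm_sq lborel (\<lambda>y. cnj (?k y))"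
      unfolding eq by (intro L2_Cauchy_Schwarz hardy_vertical_line f x L2_cnj kernel_sum_vertical_line(1) pos)
    also have "\<dots> \<le> ?m * L2_norm_sq lborel (\<lambda>y. cnj (?k y))"
      by (intro mult_right_mono hardy_vertical_line f x L2_norm_sq_nonneg)
    also have "L2_norm_sq lborel (\<lambda>y. cnj (?k y)) = 2 * pi * L2_norm_sq halfline (exp_sum z K a)"
      using kernel_sum_vertical_line(2)[of K z a, OF pos] by (simp add: L2_norm_sq_def)
    finally have "(2 * pi)\<^sup>2 * (cmod (\<Sum>n<K. cnj (a n) * f (z n + of_real x)))\<^sup>2
        \<le> (2 * pi)\<^sup>2 * (?m / (2 * pi) * L2_norm_sq halfline (exp_sum z K a))"
      by (simp add: power2_eq_square)
    then show ?thesis by (rule mult_left_le_imp_le) simp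
  qed
  have tend: "((\<lambda>x. f (z n + of_real x)) \<longlongrightarrow> f (z n + of_real 0)) (at_right 0)" if n: "n < K" for n
  proof -
    have "isCont f (z n)"
      using holomorphic_on_imp_continuous_on[OF hardy_holomorphic[OF f]] open_right_half_plane pos[OF n]
      by (simp add: continuous_on_eq_continuous_at right_half_plane_def)
    then show ?thesis by (intro isCont_tendsto_compose[of _ f] tendsto_intros) auto
  qed
  have "((\<lambda>x. (cmod (\<Sum>n<K. cnj (a n) * f (z n + of_real x)))\<^sup>2) \<longlongrightarrow>
      (cmod (\<Sum>n<K. cnj (a n) * f (z n + of_real 0)))\<^sup>2) (at_right 0)"
    by (intro tendsto_intros tend) auto
  moreover have "\<forall>\<^sub>F x in at_right 0. (cmod (\<Sum>n<K. cnj (a n) * f (z n + of_real x)))\<^sup>2 \<le>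
      ?m / (2 * pi) * L2_norm_sq halfline (exp_sum z K a)"
    using shifted by (auto simp: eventually_at_right_less intro!: eventually_mono[OF eventually_at_right_less[of 0]])
  ultimately have "(cmod (\<Sum>n<K. cnj (a n) * f (z n + of_real 0)))\<^sup>2 \<le>
      ?m / (2 * pi) * L2_norm_sq halfline (exp_sum z K a)"
    by (intro tendsto_upperbound) auto
  then show ?thesis by simp
qed

section \<open>Moment problem and Carleson measures\<close>

text \<open>Up to the sign \<open>(-1) ^ i\<close>, the \<open>i\<close>-th derivative of the Laplace transform of \<open>u\<close> at \<open>w\<close>.\<close>

definition moment :: "nat \<Rightarrow> complex \<Rightarrow> (real \<Rightarrow> complex) \<Rightarrow> complex"
  where "moment i w u = (\<integral>s. of_real (s ^ i) * exp (- (w * of_real s)) * u s \<partial>halfline)"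

abbreviation exp_norm_sq :: "(nat \<Rightarrow> complex) \<Rightarrow> nat \<Rightarrow> (nat \<Rightarrow> complex) \<Rightarrow> real"
  where "exp_norm_sq z K a \<equiv> L2_norm_sq halfline (exp_sum z K a)"

text \<open>The conjugates on \<open>b\<close> make the moment \<open>b n * moment 0 (z n) u\<close> the inner product of \<open>u\<close>
  with the \<open>n\<close>-th function of the family.\<close>

definition riesz_lower_bound :: "(nat \<Rightarrow> complex) \<Rightarrow> (nat \<Rightarrow> complex) \<Rightarrow> bool"
  where "riesz_lower_bound z b \<longleftrightarrow>
    (\<exists>c>0. \<forall>K a. c * (\<Sum>n<K. (cmod (a n))\<^sup>2) \<le> exp_norm_sq z K (\<lambda>n. a n * cnj (b n)))"

definition partial_dist :: "(nat \<Rightarrow> complex) \<Rightarrow> nat \<Rightarrow> nat \<Rightarrow> real"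
  where "partial_dist z n K = (\<Prod>k\<in>{..<K} - {n}. cmod ((z n - z k) / (z n + cnj (z k))))"

lemma moment_0: "moment 0 w u = (\<integral>s. exp (- (w * of_real s)) * u s \<partial>halfline)"
  unfolding moment_def by simp

lemma moment_0_exp_sum:
  assumes "\<And>n. n < K \<Longrightarrow> 0 < Re (z n)" "0 < Re w"
  shows "moment 0 w (exp_sum z K a) = kernel_sum z K a w"
  unfolding moment_0 by (rule laplace_exp_sum[OF assms])

lemma integral_mult_cnj_exp_sum:
  assumes u: "u \<in> L2 halfline" and pos: "\<And>n. n < K \<Longrightarrow> 0 < Re (z n)"
  shows "(\<integral>s. u s * cnj (exp_sum z K a s) \<partial>halfline) = (\<Sum>n<K. cnj (a n) * moment 0 (z n) u)"
proof -
  have int: "integrable halfline (\<lambda>s. exp (- (z n * of_real s)) * u s)" if "n < K" for n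
    by (intro L2_integrable_mult exp_L2_halfline pos that u)
  have "(\<integral>s. u s * cnj (exp_sum z K a s) \<partial>halfline) =
      (\<integral>s. (\<Sum>n<K. cnj (a n) * (exp (- (z n * of_real s)) * u s)) \<partial>halfline)"
    by (intro Bochner_Integration.integral_cong refl)
      (simp add: exp_sum_def exp_cnj sum_distrib_left mult_ac)
  also have "\<dots> = (\<Sum>n<K. \<integral>s. cnj (a n) * (exp (- (z n * of_real s)) * u s) \<partial>halfline)"
    by (intro Bochner_Integration.integral_sum integrable_mult_right int) auto
  also have "\<dots> = (\<Sum>n<K. cnj (a n) * moment 0 (z n) u)"
    unfolding moment_0 by (intro sum.cong refl integral_mult_right_zero)
  finally show ?thesis .
qed

lemma exp_norm_sq_eq:
  assumes pos: "\<And>n. n < K \<Longrightarrow> 0 < Re (z n)"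
  shows "of_real (exp_norm_sq z K a) = (\<Sum>n<K. cnj (a n) * kernel_sum z K a (z n))"
  using gram_form_eq_norm[of K z a, OF pos] unfolding gram_form_def by simp

lemma exp_norm_sq_reflection:
  assumes "inj_on z {..<K}" and pos: "\<And>n. n < K \<Longrightarrow> 0 < Re (z n)"
  shows "exp_norm_sq z K (reflection z K a) = exp_norm_sq z K a"
  using gram_form_reflection[OF assms, of a] gram_form_eq_norm[of K z, OF pos]
  by (metis of_real_eq_iff)

lemma partial_dist_factor:
  assumes "0 < Re v" "0 < Re w"
  shows "cmod ((v - w) / (v + cnj w)) \<le> 1"
proof -
  have "(cmod (v - w))\<^sup>2 \<le> (cmod (v + cnj w))\<^sup>2"
    using mult_pos_pos[OF assms] by (simp add: cmod_power2 power2_diff power2_sum)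
  then have "cmod (v - w) \<le> cmod (v + cnj w)" by (rule power2_le_imp_le) simp
  then show ?thesis using add_cnj_neq_0(1)[OF assms] by (simp add: norm_divide)
qed

lemma partial_dist_Suc:
  "partial_dist z n (Suc K) = (if n = K then 1 else cmod ((z n - z K) / (z n + cnj (z K)))) * partial_dist z n K"
proof -
  have "{..<Suc K} - {n} = (if n = K then {..<K} - {n} else insert K ({..<K} - {n}))" by auto
  then show ?thesis unfolding partial_dist_def by simp
qed

lemma partial_dist_pos:
  assumes "inj z" "\<And>n. 0 < Re (z n)"
  shows "0 < partial_dist z n K"
  using assms add_cnj_neq_0(1)[OF assms(2) assms(2)]
  unfolding partial_dist_def by (auto intro!: prod_pos simp: inj_eq)

text \<open>The numbers \<open>d n\<close> of the Carleson weights.\<close>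

definition dist_limit :: "(nat \<Rightarrow> complex) \<Rightarrow> nat \<Rightarrow> real"
  where "dist_limit z n = lim (partial_dist z n)"

definition mcphail_measure :: "(nat \<Rightarrow> complex) \<Rightarrow> (nat \<Rightarrow> complex) \<Rightarrow> complex measure"
  where "mcphail_measure z b = point_masses
    (\<lambda>n. ennreal ((Re (z n))\<^sup>2) / ennreal ((cmod (b n))\<^sup>2 * (dist_limit z n)\<^sup>2)) z"

context
  fixes z :: "nat \<Rightarrow> complex"
  assumes inj: "inj z" and pos: "\<And>n. 0 < Re (z n)"
begin

lemma partial_dist_decseq: "decseq (partial_dist z n)"
proof (rule decseq_SucI)
  show "partial_dist z n (Suc K) \<le> partial_dist z n K" for K
    unfolding partial_dist_Suc using partial_dist_factor[OF pos pos] partial_dist_pos[OF inj pos, of n K]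
    by (auto intro!: mult_left_le_one_le less_imp_le)
qed

lemma partial_dist_tendsto: "partial_dist z n \<longlonglongrightarrow> dist_limit z n"
proof -
  have "convergent (partial_dist z n)"
    using partial_dist_decseq partial_dist_pos[OF inj pos, THEN less_imp_le]
    by (metis decseq_convergent convergentI)
  then show ?thesis unfolding dist_limit_def by (simp add: convergent_LIMSEQ_iff)
qed

lemma dist_limit_le: "dist_limit z n \<le> partial_dist z n K"
  using decseq_ge[OF partial_dist_decseq partial_dist_tendsto] .

lemma dist_limit_nonneg: "0 \<le> dist_limit z n"
  by (rule LIMSEQ_le_const[OF partial_dist_tendsto]) (auto intro: less_imp_le partial_dist_pos[OF inj pos])

lemma norm_blaschke_deriv':
  assumes "n < K"
  shows "cmod (blaschke_deriv z K n) = partial_dist z n K / (2 * Re (z n))"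
  using norm_blaschke_deriv[of n K z, OF assms pos] unfolding partial_dist_def by simp

text \<open>Finiteness of the Carleson integral of this function excludes an infinite weight at \<open>z n\<close>.\<close>

lemma point_kernel:
  obtains f where "f \<in> hardy_H2" "f (z n) \<noteq> 0"
proof
  let ?a = "\<lambda>k. if k = n then 1 else 0"
  show "kernel_sum z (Suc n) ?a \<in> hardy_H2" by (rule kernel_sum_hardy(1)[OF pos])
  have "kernel_sum z (Suc n) ?a (z n) = 1 / (z n + cnj (z n))"
    unfolding kernel_sum_def by (simp add: if_distrib[of "\<lambda>c. c / _"] cong: if_cong)
  then show "kernel_sum z (Suc n) ?a (z n) \<noteq> 0" using add_cnj_neq_0(1)[OF pos pos] by simp
qed

lemma riesz_lower_bound_imp_neq_0:
  assumes "riesz_lower_bound z b"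
  shows "b n \<noteq> 0"
proof
  assume b: "b n = 0"
  obtain c where c: "0 < c" "\<And>K a. c * (\<Sum>n<K. (cmod (a n))\<^sup>2) \<le> exp_norm_sq z K (\<lambda>n. a n * cnj (b n))"
    using assms unfolding riesz_lower_bound_def by blast
  let ?a = "\<lambda>k. if k = n then 1 else 0 :: complex"
  have "exp_sum z (Suc n) (\<lambda>k. ?a k * cnj (b k)) = (\<lambda>s. 0)"
    unfolding exp_sum_def using b by (auto intro!: sum.neutral)
  then have "exp_norm_sq z (Suc n) (\<lambda>k. ?a k * cnj (b k)) = 0" by (simp add: L2_norm_sq_def)
  moreover have "(\<Sum>k<Suc n. (cmod (?a k))\<^sup>2) = 1"
    by (simp add: if_distrib[of "\<lambda>c. (cmod c)\<^sup>2"] cong: if_cong)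
  ultimately show False using c(1) c(2)[where K = "Suc n" and a = ?a] by simp
qed

text \<open>The reflected coefficients \<open>a'\<close> are chosen such that their kernel sum interpolates \<open>f\<close> at the
  first \<open>K\<close> nodes. Its norm is at most that of \<open>f\<close>, by duality, and at least the weighted sum of
  values, by the lower bound before reflection. The constant \<open>8 * pi\<close> is
  \<open>2 * pi\<close> from the norm on vertical lines times \<open>4\<close> from \<open>(2 * Re (z n))\<^sup>2\<close>.\<close>

lemma finite_carleson_of_lower_bound:
  assumes c: "0 < c" "\<And>K a. c * (\<Sum>n<K. (cmod (a n))\<^sup>2) \<le> exp_norm_sq z K (\<lambda>n. a n * cnj (b n))"
    and b: "\<And>n. b n \<noteq> 0" and f: "f \<in> hardy_H2"
  shows "(\<Sum>n<K. (Re (z n))\<^sup>2 / ((cmod (b n))\<^sup>2 * (partial_dist z n K)\<^sup>2) * (cmod (f (z n)))\<^sup>2)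
    \<le> enn2real (H2_norm_sq f) / (8 * pi * c)"
proof -
  let ?m = "enn2real (H2_norm_sq f)"
  have injK: "inj_on z {..<K}" using inj by (rule inj_on_subset) simp
  \<comment> \<open>The reflection of these coefficients takes the values of \<open>f\<close>.\<close>
  define p where "p n = - cnj (f (z n) / blaschke_deriv z K n)" for n
  define a' where "a' = reflection z K p"
  define q where "q = exp_norm_sq z K a'"
  have node: "kernel_sum z K a' (z n) = f (z n)" if "n < K" for n
    unfolding a'_def using blaschke_deriv_neq_0[OF injK pos that]
    by (subst kernel_sum_reflection_node[OF injK pos that]) (simp add: p_def)
  have "complex_of_real q = (\<Sum>n<K. cnj (a' n) * f (z n))"
    unfolding q_def exp_norm_sq_eq[OF pos] using node by (intro sum.cong) auto
  then have "(cmod (complex_of_real q))\<^sup>2 \<le> ?m / (2 * pi) * q"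
    using hardy_dual_bound[OF f, of K z a'] pos unfolding q_def by simp
  then have "q * q \<le> ?m / (2 * pi) * q" by (simp add: power2_eq_square)
  moreover have "0 \<le> q" unfolding q_def by (rule L2_norm_sq_nonneg)
  ultimately have q_le: "q \<le> ?m / (2 * pi)"
    using mult_right_le_imp_le[of q q "?m / (2 * pi)"] by (cases "q = 0") auto
  have "c * (\<Sum>n<K. (cmod (p n / cnj (b n)))\<^sup>2) \<le> exp_norm_sq z K p"
    using c(2)[where a = "\<lambda>n. p n / cnj (b n)"] b by simp
  also have "\<dots> = q" unfolding q_def a'_def by (rule exp_norm_sq_reflection[OF injK pos, symmetric])
  finally have "c * (\<Sum>n<K. (cmod (p n / cnj (b n)))\<^sup>2) \<le> ?m / (2 * pi)" using q_le by linarith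
  moreover have "(\<Sum>n<K. (cmod (p n / cnj (b n)))\<^sup>2) =
      4 * (\<Sum>n<K. (Re (z n))\<^sup>2 / ((cmod (b n))\<^sup>2 * (partial_dist z n K)\<^sup>2) * (cmod (f (z n)))\<^sup>2)"
    unfolding sum_distrib_left
  proof (rule sum.cong[OF refl])
    fix n assume "n \<in> {..<K}"
    then show "(cmod (p n / cnj (b n)))\<^sup>2 =
        4 * ((Re (z n))\<^sup>2 / ((cmod (b n))\<^sup>2 * (partial_dist z n K)\<^sup>2) * (cmod (f (z n)))\<^sup>2)"
      by (simp add: p_def norm_divide norm_mult norm_blaschke_deriv' power_divide power_mult_distrib mult_ac)
  qed
  ultimately show ?thesis using c(1) by (simp add: field_simps)
qed

lemma carleson_integral:
  assumes f: "f \<in> hardy_H2"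
  shows "(\<integral>\<^sup>+ x\<in>right_half_plane. ennreal ((cmod (f x))\<^sup>2) \<partial>point_masses w z) =
    (\<Sum>n. w n * ennreal ((cmod (f (z n)))\<^sup>2))"
proof -
  have "(\<lambda>x. ennreal ((cmod (indicator right_half_plane x *\<^sub>R f x))\<^sup>2)) \<in> borel_measurable borel"
    using hardy_measurable[OF f] by measurable
  moreover have "ennreal ((cmod (f x))\<^sup>2) * indicator right_half_plane x =
      ennreal ((cmod (indicator right_half_plane x *\<^sub>R f x))\<^sup>2)" for x
    by (simp add: indicator_def)
  ultimately have "(\<integral>\<^sup>+ x\<in>right_half_plane. ennreal ((cmod (f x))\<^sup>2) \<partial>point_masses w z) =
      (\<integral>\<^sup>+ n. ennreal ((cmod (indicator right_half_plane (z n) *\<^sub>R f (z n)))\<^sup>2) \<partial>density (count_space UNIV) w)"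
    unfolding point_masses_def by (simp add: nn_integral_distr)
  also have "\<dots> = (\<integral>\<^sup>+ n. w n * ennreal ((cmod (f (z n)))\<^sup>2) \<partial>count_space UNIV)"
    using pos by (subst nn_integral_density) (auto simp: right_half_plane_def)
  also have "\<dots> = (\<Sum>n. w n * ennreal ((cmod (f (z n)))\<^sup>2))" by (rule nn_integral_count_space_nat)
  finally show ?thesis .
qed

text \<open>Let \<open>K\<close> tend to infinity in the finite inequalities. They bound the partial products away from
  \<open>0\<close>, so that all limiting weights are finite.\<close>

lemma carleson_of_lower_bound:
  assumes lb: "riesz_lower_bound z b"
  shows "carleson_measure (mcphail_measure z b)"
proof -
  obtain c where c: "0 < c" "\<And>K a. c * (\<Sum>n<K. (cmod (a n))\<^sup>2) \<le> exp_norm_sq z K (\<lambda>n. a n * cnj (b n))"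
    using lb unfolding riesz_lower_bound_def by blast
  note b = riesz_lower_bound_imp_neq_0[OF lb]
  note fin = finite_carleson_of_lower_bound[OF c b]
  let ?t = "\<lambda>f n K. (Re (z n))\<^sup>2 / ((cmod (b n))\<^sup>2 * (partial_dist z n K)\<^sup>2) * (cmod (f (z n)))\<^sup>2"
  have t_nonneg: "0 \<le> ?t f n K" for f n K by simp
  have dist_pos: "dist_limit z n \<noteq> 0" for n
  proof
    assume zero: "dist_limit z n = 0"
    obtain f where f: "f \<in> hardy_H2" "f (z n) \<noteq> 0" by (rule point_kernel)
    let ?B = "enn2real (H2_norm_sq f) / (8 * pi * c)"
    have "?t f n K \<le> ?B" if "n < K" for K
    proof -
      have "?t f n K \<le> (\<Sum>n<K. ?t f n K)" using that by (intro member_le_sum t_nonneg) auto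
      then show ?thesis using fin[OF f(1), of K] by linarith
    qed
    then have "(Re (z n))\<^sup>2 * (cmod (f (z n)))\<^sup>2 \<le> ?B * ((cmod (b n))\<^sup>2 * (partial_dist z n K)\<^sup>2)" if "n < K" for K
    proof -
      have Y: "0 < (cmod (b n))\<^sup>2 * (partial_dist z n K)\<^sup>2"
        using b[of n] partial_dist_pos[OF inj pos, of n K] by simp
      from \<open>\<And>K. n < K \<Longrightarrow> ?t f n K \<le> ?B\<close>[OF that]
      have "(Re (z n))\<^sup>2 * (cmod (f (z n)))\<^sup>2 / ((cmod (b n))\<^sup>2 * (partial_dist z n K)\<^sup>2) \<le> ?B"
        by (simp only: times_divide_eq_left)
      then show ?thesis by (simp only: pos_divide_le_eq[OF Y])
    qed
    then have "\<forall>\<^sub>F K in sequentially. (Re (z n))\<^sup>2 * (cmod (f (z n)))\<^sup>2 \<le> ?B * ((cmod (b n))\<^sup>2 * (partial_dist z n K)\<^sup>2)"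
      using eventually_gt_at_top[of n] by (rule eventually_mono[rotated])
    moreover have "(\<lambda>K. ?B * ((cmod (b n))\<^sup>2 * (partial_dist z n K)\<^sup>2)) \<longlonglongrightarrow> ?B * ((cmod (b n))\<^sup>2 * 0\<^sup>2)"
      using partial_dist_tendsto[of n] unfolding zero by (intro tendsto_intros)
    ultimately have "(Re (z n))\<^sup>2 * (cmod (f (z n)))\<^sup>2 \<le> ?B * ((cmod (b n))\<^sup>2 * 0\<^sup>2)"
      by (intro tendsto_lowerbound) auto
    then have "(Re (z n))\<^sup>2 * (cmod (f (z n)))\<^sup>2 \<le> 0" by simp
    moreover have "0 < (Re (z n))\<^sup>2 * (cmod (f (z n)))\<^sup>2" using pos[of n] f(2) by simp
    ultimately show False by simp
  qed
  define w where "w n = (Re (z n))\<^sup>2 / ((cmod (b n))\<^sup>2 * (dist_limit z n)\<^sup>2)" for n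
  have w_eq: "ennreal ((Re (z n))\<^sup>2) / ennreal ((cmod (b n))\<^sup>2 * (dist_limit z n)\<^sup>2) = ennreal (w n)" for n
    unfolding w_def using b[of n] dist_pos[of n] by (intro divide_ennreal) auto
  have w_nonneg: "0 \<le> w n" for n unfolding w_def by simp
  have "(\<Sum>n. ennreal (w n) * ennreal ((cmod (f (z n)))\<^sup>2)) \<le> ennreal (1 / (8 * pi * c)) * H2_norm_sq f"
    if f: "f \<in> hardy_H2" for f
  proof (rule suminf_le_const)
    fix J
    let ?m = "enn2real (H2_norm_sq f)"
    have "(\<lambda>K. \<Sum>n<J. ?t f n K) \<longlonglongrightarrow> (\<Sum>n<J. w n * (cmod (f (z n)))\<^sup>2)"
      unfolding w_def using b dist_pos by (intro tendsto_intros partial_dist_tendsto) auto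
    moreover have "(\<Sum>n<J. ?t f n K) \<le> ?m / (8 * pi * c)" if "J \<le> K" for K
    proof -
      have "(\<Sum>n<J. ?t f n K) \<le> (\<Sum>n<K. ?t f n K)" using that by (intro sum_mono2 t_nonneg) auto
      then show ?thesis using fin[OF f, of K] by linarith
    qed
    ultimately have le: "(\<Sum>n<J. w n * (cmod (f (z n)))\<^sup>2) \<le> ?m / (8 * pi * c)"
      by (blast intro: LIMSEQ_le_const2)
    have "(\<Sum>n<J. ennreal (w n) * ennreal ((cmod (f (z n)))\<^sup>2)) = ennreal (\<Sum>n<J. w n * (cmod (f (z n)))\<^sup>2)"
      using w_nonneg by (simp add: ennreal_mult sum_ennreal[symmetric])
    also have "\<dots> \<le> ennreal (1 / (8 * pi * c) * ?m)" using le by (intro ennreal_leI) simp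
    also have "\<dots> = ennreal (1 / (8 * pi * c)) * ennreal ?m" using c(1) by (intro ennreal_mult) auto
    also have "ennreal ?m = H2_norm_sq f" using f unfolding hardy_H2_def by simp
    finally show "(\<Sum>n<J. ennreal (w n) * ennreal ((cmod (f (z n)))\<^sup>2)) \<le> ennreal (1 / (8 * pi * c)) * H2_norm_sq f" .
  qed simp
  moreover have "sets (mcphail_measure z b) = sets borel"
    by (simp add: mcphail_measure_def point_masses_def)
  ultimately show ?thesis
    unfolding carleson_measure_def by (auto simp: mcphail_measure_def w_eq carleson_integral)
qed

text \<open>The test function is the reflected kernel sum: its values at the nodes are the coefficients
  weighted by \<open>b n\<close> and the partial products, and its norm is that of the original exponential sum.\<close>

lemma lower_bound_of_carleson:
  assumes carl: "carleson_measure (mcphail_measure z b)"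
  shows "riesz_lower_bound z b"
proof -
  let ?w = "\<lambda>n. ennreal ((Re (z n))\<^sup>2) / ennreal ((cmod (b n))\<^sup>2 * (dist_limit z n)\<^sup>2)"
  obtain C :: real where C: "\<And>f. f \<in> hardy_H2 \<Longrightarrow>
      (\<Sum>n. ?w n * ennreal ((cmod (f (z n)))\<^sup>2)) \<le> ennreal C * H2_norm_sq f"
  proof -
    obtain C :: real where "\<And>f. f \<in> hardy_H2 \<Longrightarrow>
        (\<integral>\<^sup>+ x\<in>right_half_plane. ennreal ((cmod (f x))\<^sup>2) \<partial>mcphail_measure z b) \<le> ennreal C * H2_norm_sq f"
      using carl unfolding carleson_measure_def by blast
    then show thesis unfolding mcphail_measure_def by (intro that[of C]) (simp add: carleson_integral)
  qed
  have term_le: "?w n * ennreal ((cmod (f (z n)))\<^sup>2) \<le> ennreal C * H2_norm_sq f" if f: "f \<in> hardy_H2" for f n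
  proof -
    have "(\<Sum>k\<in>{n}. ?w k * ennreal ((cmod (f (z k)))\<^sup>2)) \<le> (\<Sum>n. ?w n * ennreal ((cmod (f (z n)))\<^sup>2))"
      by (intro sum_le_suminf) auto
    then show ?thesis using C[OF f] by simp
  qed
  have nz: "b n \<noteq> 0 \<and> dist_limit z n \<noteq> 0" for n
  proof (rule ccontr)
    assume "\<not> ?thesis"
    then have w: "?w n = \<infinity>" using pos[of n] by (auto simp: ennreal_divide_zero ennreal_zero_divide)
    obtain f where f: "f \<in> hardy_H2" "f (z n) \<noteq> 0" by (rule point_kernel)
    have "?w n * ennreal ((cmod (f (z n)))\<^sup>2) = \<infinity>" unfolding w using f(2) by (simp add: ennreal_top_mult)
    moreover have "ennreal C * H2_norm_sq f < \<infinity>"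
      using f(1) unfolding hardy_H2_def by (auto simp: ennreal_mult_less_top)
    ultimately show False using term_le[OF f(1), of n] by simp
  qed
  define w where "w n = (Re (z n))\<^sup>2 / ((cmod (b n))\<^sup>2 * (dist_limit z n)\<^sup>2)" for n
  have w_eq: "?w n = ennreal (w n)" for n
    unfolding w_def using nz[of n] by (intro divide_ennreal) auto
  have w_nonneg: "0 \<le> w n" for n unfolding w_def by simp
  define R where "R = 8 * pi * \<bar>C\<bar> + 1"
  have R: "0 < R" unfolding R_def by (simp add: add_nonneg_pos)
  have main: "(\<Sum>n<K. (cmod (a n))\<^sup>2) \<le> R * exp_norm_sq z K (\<lambda>n. a n * cnj (b n))" for K a
  proof -
    let ?p = "\<lambda>n. a n * cnj (b n)"
    have injK: "inj_on z {..<K}" using inj by (rule inj_on_subset) simp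
    define f where "f = kernel_sum z K (reflection z K ?p)"
    have f: "f \<in> hardy_H2" unfolding f_def by (rule kernel_sum_hardy(1)[OF pos])
    have norm_f: "H2_norm_sq f \<le> ennreal (2 * pi * exp_norm_sq z K ?p)"
      using kernel_sum_hardy(2)[of K z "reflection z K ?p", OF pos]
      unfolding f_def exp_norm_sq_reflection[OF injK pos] .
    have t: "(cmod (a n))\<^sup>2 / 4 \<le> w n * (cmod (f (z n)))\<^sup>2" if n: "n < K" for n
    proof -
      have "f (z n) = - cnj (?p n) * blaschke_deriv z K n"
        unfolding f_def by (rule kernel_sum_reflection_node[OF injK pos n])
      then have "(cmod (f (z n)))\<^sup>2 = (cmod (a n))\<^sup>2 * (cmod (b n))\<^sup>2 * (partial_dist z n K)\<^sup>2 / (4 * (Re (z n))\<^sup>2)"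
        by (simp add: norm_mult norm_blaschke_deriv'[OF n] power_mult_distrib power_divide)
      then have "w n * (cmod (f (z n)))\<^sup>2 = (cmod (a n))\<^sup>2 / 4 * ((partial_dist z n K)\<^sup>2 / (dist_limit z n)\<^sup>2)"
        unfolding w_def using nz[of n] pos[of n] by simp
      moreover have "1 \<le> (partial_dist z n K)\<^sup>2 / (dist_limit z n)\<^sup>2"
        using nz[of n] dist_limit_nonneg[of n] dist_limit_le[of n K] by (simp add: power_mono)
      ultimately show ?thesis
        using mult_left_mono[of 1 "(partial_dist z n K)\<^sup>2 / (dist_limit z n)\<^sup>2" "(cmod (a n))\<^sup>2 / 4"] by simp
    qed
    have "ennreal (\<Sum>n<K. (cmod (a n))\<^sup>2 / 4) \<le> ennreal (\<Sum>n<K. w n * (cmod (f (z n)))\<^sup>2)"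
      by (intro ennreal_leI sum_mono t) simp
    also have "\<dots> = (\<Sum>n<K. ?w n * ennreal ((cmod (f (z n)))\<^sup>2))"
      unfolding w_eq using w_nonneg by (simp add: ennreal_mult sum_ennreal[symmetric])
    also have "\<dots> \<le> (\<Sum>n. ?w n * ennreal ((cmod (f (z n)))\<^sup>2))"
      by (intro sum_le_suminf) auto
    also have "\<dots> \<le> ennreal C * H2_norm_sq f" by (rule C[OF f])
    also have "\<dots> \<le> ennreal \<bar>C\<bar> * ennreal (2 * pi * exp_norm_sq z K ?p)"
      by (intro mult_mono norm_f ennreal_leI) auto
    also have "\<dots> = ennreal (\<bar>C\<bar> * (2 * pi * exp_norm_sq z K ?p))"
      by (simp add: ennreal_mult L2_norm_sq_nonneg)
    finally have "(\<Sum>n<K. (cmod (a n))\<^sup>2 / 4) \<le> \<bar>C\<bar> * (2 * pi * exp_norm_sq z K ?p)"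
      by (subst (asm) ennreal_le_iff) (auto simp: L2_norm_sq_nonneg)
    then have "(\<Sum>n<K. (cmod (a n))\<^sup>2) \<le> 8 * pi * \<bar>C\<bar> * exp_norm_sq z K ?p"
      by (simp add: sum_divide_distrib[symmetric] mult_ac)
    also have "\<dots> \<le> R * exp_norm_sq z K ?p"
      unfolding R_def by (intro mult_right_mono L2_norm_sq_nonneg) simp
    finally show ?thesis .
  qed
  then show ?thesis unfolding riesz_lower_bound_def
    by (intro exI[of _ "1 / R"]) (use R in \<open>auto simp: pos_divide_le_eq mult.commute\<close>)
qed

text \<open>The lower bound, tested on the coefficients of the interpolating exponential sum, controls the
  norm of that sum by the data.\<close>

lemma finite_interpolation:
  assumes c: "0 < c" "\<And>K a. c * (\<Sum>n<K. (cmod (a n))\<^sup>2) \<le> exp_norm_sq z K (\<lambda>n. a n * cnj (b n))"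
    and b: "\<And>n. b n \<noteq> 0"
  obtains a where "\<And>n. n < K \<Longrightarrow> b n * moment 0 (z n) (exp_sum z K a) = y n"
    "c * exp_norm_sq z K a \<le> (\<Sum>n<K. (cmod (y n))\<^sup>2)"
proof -
  have injK: "inj_on z {..<K}" using inj by (rule inj_on_subset) simp
  define p where "p n = - cnj (y n / b n / blaschke_deriv z K n)" for n
  define a where "a = reflection z K p"
  define q where "q = exp_norm_sq z K a"
  have node: "kernel_sum z K a (z n) = y n / b n" if "n < K" for n
    unfolding a_def using blaschke_deriv_neq_0[OF injK pos that]
    by (subst kernel_sum_reflection_node[OF injK pos that]) (simp add: p_def)
  have 1: "b n * moment 0 (z n) (exp_sum z K a) = y n" if "n < K" for n
    using node[OF that] b[of n] by (subst moment_0_exp_sum) (auto simp: pos)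
  have "complex_of_real q = (\<Sum>n<K. cnj (a n) / b n * y n)"
    unfolding q_def exp_norm_sq_eq[OF pos] using node by (intro sum.cong) auto
  then have "cmod (complex_of_real q) \<le> (\<Sum>n<K. cmod (cnj (a n) / b n * y n))"
    by (metis norm_sum)
  then have "q \<le> (\<Sum>n<K. cmod (a n / cnj (b n)) * cmod (y n))"
    by (simp add: norm_mult norm_divide q_def L2_norm_sq_nonneg)
  then have "q\<^sup>2 \<le> (\<Sum>n<K. cmod (a n / cnj (b n)) * cmod (y n))\<^sup>2"
    by (intro power_mono) (auto simp: q_def L2_norm_sq_nonneg)
  also have "\<dots> \<le> (\<Sum>n<K. (cmod (a n / cnj (b n)))\<^sup>2) * (\<Sum>n<K. (cmod (y n))\<^sup>2)"
    by (rule Cauchy_Schwarz_ineq_sum)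
  finally have "c * q\<^sup>2 \<le> c * ((\<Sum>n<K. (cmod (a n / cnj (b n)))\<^sup>2) * (\<Sum>n<K. (cmod (y n))\<^sup>2))"
    using c(1) by (intro mult_left_mono) auto
  also have "\<dots> = (c * (\<Sum>n<K. (cmod (a n / cnj (b n)))\<^sup>2)) * (\<Sum>n<K. (cmod (y n))\<^sup>2)" by simp
  also have "\<dots> \<le> q * (\<Sum>n<K. (cmod (y n))\<^sup>2)"
    using c(2)[where K = K and a = "\<lambda>n. a n / cnj (b n)"] b unfolding q_def
    by (intro mult_right_mono sum_nonneg) auto
  finally have "q * (c * q) \<le> q * (\<Sum>n<K. (cmod (y n))\<^sup>2)" by (simp add: power2_eq_square mult_ac)
  moreover have "0 \<le> q" unfolding q_def by (rule L2_norm_sq_nonneg)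
  ultimately have "c * q \<le> (\<Sum>n<K. (cmod (y n))\<^sup>2)"
    using mult_left_le_imp_le[of q "c * q"] by (cases "q = 0") (auto intro: sum_nonneg)
  with 1 show thesis unfolding q_def by (rule that)
qed

text \<open>The solution of a finite section is the orthogonal projection of the solution of any larger one.
  Hence the squared norms increase, the squared distances are their differences, and boundedness of
  the norms makes the solutions a Cauchy sequence.\<close>

lemma interpolation_of_lower_bound:
  assumes lb: "riesz_lower_bound z b" and y: "summable (\<lambda>n. (cmod (y n))\<^sup>2)"
  obtains u where "u \<in> L2 halfline" "\<And>n. b n * moment 0 (z n) u = y n"
proof -
  obtain c where c: "0 < c" "\<And>K a. c * (\<Sum>n<K. (cmod (a n))\<^sup>2) \<le> exp_norm_sq z K (\<lambda>n. a n * cnj (b n))"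
    using lb unfolding riesz_lower_bound_def by blast
  note b = riesz_lower_bound_imp_neq_0[OF lb]
  have "\<exists>a. (\<forall>n<K. b n * moment 0 (z n) (exp_sum z K a) = y n) \<and> c * exp_norm_sq z K a \<le> (\<Sum>n<K. (cmod (y n))\<^sup>2)" for K
    using finite_interpolation[OF c b, of K y] by blast
  then obtain a where a: "\<And>K n. n < K \<Longrightarrow> b n * moment 0 (z n) (exp_sum z K (a K)) = y n"
    "\<And>K. c * exp_norm_sq z K (a K) \<le> (\<Sum>n<K. (cmod (y n))\<^sup>2)"
    by metis
  define v where "v K = exp_sum z K (a K)" for K
  define E where "E K = L2_norm_sq halfline (v K)" for K
  have v_L2: "v K \<in> L2 halfline" for K unfolding v_def by (rule exp_sum_L2[OF pos])
  have moment_v: "moment 0 (z n) (v K) = y n / b n" if "n < K" for n K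
    using a(1)[OF that] b[of n] unfolding v_def by (simp add: field_simps)
  have inner: "(\<integral>s. v K s * cnj (v J s) \<partial>halfline) = of_real (E J)" if "J \<le> K" for J K
  proof -
    have "(\<integral>s. v K s * cnj (v J s) \<partial>halfline) = (\<Sum>n<J. cnj (a J n) * moment 0 (z n) (v K))"
      unfolding v_def[of J] by (rule integral_mult_cnj_exp_sum[OF v_L2 pos])
    also have "\<dots> = (\<Sum>n<J. cnj (a J n) * moment 0 (z n) (v J))"
      using that by (intro sum.cong refl) (simp add: moment_v)
    also have "\<dots> = (\<integral>s. v J s * cnj (v J s) \<partial>halfline)"
      unfolding v_def[of J] by (rule integral_mult_cnj_exp_sum[OF v_L2[unfolded v_def] pos, symmetric])
    also have "\<dots> = of_real (E J)" unfolding E_def by (rule L2_norm_sq_eq[OF v_L2, symmetric])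
    finally show ?thesis .
  qed
  have diff: "L2_norm_sq halfline (\<lambda>s. v K s - v J s) = E K - E J" if JK: "J \<le> K" for J K
  proof -
    have int: "integrable halfline (\<lambda>s. v A s * cnj (v B s))" for A B
      by (intro L2_integrable_mult L2_cnj v_L2)
    have "complex_of_real (L2_norm_sq halfline (\<lambda>s. v K s - v J s)) =
        (\<integral>s. (v K s - v J s) * cnj (v K s - v J s) \<partial>halfline)"
      by (rule L2_norm_sq_eq[OF L2_diff[OF v_L2 v_L2]])
    also have "\<dots> = (\<integral>s. v K s * cnj (v K s) - v K s * cnj (v J s) - (cnj (v K s * cnj (v J s)) - v J s * cnj (v J s)) \<partial>halfline)"
      by (intro Bochner_Integration.integral_cong refl) (simp add: algebra_simps)
    also have "\<dots> = (\<integral>s. v K s * cnj (v K s) \<partial>halfline) - (\<integral>s. v K s * cnj (v J s) \<partial>halfline)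
        - ((\<integral>s. cnj (v K s * cnj (v J s)) \<partial>halfline) - (\<integral>s. v J s * cnj (v J s) \<partial>halfline))"
      by (simp only: Bochner_Integration.integral_diff Bochner_Integration.integrable_diff int integrable_cnj)
    also have "\<dots> = of_real (E K) - of_real (E J) - (cnj (of_real (E J)) - of_real (E J))"
      by (simp only: Bochner_Integration.integral_cnj inner[OF JK] inner[OF order_refl])
    finally have "complex_of_real (L2_norm_sq halfline (\<lambda>s. v K s - v J s)) = of_real (E K - E J)" by simp
    then show ?thesis unfolding of_real_eq_iff .
  qed
  have E_mono: "incseq E"
  proof (rule incseq_SucI)
    show "E J \<le> E (Suc J)" for J
      using diff[of J "Suc J"] L2_norm_sq_nonneg[of halfline "\<lambda>s. v (Suc J) s - v J s"] by simp
  qed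
  have E_bound: "E K \<le> (\<Sum>n. (cmod (y n))\<^sup>2) / c" for K
  proof -
    have "(\<Sum>n<K. (cmod (y n))\<^sup>2) \<le> (\<Sum>n. (cmod (y n))\<^sup>2)"
      by (intro sum_le_suminf y) auto
    then have "c * E K \<le> (\<Sum>n. (cmod (y n))\<^sup>2)" using a(2)[of K] unfolding E_def v_def by linarith
    then show ?thesis using c(1) by (simp add: pos_le_divide_eq mult.commute)
  qed
  have "convergent E" using incseq_convergent[OF E_mono] E_bound by (metis convergentI)
  then have E_Cauchy: "Cauchy E" by (rule convergent_Cauchy)
  have "\<exists>N. \<forall>m\<ge>N. \<forall>n\<ge>N. L2_norm_sq halfline (\<lambda>s. v m s - v n s) \<le> e" if e: "0 < e" for e
  proof -
    obtain N where N: "\<And>m n. m \<ge> N \<Longrightarrow> n \<ge> N \<Longrightarrow> \<bar>E m - E n\<bar> < e"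
      using CauchyD[OF E_Cauchy e] by auto
    have "L2_norm_sq halfline (\<lambda>s. v m s - v n s) \<le> e" if "m \<ge> N" "n \<ge> N" for m n
    proof (cases "n \<le> m")
      case True
      then show ?thesis using diff[OF True] N[OF that] by linarith
    next
      case False
      then have "L2_norm_sq halfline (\<lambda>s. v n s - v m s) \<le> e" using diff[of m n] N[OF that] by simp
      then show ?thesis by (simp add: L2_norm_sq_def norm_minus_commute)
    qed
    then show ?thesis by blast
  qed
  from L2_complete[OF v_L2 this] obtain u where u: "u \<in> L2 halfline"
    "(\<lambda>n. L2_norm_sq halfline (\<lambda>s. v n s - u s)) \<longlonglongrightarrow> 0" by blast
  have "b n * moment 0 (z n) u = y n" for n
  proof -
    let ?e = "\<lambda>s. exp (- (z n * complex_of_real s))"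
    have e: "?e \<in> L2 halfline" by (rule exp_L2_halfline[OF pos])
    have le: "(cmod (y n / b n - moment 0 (z n) u))\<^sup>2 \<le> L2_norm_sq halfline ?e * L2_norm_sq halfline (\<lambda>s. v K s - u s)"
      if "n < K" for K
    proof -
      have "y n / b n - moment 0 (z n) u = (\<integral>s. ?e s * v K s \<partial>halfline) - (\<integral>s. ?e s * u s \<partial>halfline)"
        unfolding moment_v[OF that, symmetric] moment_0 ..
      also have "\<dots> = (\<integral>s. ?e s * (v K s - u s) \<partial>halfline)"
        using L2_integrable_mult[OF e v_L2[of K]] L2_integrable_mult[OF e u(1)] by (simp add: right_diff_distrib)
      finally show ?thesis using L2_Cauchy_Schwarz[OF e L2_diff[OF v_L2[of K] u(1)]] by simp
    qed
    have "(\<lambda>K. L2_norm_sq halfline ?e * L2_norm_sq halfline (\<lambda>s. v K s - u s)) \<longlonglongrightarrow> L2_norm_sq halfline ?e * 0"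
      by (intro tendsto_intros u)
    moreover have "\<forall>\<^sub>F K in sequentially. (cmod (y n / b n - moment 0 (z n) u))\<^sup>2 \<le>
        L2_norm_sq halfline ?e * L2_norm_sq halfline (\<lambda>s. v K s - u s)"
      using eventually_gt_at_top[of n] by (rule eventually_mono) (rule le)
    ultimately have "(cmod (y n / b n - moment 0 (z n) u))\<^sup>2 \<le> L2_norm_sq halfline ?e * 0"
      by (intro tendsto_lowerbound) auto
    then have "y n / b n = moment 0 (z n) u" by simp
    then show ?thesis using b[of n] by (simp add: field_simps)
  qed
  with u(1) show thesis by (rule that)
qed
end

text \<open>Solvability bounds the functionals \<open>h \<mapsto> \<Sum>n<K. cnj (a n) * \<gamma> n h\<close> pointwise, uniformly over all \<open>a\<close>
  for which the exponential sum has norm at most \<open>1\<close>. Testing the resulting uniform bound on a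
  vector with coordinates \<open>a\<close> gives the inequality.\<close>

lemma lower_bound_of_interpolation:
  fixes \<gamma> :: "nat \<Rightarrow> 'h::banach \<Rightarrow> complex"
  assumes pos: "\<And>n. 0 < Re (z n)"
    and lin: "\<And>n. bounded_linear (\<gamma> n)"
    and solv: "\<And>h. \<exists>u\<in>L2 halfline. \<forall>n. b n * moment 0 (z n) u = \<gamma> n h"
    and synth: "\<And>K a. \<exists>h. (norm h)\<^sup>2 \<le> M * (\<Sum>n<K. (cmod (a n))\<^sup>2) \<and> (\<forall>n<K. \<gamma> n h = a n)"
  shows "riesz_lower_bound z b"
proof -
  define I where "I = {(K, a). exp_norm_sq z K (\<lambda>n. a n * cnj (b n)) \<le> 1}"
  define F where "F i h = (\<Sum>n<fst i. cnj (snd i n) * \<gamma> n h)" for i h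
  obtain C where C: "0 < C" "\<And>i h. i \<in> I \<Longrightarrow> norm (F i h) \<le> C * norm h"
  proof (rule uniform_boundedness[of I F])
    show "bounded_linear (F i)" for i
      unfolding F_def[abs_def]
      by (intro bounded_linear_sum bounded_linear_const_mult lin)
    show "\<exists>k. \<forall>i\<in>I. norm (F i h) \<le> k" for h
    proof -
      obtain u where u: "u \<in> L2 halfline" "\<And>n. b n * moment 0 (z n) u = \<gamma> n h" using solv by blast
      have "norm (F i h) \<le> sqrt (L2_norm_sq halfline u)" if "i \<in> I" for i
      proof -
        obtain K a where i: "i = (K, a)" by (cases i)
        let ?s = "exp_sum z K (\<lambda>n. a n * cnj (b n))"
        have "F i h = (\<integral>s. u s * cnj (?s s) \<partial>halfline)"
          unfolding integral_mult_cnj_exp_sum[OF u(1) pos] F_def i u(2)[symmetric]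
          by (simp add: mult_ac)
        then have "(norm (F i h))\<^sup>2 \<le> L2_norm_sq halfline u * L2_norm_sq halfline (\<lambda>s. cnj (?s s))"
          using L2_Cauchy_Schwarz[OF u(1) L2_cnj[OF exp_sum_L2[OF pos]]] by simp
        also have "L2_norm_sq halfline (\<lambda>s. cnj (?s s)) = L2_norm_sq halfline ?s" by (simp add: L2_norm_sq_def)
        also have "L2_norm_sq halfline u * \<dots> \<le> L2_norm_sq halfline u * 1"
          using that by (intro mult_left_mono L2_norm_sq_nonneg) (simp add: I_def i)
        finally show ?thesis by (simp add: real_le_rsqrt)
      qed
      then show ?thesis by blast
    qed
  qed blast
  \<comment> \<open>The summand \<open>1\<close> makes \<open>R\<close> positive and the bound in \<open>t_bound\<close> strict.\<close>
  define R where "R = C\<^sup>2 * \<bar>M\<bar> + 1"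
  have R: "0 < R" unfolding R_def by (simp add: add_nonneg_pos)
  have main: "(\<Sum>n<K. (cmod (a n))\<^sup>2) \<le> R * exp_norm_sq z K (\<lambda>n. a n * cnj (b n))" for K a
  proof -
    define S where "S = (\<Sum>n<K. (cmod (a n))\<^sup>2)"
    define Q where "Q = exp_norm_sq z K (\<lambda>n. a n * cnj (b n))"
    have S: "0 \<le> S" unfolding S_def by (intro sum_nonneg) simp
    have Q: "0 \<le> Q" unfolding Q_def by (rule L2_norm_sq_nonneg)
    obtain h where h: "(norm h)\<^sup>2 \<le> M * S" "\<And>n. n < K \<Longrightarrow> \<gamma> n h = a n"
      using synth[where K = K and a = a] unfolding S_def by blast
    \<comment> \<open>Scaling by a free \<open>t\<close> instead of normalising covers the case \<open>Q = 0\<close>.\<close>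
    have scaled: "t\<^sup>2 * S\<^sup>2 \<le> C\<^sup>2 * \<bar>M\<bar> * S" if t: "t\<^sup>2 * Q \<le> 1" "0 \<le> t" for t :: real
    proof -
      let ?i = "(K, \<lambda>n. of_real t * a n)"
      have "exp_sum z K (\<lambda>n. of_real t * a n * cnj (b n)) s = of_real t * exp_sum z K (\<lambda>n. a n * cnj (b n)) s" for s
        unfolding exp_sum_def by (simp add: sum_distrib_left mult_ac)
      then have "exp_norm_sq z K (\<lambda>n. of_real t * a n * cnj (b n)) = t\<^sup>2 * Q"
        unfolding Q_def L2_norm_sq_def by (simp add: norm_mult power_mult_distrib)
      then have "?i \<in> I" using t unfolding I_def by simp
      then have "norm (F ?i h) \<le> C * norm h" by (rule C(2))
      moreover have "F ?i h = of_real (t * S)"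
      proof -
        have "F ?i h = (\<Sum>n<K. of_real t * (cnj (a n) * a n))"
          unfolding F_def using h(2) by (auto intro!: sum.cong)
        also have "\<dots> = of_real (t * S)"
          unfolding S_def of_real_mult of_real_sum complex_norm_square sum_distrib_left
          by (intro sum.cong refl) (simp add: mult.commute)
        finally show ?thesis .
      qed
      moreover have "norm (complex_of_real (t * S)) = t * S" unfolding norm_of_real using t S by simp
      ultimately have "t * S \<le> C * norm h" by simp
      then have "(t * S)\<^sup>2 \<le> (C * norm h)\<^sup>2" using t S by (intro power_mono) auto
      also have "\<dots> = C\<^sup>2 * (norm h)\<^sup>2" by (simp add: power_mult_distrib)
      also have "\<dots> \<le> C\<^sup>2 * (\<bar>M\<bar> * S)"
        using order_trans[OF h(1) mult_right_mono[OF abs_ge_self S]] by (intro mult_left_mono) auto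
      finally show ?thesis by (simp add: power_mult_distrib mult_ac)
    qed
    have "S \<le> R * Q"
    proof (cases "S = 0")
      case True
      then show ?thesis using R Q by simp
    next
      case False
      then have Spos: "0 < S" using S by simp
      have t_bound: "t\<^sup>2 * S < R" if t: "t\<^sup>2 * Q \<le> 1" "0 \<le> t" for t :: real
      proof -
        have "S * (t\<^sup>2 * S) \<le> S * (C\<^sup>2 * \<bar>M\<bar>)" using scaled[OF t] by (simp add: power2_eq_square mult_ac)
        then have "t\<^sup>2 * S \<le> C\<^sup>2 * \<bar>M\<bar>" using Spos by (rule mult_left_le_imp_le)
        then show ?thesis unfolding R_def by simp
      qed
      show ?thesis
      proof (cases "Q = 0")
        case True
        have "(sqrt (R / S))\<^sup>2 * S < R" using True R Spos by (intro t_bound) auto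
        then show ?thesis using R Spos by simp
      next
        case False
        then have "0 < Q" using Q by simp
        then have "(sqrt (1 / Q))\<^sup>2 * S < R" by (intro t_bound) auto
        then show ?thesis using \<open>0 < Q\<close> by (simp add: field_simps)
      qed
    qed
    then show ?thesis unfolding S_def Q_def .
  qed
  then show ?thesis unfolding riesz_lower_bound_def
    by (intro exI[of _ "1 / R"]) (use R in \<open>auto simp: pos_divide_le_eq mult.commute\<close>)
qed

section \<open>Higher moments\<close>

text \<open>One term of the exponential series.\<close>

lemma power_le_fact_exp:
  fixes x :: real
  assumes "0 \<le> x"
  shows "x ^ m \<le> fact m * exp x"
proof -
  have "x ^ m /\<^sub>R fact m = (\<Sum>n\<in>{m}. x ^ n /\<^sub>R fact n)" by simp
  also have "\<dots> \<le> (\<Sum>n. x ^ n /\<^sub>R fact n)"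
    using assms by (intro sum_le_suminf sums_summable[OF exp_converges]) auto
  also have "\<dots> = exp x" by (rule sums_unique[OF exp_converges, symmetric])
  finally show ?thesis by (simp add: field_simps)
qed

lemma power_exp_L2_halfline:
  fixes w :: complex
  assumes w: "0 < Re w"
  shows "(\<lambda>s. of_real (s ^ i) * exp (- (w * of_real s))) \<in> L2 halfline"
proof (rule L2_bound)
  have "(\<lambda>s. of_real (s ^ i) * exp (- (w * of_real s))) \<in> borel_measurable borel"
    by (intro borel_measurable_continuous_onI continuous_intros)
  then show "(\<lambda>s. of_real (s ^ i) * exp (- (w * of_real s))) \<in> borel_measurable halfline"
    by (intro measurable_restrict_space1) simp
  let ?C = "fact (2 * i) / Re w ^ (2 * i)"
  show "integrable halfline (\<lambda>s. ?C * exp (- (Re w * s)))"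
    using w by (intro integrable_mult_right halfline_exp_real)
  fix s :: real assume "s \<in> space halfline"
  then have s: "0 < s" by (simp add: space_restrict_space)
  have "(Re w * s) ^ (2 * i) \<le> fact (2 * i) * exp (Re w * s)"
    using w s by (intro power_le_fact_exp) simp
  then have "s ^ (2 * i) \<le> ?C * exp (Re w * s)"
    using w by (simp add: power_mult_distrib field_simps)
  then have "s ^ (2 * i) * exp (- (2 * Re w * s)) \<le> ?C * exp (Re w * s) * exp (- (2 * Re w * s))"
    by (intro mult_right_mono) auto
  also have "\<dots> = ?C * exp (- (Re w * s))" by (simp add: exp_add[symmetric] mult.assoc)
  finally show "(cmod (of_real (s ^ i) * exp (- (w * of_real s))))\<^sup>2 \<le> ?C * exp (- (Re w * s))"
    using s by (simp add: norm_mult norm_power norm_exp_eq_Re power_mult_distrib exp_double[symmetric]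
        power_mult[symmetric] mult.commute[of i 2] mult.assoc)
qed

lemma moment_integrable:
  assumes "u \<in> L2 halfline" "0 < Re w"
  shows "integrable halfline (\<lambda>s. of_real (s ^ i) * exp (- (w * of_real s)) * u s)"
  by (intro L2_integrable_mult power_exp_L2_halfline assms)

lemma moment_add_scaled:
  assumes u: "u \<in> L2 halfline" and v: "v \<in> L2 halfline" and w: "0 < Re w"
  shows "moment i w (\<lambda>s. u s + c * v s) = moment i w u + c * moment i w v"
proof -
  have "moment i w (\<lambda>s. u s + c * v s) = (\<integral>s. of_real (s ^ i) * exp (- (w * of_real s)) * u s
      + c * (of_real (s ^ i) * exp (- (w * of_real s)) * v s) \<partial>halfline)"
    unfolding moment_def by (intro Bochner_Integration.integral_cong refl) (simp add: algebra_simps)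
  also have "\<dots> = moment i w u + (\<integral>s. c * (of_real (s ^ i) * exp (- (w * of_real s)) * v s) \<partial>halfline)"
    unfolding moment_def
    by (intro Bochner_Integration.integral_add integrable_mult_right moment_integrable u v w)
  finally show ?thesis unfolding integral_mult_right_zero moment_def .
qed

definition delay :: "real \<Rightarrow> (real \<Rightarrow> complex) \<Rightarrow> real \<Rightarrow> complex"
  where "delay \<tau> u s = (if \<tau> < s then u (s - \<tau>) else 0)"

lemma halfline_shift:
  fixes h :: "real \<Rightarrow> 'b::{banach, second_countable_topology}"
  assumes "0 < \<tau>"
  shows "integrable halfline (\<lambda>s. if \<tau> < s then h (s - \<tau>) else 0) \<longleftrightarrow> integrable halfline h"
    and "(\<integral>s. (if \<tau> < s then h (s - \<tau>) else 0) \<partial>halfline) = (\<integral>s. h s \<partial>halfline)"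
proof -
  let ?f = "\<lambda>s. indicator {0<..} s *\<^sub>R h s"
  have eq: "indicator {0<..} s *\<^sub>R (if \<tau> < s then h (s - \<tau>) else 0) = ?f (- \<tau> + 1 * s)" for s
    using assms by (auto simp: indicator_def)
  show "integrable halfline (\<lambda>s. if \<tau> < s then h (s - \<tau>) else 0) \<longleftrightarrow> integrable halfline h"
    unfolding integrable_halfline_iff set_integrable_def eq
    by (rule lborel_integrable_real_affine_iff) simp
  show "(\<integral>s. (if \<tau> < s then h (s - \<tau>) else 0) \<partial>halfline) = (\<integral>s. h s \<partial>halfline)"
    unfolding integral_halfline_eq set_lebesgue_integral_def eq
    using lborel_integral_real_affine[of 1 ?f "- \<tau>"] by simp
qed

lemma delay_L2:
  assumes u: "u \<in> L2 halfline" and \<tau>: "0 < \<tau>"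
  shows "delay \<tau> u \<in> L2 halfline"
proof -
  let ?U = "\<lambda>s. indicator {0<..} s *\<^sub>R u s"
  have U: "?U \<in> borel_measurable borel"
    using L2_measurable[OF u] by (simp add: borel_measurable_restrict_space_iff)
  have "(\<lambda>s. ?U (s - \<tau>)) \<in> borel_measurable borel"
    by (rule measurable_compose[OF _ U]) simp
  moreover have "delay \<tau> u = (\<lambda>s. ?U (s - \<tau>))" unfolding delay_def by (auto simp: indicator_def)
  ultimately have "delay \<tau> u \<in> borel_measurable halfline"
    by (intro measurable_restrict_space1) simp
  moreover have "integrable halfline (\<lambda>s. (cmod (delay \<tau> u s))\<^sup>2)"
    using halfline_shift(1)[OF \<tau>, of "\<lambda>s. (cmod (u s))\<^sup>2"] L2_integrable[OF u]
    by (simp add: delay_def if_distrib[of "\<lambda>x. (cmod x)\<^sup>2"] cong: if_cong)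
  ultimately show ?thesis unfolding L2_def by simp
qed

lemma moment_delay:
  assumes u: "u \<in> L2 halfline" and w: "0 < Re w" and \<tau>: "0 < \<tau>"
  shows "moment i w (delay \<tau> u) =
    exp (- (w * of_real \<tau>)) * (\<Sum>l\<le>i. of_nat (i choose l) * of_real (\<tau> ^ (i - l)) * moment l w u)"
proof -
  have expand: "of_real ((s + \<tau>) ^ i) * exp (- (w * of_real (s + \<tau>))) * u s = exp (- (w * of_real \<tau>)) *
      (\<Sum>l\<le>i. of_nat (i choose l) * of_real (\<tau> ^ (i - l)) * (of_real (s ^ l) * exp (- (w * of_real s)) * u s))" for s
  proof -
    have "complex_of_real ((s + \<tau>) ^ i) = (\<Sum>l\<le>i. of_nat (i choose l) * of_real (s ^ l) * of_real (\<tau> ^ (i - l)))"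
      unfolding binomial_ring by simp
    moreover have "exp (- (w * of_real (s + \<tau>))) = exp (- (w * of_real \<tau>)) * exp (- (w * of_real s))"
      by (simp add: exp_add[symmetric] algebra_simps)
    ultimately show ?thesis by (simp add: sum_distrib_left sum_distrib_right mult_ac)
  qed
  have "moment i w (delay \<tau> u) =
      (\<integral>s. (if \<tau> < s then of_real ((s - \<tau> + \<tau>) ^ i) * exp (- (w * of_real (s - \<tau> + \<tau>))) * u (s - \<tau>) else 0) \<partial>halfline)"
    unfolding moment_def delay_def by (intro Bochner_Integration.integral_cong refl) simp
  also have "\<dots> = (\<integral>s. of_real ((s + \<tau>) ^ i) * exp (- (w * of_real (s + \<tau>))) * u s \<partial>halfline)"
    by (rule halfline_shift(2)[OF \<tau>, of "\<lambda>s. of_real ((s + \<tau>) ^ i) * exp (- (w * of_real (s + \<tau>))) * u s"])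
  also have "\<dots> = exp (- (w * of_real \<tau>)) * (\<integral>s. (\<Sum>l\<le>i. of_nat (i choose l) * of_real (\<tau> ^ (i - l)) *
      (of_real (s ^ l) * exp (- (w * of_real s)) * u s)) \<partial>halfline)"
    unfolding expand by (rule integral_mult_right_zero)
  also have "(\<integral>s. (\<Sum>l\<le>i. of_nat (i choose l) * of_real (\<tau> ^ (i - l)) *
      (of_real (s ^ l) * exp (- (w * of_real s)) * u s)) \<partial>halfline) =
      (\<Sum>l\<le>i. \<integral>s. of_nat (i choose l) * of_real (\<tau> ^ (i - l)) *
      (of_real (s ^ l) * exp (- (w * of_real s)) * u s) \<partial>halfline)"
    by (intro Bochner_Integration.integral_sum integrable_mult_right moment_integrable u w)
  finally show ?thesis unfolding integral_mult_right_zero moment_def .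
qed

text \<open>The Laplace transform of \<open>u\<close> has a zero of order at least \<open>p\<close> at \<open>w\<close>.\<close>

definition vanishes :: "complex \<Rightarrow> nat \<Rightarrow> (real \<Rightarrow> complex) \<Rightarrow> bool"
  where "vanishes w p u \<longleftrightarrow> (\<forall>l<p. moment l w u = 0)"

text \<open>The Laplace transform of \<open>v\<close> is that of \<open>u\<close> multiplied by \<open>1 - exp ((\<mu> - w) * \<tau>)\<close>; the three claims
  are the product rule at \<open>w\<close>.\<close>

lemma moment_delay_difference:
  fixes u :: "real \<Rightarrow> complex" and \<tau> :: real and \<mu> :: complex
  assumes u: "u \<in> L2 halfline" and w: "0 < Re w" and \<tau>: "0 < \<tau>" and van: "vanishes w q u"
  defines "v \<equiv> \<lambda>s. u s + - exp (\<mu> * of_real \<tau>) * delay \<tau> u s"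
  shows "vanishes w q v"
    and "moment q w v = (1 - exp ((\<mu> - w) * of_real \<tau>)) * moment q w u"
    and "\<mu> = w \<Longrightarrow> moment (Suc q) w v = - (of_nat (Suc q) * of_real \<tau> * moment q w u)"
proof -
  have exps: "exp (\<mu> * of_real \<tau>) * exp (- (w * of_real \<tau>)) = exp ((\<mu> - w) * of_real \<tau>)"
    by (simp add: exp_add[symmetric] algebra_simps)
  have mom: "moment i w v = moment i w u - exp ((\<mu> - w) * of_real \<tau>) *
      (\<Sum>l\<le>i. of_nat (i choose l) * of_real (\<tau> ^ (i - l)) * moment l w u)" for i
    unfolding v_def moment_add_scaled[OF u delay_L2[OF u \<tau>] w] moment_delay[OF u w \<tau>] exps[symmetric]
    by simp
  have zero: "moment l w u = 0" if "l < q" for l using van that unfolding vanishes_def by blast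
  show "vanishes w q v" unfolding vanishes_def mom by (auto simp: zero intro!: sum.neutral)
  have "(\<Sum>l\<le>q. of_nat (q choose l) * of_real (\<tau> ^ (q - l)) * moment l w u) =
      (\<Sum>l\<in>{q}. of_nat (q choose l) * of_real (\<tau> ^ (q - l)) * moment l w u)"
    by (intro sum.mono_neutral_right) (auto simp: zero)
  then show "moment q w v = (1 - exp ((\<mu> - w) * of_real \<tau>)) * moment q w u"
    unfolding mom by (simp add: algebra_simps)
  have "(\<Sum>l\<le>Suc q. of_nat (Suc q choose l) * of_real (\<tau> ^ (Suc q - l)) * moment l w u) =
      (\<Sum>l\<in>{q, Suc q}. of_nat (Suc q choose l) * of_real (\<tau> ^ (Suc q - l)) * moment l w u)"
    by (intro sum.mono_neutral_right) (auto simp: zero)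
  then show "\<mu> = w \<Longrightarrow> moment (Suc q) w v = - (of_nat (Suc q) * of_real \<tau> * moment q w u)"
    unfolding mom by simp
qed

text \<open>The delay is chosen such that the multiplier has no zero at \<open>w\<close> other than the prescribed one
  at \<open>\<mu>\<close>.\<close>

lemma raise_order:
  assumes u: "u \<in> L2 halfline" and \<mu>: "0 < Re \<mu>" and w: "0 < Re w"
    and van: "vanishes w q u" and nz: "moment q w u \<noteq> 0"
  obtains v where "v \<in> L2 halfline" "\<And>w p. 0 < Re w \<Longrightarrow> vanishes w p u \<Longrightarrow> vanishes w p v"
    "\<And>p. vanishes \<mu> p u \<Longrightarrow> vanishes \<mu> (Suc p) v"
    "vanishes w (if \<mu> = w then Suc q else q) v" "moment (if \<mu> = w then Suc q else q) w v \<noteq> 0"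
proof -
  obtain \<tau> where \<tau>: "0 < \<tau>" "\<mu> \<noteq> w \<Longrightarrow> exp ((\<mu> - w) * of_real \<tau>) \<noteq> 1"
  proof (cases "\<mu> = w")
    case False
    \<comment> \<open>A number of modulus \<open>1\<close> is not a multiple of \<open>2 * pi * \<i>\<close>, except \<open>0\<close>.\<close>
    let ?v = "(\<mu> - w) * of_real (1 / cmod (\<mu> - w))"
    have "cmod ?v = 1" unfolding norm_mult norm_of_real using False by simp
    moreover have "exp ?v \<noteq> 1"
    proof
      assume "exp ?v = 1"
      then obtain k :: int where k: "Re ?v = 0" "Im ?v = of_int (2 * k) * pi" unfolding exp_eq_1 by blast
      then have "?v = \<i> * of_real (of_int (2 * k) * pi)" by (simp only: complex_eq_iff) simp
      then have "cmod ?v = \<bar>of_int (2 * k) * pi\<bar>" by (simp only: norm_mult norm_of_real norm_ii)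
      then have 1: "\<bar>real_of_int (2 * k)\<bar> * pi = 1" using \<open>cmod ?v = 1\<close> by (simp add: abs_mult)
      then have "k \<noteq> 0" by auto
      then have "1 \<le> \<bar>real_of_int (2 * k)\<bar>" by linarith
      then have "1 * pi \<le> \<bar>real_of_int (2 * k)\<bar> * pi" by (intro mult_right_mono) auto
      then show False using 1 pi_gt3 by linarith
    qed
    ultimately show thesis using False by (intro that[of "1 / cmod (\<mu> - w)"]) auto
  qed (rule that[of 1], auto)
  define v where "v = (\<lambda>s. u s + - exp (\<mu> * of_real \<tau>) * delay \<tau> u s)"
  note diff = moment_delay_difference[OF u _ \<tau>(1), where \<mu> = \<mu>, folded v_def]
  show thesis
  proof (rule that[of v])
    show "v \<in> L2 halfline" unfolding v_def by (intro L2_add L2_mult_const delay_L2 u \<tau>)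
    show "vanishes w p v" if "0 < Re w" "vanishes w p u" for w p using diff(1)[OF that] .
    show raise: "vanishes \<mu> (Suc p) v" if "vanishes \<mu> p u" for p
      using diff(1,2)[OF \<mu> that] unfolding vanishes_def less_Suc_eq by auto
    show "vanishes w (if \<mu> = w then Suc q else q) v" using raise van diff(1)[OF w van] by auto
    show "moment (if \<mu> = w then Suc q else q) w v \<noteq> 0"
      using diff(2,3)[OF w van] nz \<tau> by (auto simp del: of_nat_Suc)
  qed
qed

lemma raise_order_power:
  assumes u: "u \<in> L2 halfline" and \<mu>: "0 < Re \<mu>" and w: "0 < Re w"
    and van: "vanishes w q u" and nz: "moment q w u \<noteq> 0"
  shows "\<exists>v\<in>L2 halfline. (\<forall>w p. 0 < Re w \<longrightarrow> vanishes w p u \<longrightarrow> vanishes w p v) \<and> vanishes \<mu> m v \<and>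
    vanishes w (if \<mu> = w then q + m else q) v \<and> moment (if \<mu> = w then q + m else q) w v \<noteq> 0"
proof (induction m)
  case 0
  then show ?case using u van nz by (intro bexI[of _ u]) (auto simp: vanishes_def)
next
  case (Suc m)
  then obtain v where v: "v \<in> L2 halfline" "\<forall>w p. 0 < Re w \<longrightarrow> vanishes w p u \<longrightarrow> vanishes w p v"
    "vanishes \<mu> m v" "vanishes w (if \<mu> = w then q + m else q) v"
    "moment (if \<mu> = w then q + m else q) w v \<noteq> 0" by blast
  from raise_order[OF v(1) \<mu> w v(4,5)] obtain v' where v': "v' \<in> L2 halfline"
    "\<And>w p. 0 < Re w \<Longrightarrow> vanishes w p v \<Longrightarrow> vanishes w p v'"
    "\<And>p. vanishes \<mu> p v \<Longrightarrow> vanishes \<mu> (Suc p) v'"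
    "vanishes w (if \<mu> = w then Suc (if \<mu> = w then q + m else q) else if \<mu> = w then q + m else q) v'"
    "moment (if \<mu> = w then Suc (if \<mu> = w then q + m else q) else if \<mu> = w then q + m else q) w v' \<noteq> 0"
    by blast
  show ?case
    by (rule bexI[OF _ v'(1)]) (use v v' in \<open>auto split: if_splits\<close>)
qed

lemma raise_orders:
  assumes "finite G" and pos: "\<And>k. 0 < Re (z k)" and w: "0 < Re w" and G: "\<And>k. k \<in> G \<Longrightarrow> z k \<noteq> w"
    and u: "u \<in> L2 halfline" and van: "vanishes w q u" and nz: "moment q w u \<noteq> 0"
  shows "\<exists>v\<in>L2 halfline. (\<forall>w p. 0 < Re w \<longrightarrow> vanishes w p u \<longrightarrow> vanishes w p v) \<and>
    (\<forall>k\<in>G. vanishes (z k) (m k) v) \<and> vanishes w q v \<and> moment q w v \<noteq> 0"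
  using \<open>finite G\<close> G
proof (induction G)
  case empty
  then show ?case using u van nz by blast
next
  case (insert k G)
  then obtain v where v: "v \<in> L2 halfline" "\<forall>w p. 0 < Re w \<longrightarrow> vanishes w p u \<longrightarrow> vanishes w p v"
    "\<forall>k\<in>G. vanishes (z k) (m k) v" "vanishes w q v" "moment q w v \<noteq> 0" by blast
  have "z k \<noteq> w" using insert.prems by blast
  from raise_order_power[OF v(1) pos[of k] w v(4,5), of "m k"] this
  obtain v' where v': "v' \<in> L2 halfline"
    "\<forall>w p. 0 < Re w \<longrightarrow> vanishes w p v \<longrightarrow> vanishes w p v'" "vanishes (z k) (m k) v'"
    "vanishes w q v'" "moment q w v' \<noteq> 0" by auto
  show ?case by (rule bexI[OF _ v'(1)]) (use v v' pos in auto)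
qed

text \<open>The coordinate at \<open>(n, l)\<close> of the state reached by the input \<open>u\<close>; see
  \<open>coordinate_controllability_op\<close>.\<close>

definition block_output ::
    "(nat \<Rightarrow> nat) \<Rightarrow> (nat \<times> nat \<Rightarrow> complex) \<Rightarrow> (nat \<Rightarrow> complex) \<Rightarrow> (real \<Rightarrow> complex) \<Rightarrow> nat \<times> nat \<Rightarrow> complex"
  where "block_output N b z u = (\<lambda>(n, l). \<Sum>j\<in>{l..N n}. b (n, j) / fact (j - l) * moment (j - l) (z n) u)"

lemma block_output_add_scaled:
  assumes "u \<in> L2 halfline" "v \<in> L2 halfline" "\<And>n. 0 < Re (z n)"
  shows "block_output N b z (\<lambda>s. u s + c * v s) nl = block_output N b z u nl + c * block_output N b z v nl"
  unfolding block_output_def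
  by (cases nl) (simp add: moment_add_scaled[OF assms] sum_distrib_left sum.distrib distrib_left mult_ac)

lemma block_output_top: "block_output N b z u (n, N n) = b (n, N n) * moment 0 (z n) u"
  unfolding block_output_def by simp

lemma block_output_eq_0:
  assumes "vanishes (z n) i u" "N n < l + i"
  shows "block_output N b z u (n, l) = 0"
  unfolding block_output_def prod.case
proof (intro sum.neutral ballI)
  fix j assume "j \<in> {l..N n}"
  then have "moment (j - l) (z n) u = 0" using assms unfolding vanishes_def by auto
  then show "b (n, j) / fact (j - l) * moment (j - l) (z n) u = 0" by simp
qed

text \<open>When the moments of order less than \<open>i\<close> vanish, the moment of order \<open>i\<close> is first seen by the
  coordinate \<open>N n - i\<close>, with coefficient \<open>b (n, N n)\<close>; this is why only the last coefficient of a block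
  matters.\<close>

lemma block_output_lowest:
  assumes "vanishes (z n) i u" "i \<le> N n"
  shows "block_output N b z u (n, N n - i) = b (n, N n) / fact i * moment i (z n) u"
proof -
  let ?t = "\<lambda>j. b (n, j) / fact (j - (N n - i)) * moment (j - (N n - i)) (z n) u"
  have "(\<Sum>j\<in>{N n - i..N n}. ?t j) = (\<Sum>j\<in>{N n}. ?t j)"
  proof (intro sum.mono_neutral_right ballI)
    fix j assume "j \<in> {N n - i..N n} - {N n}"
    then have "j - (N n - i) < i" using assms(2) by auto
    then have "moment (j - (N n - i)) (z n) u = 0" using assms(1) unfolding vanishes_def by blast
    then show "?t j = 0" by simp
  qed auto
  then show ?thesis using assms(2) unfolding block_output_def by simp
qed

text \<open>A solution for the ends of the blocks is corrected coordinate by coordinate, downwards in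
  each of the finitely many nontrivial blocks. The corrector for the coordinate \<open>N n - i\<close> is obtained
  from the input that is dual to the \<open>n\<close>-th simple moment by raising its order of vanishing to \<open>N k\<close> at
  the other multiple nodes and to exactly \<open>i\<close> at \<open>z n\<close>.\<close>

lemma block_interpolation:
  fixes y :: "nat \<times> nat \<Rightarrow> complex"
  assumes inj: "inj z" and pos: "\<And>n. 0 < Re (z n)"
    and N1: "\<And>n. 1 \<le> N n" and fin: "finite {n. N n \<noteq> 1}" and b: "\<And>n. b (n, N n) \<noteq> 0"
    and simple: "\<And>y :: nat \<Rightarrow> complex. summable (\<lambda>n. (cmod (y n))\<^sup>2) \<Longrightarrow>
      \<exists>u\<in>L2 halfline. \<forall>n. b (n, N n) * moment 0 (z n) u = y n"
    and y: "summable (\<lambda>n. (cmod (y (n, N n)))\<^sup>2)"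
  obtains u where "u \<in> L2 halfline" "\<And>nl. nl \<in> jordan_index N \<Longrightarrow> block_output N b z u nl = y nl"
proof -
  let ?out = "block_output N b z"
  have corrector: "\<exists>v\<in>L2 halfline. (\<forall>k l. k \<noteq> n \<longrightarrow> 1 \<le> l \<longrightarrow> ?out v (k, l) = 0) \<and>
      (\<forall>l. N n - i < l \<longrightarrow> ?out v (n, l) = 0) \<and> ?out v (n, N n - i) \<noteq> 0" if i: "i \<le> N n" for n i
  proof -
    have "summable (\<lambda>k. (cmod (if k = n then 1 else 0))\<^sup>2)"
      by (rule summable_finite[of "{n}"]) auto
    from simple[OF this] obtain r where r: "r \<in> L2 halfline"
      "\<And>k. b (k, N k) * moment 0 (z k) r = (if k = n then 1 else 0)" by blast
    have r_van: "vanishes (z k) 1 r" if "k \<noteq> n" for k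
      using r(2)[of k] that b[of k] by (simp add: vanishes_def)
    have r_nz: "vanishes (z n) 0 r" "moment 0 (z n) r \<noteq> 0" using r(2)[of n] by (auto simp: vanishes_def)
    have "finite ({k. N k \<noteq> 1} - {n})" "\<And>k. k \<in> {k. N k \<noteq> 1} - {n} \<Longrightarrow> z k \<noteq> z n"
      using fin inj by (auto simp: inj_eq)
    from raise_orders[where z = z and m = N, OF this(1) pos pos this(2) r(1) r_nz]
    obtain v where v: "v \<in> L2 halfline" "\<And>w p. 0 < Re w \<Longrightarrow> vanishes w p r \<Longrightarrow> vanishes w p v"
      "\<And>k. N k \<noteq> 1 \<Longrightarrow> k \<noteq> n \<Longrightarrow> vanishes (z k) (N k) v" "vanishes (z n) 0 v" "moment 0 (z n) v \<noteq> 0"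
      by blast
    from raise_order_power[OF v(1) pos[of n] pos v(4,5), of i]
    obtain v' where v': "v' \<in> L2 halfline" "\<And>w p. 0 < Re w \<Longrightarrow> vanishes w p v \<Longrightarrow> vanishes w p v'"
      "vanishes (z n) i v'" "moment i (z n) v' \<noteq> 0" by auto
    have van: "vanishes (z k) (N k) v'" if "k \<noteq> n" for k
      using v(2)[OF pos r_van[OF that]] v(3)[of k] v'(2)[OF pos] that by (cases "N k = 1") auto
    show ?thesis
    proof (intro bexI[OF _ v'(1)] conjI allI impI)
      show "?out v' (k, l) = 0" if "k \<noteq> n" "1 \<le> l" for k l
        using van[OF that(1)] that(2) by (intro block_output_eq_0) auto
      show "?out v' (n, l) = 0" if "N n - i < l" for l
        using v'(3) that by (intro block_output_eq_0) auto
      show "?out v' (n, N n - i) \<noteq> 0"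
        using v'(4) b[of n] block_output_lowest[where z = z and n = n and i = i and N = N and b = b, OF v'(3) i] by simp
    qed
  qed
  have blocks: "\<exists>u\<in>L2 halfline. (\<forall>n. ?out u (n, N n) = y (n, N n)) \<and> (\<forall>n\<in>G. \<forall>l\<in>{1..N n}. ?out u (n, l) = y (n, l))"
    if "finite G" for G
    using that
  proof (induction G)
    case empty
    then show ?case using simple[OF y] by (simp add: block_output_top)
  next
    case (insert n G)
    have "\<exists>u\<in>L2 halfline. (\<forall>n. ?out u (n, N n) = y (n, N n)) \<and> (\<forall>n\<in>G. \<forall>l\<in>{1..N n}. ?out u (n, l) = y (n, l)) \<and>
        (\<forall>l. 1 \<le> l \<longrightarrow> l \<le> N n \<longrightarrow> N n - i \<le> l \<longrightarrow> ?out u (n, l) = y (n, l))" for i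
    proof (induction i)
      case 0
      from insert.IH obtain u where "u \<in> L2 halfline" "\<forall>n. ?out u (n, N n) = y (n, N n)"
        "\<forall>n\<in>G. \<forall>l\<in>{1..N n}. ?out u (n, l) = y (n, l)" by blast
      then show ?case by (intro bexI[of _ u]) auto
    next
      case (Suc i)
      then obtain u where u: "u \<in> L2 halfline" "\<And>n. ?out u (n, N n) = y (n, N n)"
        "\<And>n l. n \<in> G \<Longrightarrow> l \<in> {1..N n} \<Longrightarrow> ?out u (n, l) = y (n, l)"
        "\<And>l. 1 \<le> l \<Longrightarrow> l \<le> N n \<Longrightarrow> N n - i \<le> l \<Longrightarrow> ?out u (n, l) = y (n, l)" by blast
      show ?case
      proof (cases "Suc i \<le> N n")
        case False
        then have "N n - i = 0" by simp
        then show ?thesis using u by (intro bexI[of _ u]) auto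
      next
        case True
        let ?l = "N n - Suc i"
        obtain v where v: "v \<in> L2 halfline" "\<And>k l. k \<noteq> n \<Longrightarrow> 1 \<le> l \<Longrightarrow> ?out v (k, l) = 0"
          "\<And>l. ?l < l \<Longrightarrow> ?out v (n, l) = 0" "?out v (n, ?l) \<noteq> 0" using corrector[OF True] by blast
        define c where "c = (y (n, ?l) - ?out u (n, ?l)) / ?out v (n, ?l)"
        let ?u' = "\<lambda>s. u s + c * v s"
        note lin = block_output_add_scaled[OF u(1) v(1) pos, where N = N and b = b and c = c]
        show ?thesis
        proof (intro bexI[of _ ?u'] conjI allI ballI impI)
          show "?u' \<in> L2 halfline" by (intro L2_add L2_mult_const u v)
          show "?out ?u' (k, N k) = y (k, N k)" for k
            unfolding lin using u(2)[of k] v(2)[of k "N k"] v(3)[of "N n"] N1[of k] True by (cases "k = n") auto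
          show "?out ?u' (k, l) = y (k, l)" if "k \<in> G" "l \<in> {1..N k}" for k l
            unfolding lin using u(3)[OF that] v(2)[of k l] that insert.hyps(2) by (cases "k = n") auto
          show "?out ?u' (n, l) = y (n, l)" if "1 \<le> l" "l \<le> N n" "?l \<le> l" for l
          proof (cases "l = ?l")
            case True
            have "?out ?u' (n, ?l) = ?out u (n, ?l) + c * ?out v (n, ?l)" by (rule lin)
            also have "\<dots> = y (n, ?l)" unfolding c_def using v(4) by simp
            finally show ?thesis using True by simp
          next
            case False
            then have "?l < l" "N n - i \<le> l" using that by auto
            then show ?thesis unfolding lin using u(4)[OF that(1,2)] v(3)[of l] by simp
          qed
        qed
      qed
    qed
    from this[of "N n"] obtain u where u: "u \<in> L2 halfline" "\<And>n. ?out u (n, N n) = y (n, N n)"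
      "\<And>n l. n \<in> G \<Longrightarrow> l \<in> {1..N n} \<Longrightarrow> ?out u (n, l) = y (n, l)"
      "\<And>l. 1 \<le> l \<Longrightarrow> l \<le> N n \<Longrightarrow> ?out u (n, l) = y (n, l)" by auto
    show ?case
    proof (intro bexI[OF _ u(1)] conjI ballI allI)
      show "?out u (k, l) = y (k, l)" if "k \<in> insert n G" "l \<in> {1..N k}" for k l
        using u(3)[of k l] u(4)[of l] that by auto
    qed (rule u(2))
  qed
  from blocks[OF fin] obtain u where u: "u \<in> L2 halfline" "\<And>n. ?out u (n, N n) = y (n, N n)"
    "\<And>n l. N n \<noteq> 1 \<Longrightarrow> l \<in> {1..N n} \<Longrightarrow> ?out u (n, l) = y (n, l)" by blast
  have "?out u nl = y nl" if J: "nl \<in> jordan_index N" for nl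
  proof -
    obtain n l where nl: "nl = (n, l)" "1 \<le> l" "l \<le> N n" using J unfolding jordan_index_def by auto
    then show ?thesis using u(2)[of n] u(3)[of n l] by (cases "N n = 1") auto
  qed
  with u(1) show thesis by (rule that)
qed

section \<open>Semigroups on Jordan chains\<close>

lemma scaleC_zero_left: "0 *\<^sub>C x = (0 :: 'a::complex_banach)"
  using scaleC_add_left[of 0 0 x] by simp

lemma scaleC_zero_right: "c *\<^sub>C 0 = (0 :: 'a::complex_banach)"
  using scaleC_add_right[of c 0 "0::'a"] by simp

lemma scaleC_one: "1 *\<^sub>C x = (x :: 'a::complex_banach)"
  using scaleR_scaleC[of 1 x] by simp

lemma scaleC_minus_left: "(- c) *\<^sub>C x = - (c *\<^sub>C x :: 'a::complex_banach)"
  using scaleC_add_left[of c "- c" x] by (simp add: scaleC_zero_left add_eq_0_iff)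

lemma scaleC_sum_right: "c *\<^sub>C (\<Sum>i\<in>F. f i) = (\<Sum>i\<in>F. c *\<^sub>C f i :: 'a::complex_banach)"
  by (induction F rule: infinite_finite_induct) (auto simp: scaleC_zero_right scaleC_add_right)

lemma bounded_bilinear_scaleC: "bounded_bilinear (scaleC :: complex \<Rightarrow> 'a \<Rightarrow> 'a::complex_banach)"
proof
  show "(a *\<^sub>R c) *\<^sub>C x = a *\<^sub>R (c *\<^sub>C x)" for a c and x :: 'a
    by (simp add: scaleR_scaleC scaleC_scaleC scaleR_conv_of_real)
  show "c *\<^sub>C (a *\<^sub>R x) = a *\<^sub>R (c *\<^sub>C x)" for a c and x :: 'a
    by (simp add: scaleR_scaleC scaleC_scaleC mult.commute)
  show "\<exists>K. \<forall>c (x::'a). norm (c *\<^sub>C x) \<le> norm c * norm x * K"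
    by (intro exI[of _ 1]) (simp add: norm_scaleC)
qed (simp_all add: scaleC_add_left scaleC_add_right)

lemma bounded_clinearD:
  assumes "bounded_clinear S"
  shows "bounded_linear S" "S (c *\<^sub>C x) = c *\<^sub>C S x"
  using assms unfolding bounded_clinear_def by auto

lemma bounded_clinear_sum:
  assumes "bounded_clinear S"
  shows "S (\<Sum>i\<in>F. a i *\<^sub>C x i) = (\<Sum>i\<in>F. a i *\<^sub>C S (x i))"
proof -
  interpret bounded_linear S by (rule bounded_clinearD(1)[OF assms])
  show ?thesis by (simp add: sum bounded_clinearD(2)[OF assms])
qed

text \<open>The exponential of a Jordan block with eigenvalue \<open>\<mu>\<close>, applied to the \<open>j\<close>-th vector of the chain.\<close>

definition jordan_flow :: "complex \<Rightarrow> (nat \<Rightarrow> 'a::complex_banach) \<Rightarrow> nat \<Rightarrow> real \<Rightarrow> 'a"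
  where "jordan_flow \<mu> \<phi> j s = (\<Sum>l\<in>{1..j}. (exp (\<mu> * of_real s) * of_real (s ^ (j - l)) / fact (j - l)) *\<^sub>C \<phi> l)"

locale stable_semigroup =
  fixes T :: "real \<Rightarrow> 'a \<Rightarrow> 'a::complex_banach" and M \<omega> :: real
  assumes semigroup: "C0_semigroup T"
    and \<omega>: "0 < \<omega>" and stable: "\<And>t x. 0 \<le> t \<Longrightarrow> norm (T t x) \<le> M * exp (- \<omega> * t) * norm x"
begin

lemma T_clinear: "0 \<le> t \<Longrightarrow> bounded_clinear (T t)"
  using semigroup unfolding C0_semigroup_def by blast

lemma T_linear: "0 \<le> t \<Longrightarrow> bounded_linear (T t)"
  by (rule bounded_clinearD(1)[OF T_clinear])

lemma T_zero: "T 0 x = x"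
  using semigroup unfolding C0_semigroup_def by simp

lemma T_add: "0 \<le> s \<Longrightarrow> 0 \<le> t \<Longrightarrow> T (s + t) x = T s (T t x)"
  using semigroup unfolding C0_semigroup_def by (metis comp_apply)

lemma T_tendsto: "((\<lambda>t. T t x) \<longlongrightarrow> x) (at_right 0)"
  using semigroup unfolding C0_semigroup_def by blast

lemma T_diff: "0 \<le> t \<Longrightarrow> T t (x - y) = T t x - T t y"
  using T_linear by (simp add: bounded_linear.linear linear_diff)

lemma T_norm: "0 \<le> t \<Longrightarrow> norm (T t x) \<le> \<bar>M\<bar> * norm x"
proof -
  assume t: "0 \<le> t"
  have "M * exp (- \<omega> * t) \<le> \<bar>M\<bar> * 1"
    using t \<omega> by (intro mult_mono) auto
  then have "M * exp (- \<omega> * t) * norm x \<le> \<bar>M\<bar> * norm x" by (intro mult_right_mono) auto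
  then show ?thesis using stable[OF t, of x] by linarith
qed

lemma T_continuous_at_left:
  assumes "0 < t"
  shows "((\<lambda>h. T (t - h) x) \<longlongrightarrow> T t x) (at_right 0)"
proof -
  have "((\<lambda>h. \<bar>M\<bar> * norm (x - T h x)) \<longlongrightarrow> \<bar>M\<bar> * norm (x - x)) (at_right 0)"
    by (intro tendsto_intros T_tendsto)
  then have "((\<lambda>h. \<bar>M\<bar> * norm (x - T h x)) \<longlongrightarrow> 0) (at_right 0)" by simp
  moreover have "\<forall>\<^sub>F h in at_right 0. norm (T (t - h) x - T t x) \<le> \<bar>M\<bar> * norm (x - T h x)"
    using eventually_at_right_real[OF assms] eventually_at_right_less[of 0]
  proof eventually_elim
    case (elim h)
    then have "T t x = T (t - h) (T h x)" using T_add[of "t - h" h x] by simp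
    then have "T (t - h) x - T t x = T (t - h) (x - T h x)" using elim by (simp add: T_diff)
    then show ?case using T_norm[of "t - h" "x - T h x"] elim by simp
  qed
  ultimately have "((\<lambda>h. T (t - h) x - T t x) \<longlongrightarrow> 0) (at_right 0)"
    by (rule Lim_null_comparison[rotated])
  then show ?thesis by (simp add: LIM_zero_iff)
qed

text \<open>The right derivative is immediate from the semigroup law. The left one uses that the operators are
  uniformly bounded, so that the difference quotient may be replaced by its limit.\<close>

lemma T_has_vector_derivative:
  assumes gen: "((\<lambda>h. (1 / h) *\<^sub>R (T h x - x)) \<longlongrightarrow> y) (at_right 0)" and t: "0 < t"
  shows "((\<lambda>t. T t x) has_vector_derivative T t y) (at t)"
proof -
  let ?q = "\<lambda>s. (1 / norm (s - t)) *\<^sub>R (T s x - (T t x + (s - t) *\<^sub>R T t y))"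
  let ?d = "\<lambda>h. (1 / h) *\<^sub>R (T h x - x)"
  have t0: "0 \<le> t" using t by simp
  have scale: "T r (c *\<^sub>R z) = c *\<^sub>R T r z" if "0 \<le> r" for r c z
    using T_linear[OF that] by (simp add: bounded_linear.linear linear_scale)
  have right: "((\<lambda>h. ?q (t + h)) \<longlongrightarrow> 0) (at_right 0)"
  proof -
    have "((\<lambda>h. T t (?d h) - T t y) \<longlongrightarrow> T t y - T t y) (at_right 0)"
      by (intro tendsto_diff bounded_linear.tendsto[OF T_linear[OF t0] gen] tendsto_const)
    moreover have "\<forall>\<^sub>F h in at_right 0. T t (?d h) - T t y = ?q (t + h)"
      using eventually_at_right_less[of 0]
      by eventually_elim (simp add: scale[OF t0] T_diff[OF t0] T_add[OF t0] scaleR_diff_right scaleR_add_right)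
    ultimately show ?thesis by (simp add: Lim_transform_eventually)
  qed
  have left: "((\<lambda>h. ?q (t - h)) \<longlongrightarrow> 0) (at_right 0)"
  proof -
    have "((\<lambda>h. T (t - h) (?d h - y)) \<longlongrightarrow> 0) (at_right 0)"
    proof (rule Lim_null_comparison)
      have "((\<lambda>h. \<bar>M\<bar> * norm (?d h - y)) \<longlongrightarrow> \<bar>M\<bar> * norm (y - y)) (at_right 0)"
        by (intro tendsto_intros gen)
      then show "((\<lambda>h. \<bar>M\<bar> * norm (?d h - y)) \<longlongrightarrow> 0) (at_right 0)" by simp
      show "\<forall>\<^sub>F h in at_right 0. norm (T (t - h) (?d h - y)) \<le> \<bar>M\<bar> * norm (?d h - y)"
        using eventually_at_right_real[OF t] by eventually_elim (rule T_norm, simp)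
    qed
    then have "((\<lambda>h. T t y - (T (t - h) (?d h - y) + T (t - h) y)) \<longlongrightarrow> T t y - (0 + T t y)) (at_right 0)"
      by (intro tendsto_intros T_continuous_at_left t)
    moreover have "\<forall>\<^sub>F h in at_right 0. T t y - (T (t - h) (?d h - y) + T (t - h) y) = ?q (t - h)"
      using eventually_at_right_real[OF t]
    proof eventually_elim
      case (elim h)
      then have h: "0 < h" "0 \<le> t - h" by auto
      have "T (t - h) (T h x) = T t x" using T_add[of "t - h" h x] h by simp
      then show ?case using h
        by (simp add: T_diff[OF h(2)] scale[OF h(2)] scaleR_diff_right scaleR_add_right)
    qed
    ultimately show ?thesis by (simp add: Lim_transform_eventually)
  qed
  have "(?q \<longlongrightarrow> 0) (at t)"
    unfolding filterlim_at_split filterlim_at_left_to_right filterlim_at_right_to_0[where a = t]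
      filterlim_at_right_to_0[where a = "- t"]
    using left right by (simp add: add.commute)
  then show ?thesis
    unfolding has_vector_derivative_def has_derivative_within
    by (simp add: bounded_linear_scaleR_left)
qed

end

lemma jordan_coefficient_derivative:
  fixes \<mu> :: complex and s :: real
  shows
  "((\<lambda>s. exp (\<mu> * of_real s) * of_real (s ^ i) / fact i) has_vector_derivative
    (\<mu> * (exp (\<mu> * of_real s) * of_real (s ^ i) / fact i)
     + (if i = 0 then 0 else exp (\<mu> * of_real s) * of_real (s ^ (i - 1)) / fact (i - 1)))) (at s)"
proof -
  have "((\<lambda>s. exp (\<mu> * s) * s ^ i / fact i) has_field_derivative
      (\<mu> * (exp (\<mu> * of_real s) * of_real s ^ i / fact i)
       + (if i = 0 then 0 else exp (\<mu> * of_real s) * of_real s ^ (i - 1) / fact (i - 1)))) (at (of_real s))"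
  proof (cases i)
    case 0
    then show ?thesis by (auto intro!: derivative_eq_intros)
  next
    case (Suc k)
    have "((\<lambda>s. exp (\<mu> * s) * s ^ Suc k) has_field_derivative
        (exp (\<mu> * of_real s) * \<mu>) * of_real s ^ Suc k + of_nat (Suc k) * of_real s ^ k * exp (\<mu> * of_real s))
        (at (of_real s))"
      by (rule derivative_eq_intros refl)+ simp
    note DERIV_cdivide[OF this, of "fact (Suc k)"]
    moreover have "((exp (\<mu> * of_real s) * \<mu>) * of_real s ^ Suc k + of_nat (Suc k) * of_real s ^ k * exp (\<mu> * of_real s)) / fact (Suc k)
        = \<mu> * (exp (\<mu> * of_real s) * of_real s ^ Suc k / fact (Suc k)) + exp (\<mu> * of_real s) * of_real s ^ k / fact k"
    proof -
      have "of_nat (Suc k) * of_real s ^ k * exp (\<mu> * of_real s) / fact (Suc k) = exp (\<mu> * of_real s) * of_real s ^ k / fact k"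
        by (simp add: fact_Suc del: of_nat_Suc)
      then show ?thesis by (simp add: add_divide_distrib mult_ac del: fact_Suc of_nat_Suc)
    qed
    ultimately show ?thesis using Suc by simp
  qed
  then have "((\<lambda>s. exp (\<mu> * of_real s) * of_real s ^ i / fact i) has_vector_derivative
      (\<mu> * (exp (\<mu> * of_real s) * of_real s ^ i / fact i)
       + (if i = 0 then 0 else exp (\<mu> * of_real s) * of_real s ^ (i - 1) / fact (i - 1)))) (at s)"
    by (rule has_vector_derivative_real_field)
  then show ?thesis by (simp only: of_real_power)
qed

lemma jordan_flow_derivative:
  assumes "1 \<le> j"
  shows "(jordan_flow \<mu> \<phi> j has_vector_derivative
    (\<mu> *\<^sub>C jordan_flow \<mu> \<phi> j s + jordan_flow \<mu> \<phi> (j - 1) s)) (at s)"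
proof -
  let ?c = "\<lambda>i s. exp (\<mu> * of_real s) * of_real (s ^ i) / fact i"
  let ?c' = "\<lambda>i s. \<mu> * ?c i s + (if i = 0 then 0 else ?c (i - 1) s)"
  have "((\<lambda>s. \<Sum>l\<in>{1..j}. ?c (j - l) s *\<^sub>C \<phi> l) has_vector_derivative
      (\<Sum>l\<in>{1..j}. ?c' (j - l) s *\<^sub>C \<phi> l)) (at s)"
    by (intro has_vector_derivative_sum bounded_linear.has_vector_derivative[OF
          bounded_bilinear.bounded_linear_left[OF bounded_bilinear_scaleC]] jordan_coefficient_derivative)
  moreover have "(\<Sum>l\<in>{1..j}. ?c' (j - l) s *\<^sub>C \<phi> l) =
      \<mu> *\<^sub>C jordan_flow \<mu> \<phi> j s + jordan_flow \<mu> \<phi> (j - 1) s"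
  proof -
    have "(\<Sum>l\<in>{1..j}. ?c' (j - l) s *\<^sub>C \<phi> l) =
        (\<Sum>l\<in>{1..j}. (\<mu> * ?c (j - l) s) *\<^sub>C \<phi> l) + (\<Sum>l\<in>{1..j}. (if j - l = 0 then 0 else ?c (j - l - 1) s) *\<^sub>C \<phi> l)"
      by (simp add: scaleC_add_left sum.distrib)
    also have "(\<Sum>l\<in>{1..j}. (\<mu> * ?c (j - l) s) *\<^sub>C \<phi> l) = \<mu> *\<^sub>C jordan_flow \<mu> \<phi> j s"
      unfolding jordan_flow_def by (simp add: scaleC_sum_right scaleC_scaleC)
    also have "(\<Sum>l\<in>{1..j}. (if j - l = 0 then 0 else ?c (j - l - 1) s) *\<^sub>C \<phi> l) = jordan_flow \<mu> \<phi> (j - 1) s"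
      unfolding jordan_flow_def
    proof (rule sum.mono_neutral_cong_right)
      show "\<forall>l\<in>{1..j} - {1..j - 1}. (if j - l = 0 then 0 else ?c (j - l - 1) s) *\<^sub>C \<phi> l = 0"
        by (auto simp: scaleC_zero_left)
    qed (auto simp: diff_diff_add add.commute)
    finally show ?thesis .
  qed
  ultimately show ?thesis unfolding jordan_flow_def[abs_def] by simp
qed

lemma jordan_flow_0: "1 \<le> j \<Longrightarrow> jordan_flow \<mu> \<phi> j 0 = \<phi> j"
proof -
  assume j: "1 \<le> j"
  have "jordan_flow \<mu> \<phi> j 0 = (\<Sum>l\<in>{j}. (exp (\<mu> * of_real 0) * of_real (0 ^ (j - l)) / fact (j - l)) *\<^sub>C \<phi> l)"
    unfolding jordan_flow_def using j
    by (intro sum.mono_neutral_right) (auto simp: scaleC_zero_left power_0_left)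
  then show ?thesis by (simp add: scaleC_one)
qed

context stable_semigroup
begin

text \<open>By induction along the chain the difference of both sides solves \<open>d' = \<mu> d\<close> with \<open>d 0 = 0\<close>.\<close>

lemma T_jordan_chain:
  assumes gen: "\<And>j. j \<in> {1..N} \<Longrightarrow> ((\<lambda>h. (1 / h) *\<^sub>R (T h (\<phi> j) - \<phi> j)) \<longlongrightarrow>
      \<mu> *\<^sub>C \<phi> j + (if j = 1 then 0 else \<phi> (j - 1))) (at_right 0)"
    and j: "1 \<le> j" "j \<le> N" and t: "0 \<le> t"
  shows "T t (\<phi> j) = jordan_flow \<mu> \<phi> j t"
  using j t
proof (induction j arbitrary: t rule: less_induct)
  case (less j)
  define d where "d s = T s (\<phi> j) - jordan_flow \<mu> \<phi> j s" for s
  have gen_j: "((\<lambda>h. (1 / h) *\<^sub>R (T h (\<phi> j) - \<phi> j)) \<longlongrightarrow>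
      \<mu> *\<^sub>C \<phi> j + (if j = 1 then 0 else \<phi> (j - 1))) (at_right 0)"
    using less.prems by (intro gen) simp
  have prev: "T s (if j = 1 then 0 else \<phi> (j - 1)) = jordan_flow \<mu> \<phi> (j - 1) s" if "0 \<le> s" for s
  proof (cases "j = 1")
    case True
    then show ?thesis
      using linear_0[OF bounded_linear.linear[OF T_linear[OF that]]] by (simp add: jordan_flow_def)
  next
    case False
    then show ?thesis using less.IH[of "j - 1" s] less.prems that by simp
  qed
  have d': "(d has_vector_derivative \<mu> *\<^sub>C d s) (at s)" if s: "0 < s" for s
  proof -
    have "(d has_vector_derivative T s (\<mu> *\<^sub>C \<phi> j + (if j = 1 then 0 else \<phi> (j - 1)))
        - (\<mu> *\<^sub>C jordan_flow \<mu> \<phi> j s + jordan_flow \<mu> \<phi> (j - 1) s)) (at s)"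
      unfolding d_def[abs_def]
      by (intro has_vector_derivative_diff T_has_vector_derivative gen_j s jordan_flow_derivative less.prems)
    also have "T s (\<mu> *\<^sub>C \<phi> j + (if j = 1 then 0 else \<phi> (j - 1))) =
        \<mu> *\<^sub>C T s (\<phi> j) + jordan_flow \<mu> \<phi> (j - 1) s"
      using s prev[of s] linear_add[OF bounded_linear.linear[OF T_linear]] bounded_clinearD(2)[OF T_clinear]
      by simp
    also have "\<dots> - (\<mu> *\<^sub>C jordan_flow \<mu> \<phi> j s + jordan_flow \<mu> \<phi> (j - 1) s) = \<mu> *\<^sub>C d s"
      unfolding d_def by (simp add: bounded_bilinear.diff_right[OF bounded_bilinear_scaleC])
    finally show ?thesis .
  qed
  define k where "k s = exp (- \<mu> * of_real s) *\<^sub>C d s" for s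
  have k': "(k has_vector_derivative 0) (at s)" if s: "0 < s" for s
  proof -
    have "((\<lambda>s. exp (- \<mu> * of_real s)) has_vector_derivative exp (- \<mu> * of_real s) * (- \<mu>)) (at s)"
      by (rule has_vector_derivative_real_field) (auto intro!: derivative_eq_intros)
    from bounded_bilinear.has_vector_derivative[OF bounded_bilinear_scaleC this d'[OF s]]
    have "(k has_vector_derivative exp (- \<mu> * of_real s) *\<^sub>C (\<mu> *\<^sub>C d s) + (exp (- \<mu> * of_real s) * (- \<mu>)) *\<^sub>C d s) (at s)"
      unfolding k_def[abs_def] .
    then show ?thesis by (simp add: scaleC_scaleC scaleC_minus_left)
  qed
  have d_0: "(d \<longlongrightarrow> 0) (at_right 0)"
  proof -
    have "isCont (jordan_flow \<mu> \<phi> j) 0"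
      using has_vector_derivative_continuous[OF jordan_flow_derivative[OF less.prems(1)]] .
    then have "(jordan_flow \<mu> \<phi> j \<longlongrightarrow> jordan_flow \<mu> \<phi> j 0) (at_right 0)"
      unfolding isCont_def filterlim_at_split by simp
    then have "(d \<longlongrightarrow> \<phi> j - jordan_flow \<mu> \<phi> j 0) (at_right 0)"
      unfolding d_def[abs_def] by (intro tendsto_intros T_tendsto)
    then show ?thesis using jordan_flow_0[OF less.prems(1), of \<mu> \<phi>] by simp
  qed
  have "d 0 = 0" unfolding d_def using jordan_flow_0[OF less.prems(1), of \<mu> \<phi>] by (simp add: T_zero)
  show ?case
  proof (cases "t = 0")
    case True
    then show ?thesis using \<open>d 0 = 0\<close> unfolding d_def by simp
  next
    case False
    then have t: "0 < t" using less.prems by simp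
    have cont: "continuous_on {0..t} k"
      unfolding continuous_on_eq_continuous_within
    proof
      fix s assume "s \<in> {0..t}"
      show "continuous (at s within {0..t}) k"
      proof (cases "s = 0")
        case True
        have "(k \<longlongrightarrow> exp (- \<mu> * of_real 0) *\<^sub>C 0) (at_right 0)"
          unfolding k_def[abs_def]
          by (intro bounded_bilinear.tendsto[OF bounded_bilinear_scaleC] tendsto_intros d_0)
        moreover have "k 0 = 0" unfolding k_def \<open>d 0 = 0\<close> by (simp add: scaleC_zero_right)
        ultimately show ?thesis
          unfolding True continuous_within at_within_Icc_at_right[OF t] by (simp add: scaleC_zero_right)
      next
        case False
        then have "0 < s" using \<open>s \<in> {0..t}\<close> by simp
        then show ?thesis
          using has_vector_derivative_continuous[OF k'] continuous_at_imp_continuous_at_within by blast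
      qed
    qed
    have "k t = 0"
    proof (rule has_derivative_zero_unique_strong_interval[of "{0}" 0 t k 0])
      show "k 0 = 0" unfolding k_def \<open>d 0 = 0\<close> by (simp add: scaleC_zero_right)
      show "(k has_derivative (\<lambda>h. 0)) (at s within {0..t})" if "s \<in> {0..t} - {0}" for s
        using k'[of s] that by (auto simp: has_vector_derivative_def intro: has_derivative_at_withinI)
    qed (use t cont in auto)
    then have "norm (k t) = 0" by simp
    then have "d t = 0" unfolding k_def norm_scaleC by simp
    then show ?thesis unfolding d_def by simp
  qed
qed
end

section \<open>Coordinates in the extended space\<close>

text \<open>The situation of the theorem after the generator has been traded for the explicit action of the
  semigroup on the Jordan chains.\<close>

locale extended_jordan_system = stable_semigroup T M \<omega>
  for T :: "real \<Rightarrow> 'h \<Rightarrow> 'h::complex_hilbert" and M \<omega> +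
  fixes ev :: "nat \<Rightarrow> complex" and N :: "nat \<Rightarrow> nat"
    and \<phi> :: "nat \<times> nat \<Rightarrow> 'h" and b :: "nat \<times> nat \<Rightarrow> complex" and e :: "nat \<Rightarrow> nat \<times> nat"
    and \<iota> :: "'h \<Rightarrow> 'k::{complex_banach, second_countable_topology}"
  assumes block_size: "\<And>n. 1 \<le> N n"
    and almost_all_simple: "finite {n. N n \<noteq> 1}"
    and basis: "riesz_basis (jordan_index N) \<phi>"
    and enumeration: "bij_betw e UNIV (jordan_index N)"
    and extended: "is_extended_space (\<phi> \<circ> e) (b \<circ> e) \<iota>"
    and T_flow: "\<And>n j t. 1 \<le> j \<Longrightarrow> j \<le> N n \<Longrightarrow> 0 \<le> t \<Longrightarrow>
      T t (\<phi> (n, j)) = jordan_flow (ev n) (\<lambda>j. \<phi> (n, j)) j t"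
    and T_differentiable: "\<And>i t. i \<in> jordan_index N \<Longrightarrow> 0 < t \<Longrightarrow> isCont (\<lambda>t. T t (\<phi> i)) t"
begin

definition \<psi> :: "nat \<Rightarrow> 'h" where "\<psi> m = \<phi> (e m)"
definition \<beta> :: "nat \<Rightarrow> complex" where "\<beta> m = b (e m)"
text \<open>The squared norm of \<open>\<psi> m\<close> in the extended space.\<close>

definition weight :: "nat \<Rightarrow> real"
  where "weight m = 1 / ((real (Suc m))\<^sup>2 * (1 + (cmod (\<beta> m))\<^sup>2))"

lemma weight_pos: "0 < weight m"
  unfolding weight_def by (auto intro!: mult_pos_pos add_pos_nonneg)

lemma e_in: "e m \<in> jordan_index N"
  using enumeration by (auto simp: bij_betw_def)

lemma e_inj: "e m = e k \<longleftrightarrow> m = k"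
  using enumeration by (auto simp: bij_betw_def inj_eq)

lemma e_surj: "i \<in> jordan_index N \<Longrightarrow> \<exists>m. e m = i"
  using enumeration unfolding bij_betw_def by (metis imageE)

lemma \<iota>_clinear: "bounded_clinear \<iota>"
  using extended unfolding is_extended_space_def by blast

lemma \<iota>_linear: "bounded_linear \<iota>"
  by (rule bounded_clinearD(1)[OF \<iota>_clinear])

abbreviation comb :: "nat set \<Rightarrow> (nat \<Rightarrow> complex) \<Rightarrow> 'h"
  where "comb F a \<equiv> \<Sum>m\<in>F. a m *\<^sub>C \<psi> m"

lemma norm_\<iota>_sum:
  assumes "finite F"
  shows "(norm (\<iota> (comb F a)))\<^sup>2 = (\<Sum>m\<in>F. (cmod (a m))\<^sup>2 * weight m)"
proof -
  obtain L where L: "F \<subseteq> {..<L}" using assms finite_nat_iff_bounded by blast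
  let ?a = "\<lambda>m. if m \<in> F then a m else 0"
  have F: "{..<L} \<inter> F = F" using L by blast
  have "comb F a = (\<Sum>m<L. ?a m *\<^sub>C (\<phi> \<circ> e) m)"
    using L by (intro sum.mono_neutral_cong_left) (auto simp: \<psi>_def scaleC_zero_left)
  moreover have "(\<Sum>m\<in>F. (cmod (a m))\<^sup>2 * weight m) =
      (\<Sum>m<L. (cmod (?a m))\<^sup>2 / ((real (Suc m))\<^sup>2 * (1 + (cmod ((b \<circ> e) m))\<^sup>2)))"
    using L by (intro sum.mono_neutral_cong_left) (auto simp: weight_def \<beta>_def)
  ultimately show ?thesis using extended unfolding is_extended_space_def by metis
qed

definition finite_sums :: "'h set"
  where "finite_sums = {x. \<exists>F a. finite F \<and> x = comb F a}"

lemma finite_sumsI: "finite F \<Longrightarrow> (comb F a) \<in> finite_sums"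
  unfolding finite_sums_def by blast

lemma finite_sums_common:
  assumes "finite F" "finite F'"
  shows "comb F a + comb F' a' =
    (comb (F \<union> F') (\<lambda>m. (if m \<in> F then a m else 0) + (if m \<in> F' then a' m else 0)))"
proof -
  have "comb F a = comb (F \<union> F') (\<lambda>m. (if m \<in> F then a m else 0))"
    using assms by (intro sum.mono_neutral_cong_left) (auto simp: scaleC_zero_left)
  moreover have "comb F' a' = comb (F \<union> F') (\<lambda>m. (if m \<in> F' then a' m else 0))"
    using assms by (intro sum.mono_neutral_cong_left) (auto simp: scaleC_zero_left)
  ultimately show ?thesis by (simp only: scaleC_add_left sum.distrib)
qed

lemma cspan_subset: "cspan (range \<psi>) \<subseteq> finite_sums"
proof -
  interpret vector_space "scaleC :: complex \<Rightarrow> 'h \<Rightarrow> 'h" by (rule vector_space_scaleC)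
  show ?thesis unfolding cspan_def
  proof (rule span_minimal)
    have "\<psi> m \<in> finite_sums" for m
      using finite_sumsI[of "{m}" "\<lambda>_. 1"] by (simp add: scaleC_one)
    then show "range \<psi> \<subseteq> finite_sums" by blast
    show "subspace finite_sums"
    proof (rule subspaceI)
      show "0 \<in> finite_sums" using finite_sumsI[of "{}"] by simp
      show "x + y \<in> finite_sums" if "x \<in> finite_sums" "y \<in> finite_sums" for x y
      proof -
        obtain F a F' a' where *: "finite F" "x = comb F a" "finite F'" "y = comb F' a'"
          using \<open>x \<in> finite_sums\<close> \<open>y \<in> finite_sums\<close> unfolding finite_sums_def by blast
        show ?thesis
          unfolding *(2,4) finite_sums_common[OF *(1,3)] by (rule finite_sumsI) (simp add: *)
      qed
      show "c *\<^sub>C x \<in> finite_sums" if "x \<in> finite_sums" for c x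
      proof -
        obtain F a where *: "finite F" "x = comb F a"
          using \<open>x \<in> finite_sums\<close> unfolding finite_sums_def by blast
        have "c *\<^sub>C x = comb F (\<lambda>m. c * a m)"
          unfolding * by (simp add: scaleC_sum_right scaleC_scaleC)
        then show ?thesis using finite_sumsI[OF *(1)] by simp
      qed
    qed
  qed
qed

lemma range_\<psi>: "range \<psi> = \<phi> ` jordan_index N"
  unfolding \<psi>_def using enumeration by (metis bij_betw_def image_image)

lemma closure_finite_sums: "closure finite_sums = UNIV"
proof -
  have "closure (cspan (range \<psi>)) = UNIV"
    using basis unfolding riesz_basis_def range_\<psi> by blast
  then show ?thesis using closure_mono[OF cspan_subset] by auto
qed

lemma closure_\<iota>_finite_sums: "closure (\<iota> ` finite_sums) = UNIV"
proof -
  have "range \<psi> = range (\<phi> \<circ> e)" by (auto simp: \<psi>_def)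
  then have "closure (\<iota> ` cspan (range \<psi>)) = UNIV"
    using extended unfolding is_extended_space_def by simp
  then show ?thesis using closure_mono[OF image_mono[OF cspan_subset, of \<iota>]] by auto
qed

lemma finite_sums_dense:
  assumes "closed {x. P x}" "\<And>F a. finite F \<Longrightarrow> P (comb F a)"
  shows "P x"
proof -
  have "finite_sums \<subseteq> {x. P x}" using assms(2) unfolding finite_sums_def by blast
  then have "closure finite_sums \<subseteq> {x. P x}" using assms(1) by (rule closure_minimal)
  then show ?thesis unfolding closure_finite_sums by blast
qed

lemma \<iota>_finite_sums_dense:
  assumes "closed {k. P k}" "\<And>F a. finite F \<Longrightarrow> P (\<iota> (comb F a))"
  shows "P k"
proof -
  have "\<iota> ` finite_sums \<subseteq> {k. P k}" using assms(2) unfolding finite_sums_def by blast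
  then have "closure (\<iota> ` finite_sums) \<subseteq> {k. P k}" using assms(1) by (rule closure_minimal)
  then show ?thesis unfolding closure_\<iota>_finite_sums by blast
qed

lemma equal_on_\<iota>_finite_sums:
  fixes f g :: "'k \<Rightarrow> 'c::real_normed_vector"
  assumes "bounded_linear f" "bounded_linear g" "\<And>x. x \<in> finite_sums \<Longrightarrow> f (\<iota> x) = g (\<iota> x)"
  shows "f k = g k"
proof (rule \<iota>_finite_sums_dense)
  show "closed {k. f k = g k}" by (intro closed_Collect_eq linear_continuous_on assms)
qed (rule assms(3)[OF finite_sumsI])

lemma equal_on_finite_sums:
  fixes f g :: "'h \<Rightarrow> 'c::real_normed_vector"
  assumes "bounded_linear f" "bounded_linear g" "\<And>x. x \<in> finite_sums \<Longrightarrow> f x = g x"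
  shows "f x = g x"
proof (rule finite_sums_dense)
  show "closed {x. f x = g x}" by (intro closed_Collect_eq linear_continuous_on assms)
qed (rule assms(3)[OF finite_sumsI])

text \<open>The norm of the extended space is a weighted square-sum norm on finite sums, hence the coefficients
  are bounded functionals there and extend by density.\<close>

lemma coordinate_exists:
  "\<exists>f :: 'k \<Rightarrow> complex. bounded_linear f \<and>
    (\<forall>F a. finite F \<longrightarrow> f (\<iota> (comb F a)) = (if m \<in> F then a m else 0))"
proof -
  let ?c = "\<lambda>F a. if m \<in> F then a m else (0::complex)"
  define G where "G = {(\<iota> (comb F a), ?c F a) | F a. finite F}"
  have GI: "(\<iota> (comb F a), ?c F a) \<in> G" if "finite F" for F a
    unfolding G_def using that by blast
  have add: "(x + x', y + y') \<in> G" if "(x, y) \<in> G" "(x', y') \<in> G" for x y x' y'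
  proof -
    obtain F a F' a' where *: "finite F" "x = \<iota> (comb F a)" "y = ?c F a"
      "finite F'" "x' = \<iota> (comb F' a')" "y' = ?c F' a'"
      using \<open>(x, y) \<in> G\<close> \<open>(x', y') \<in> G\<close> unfolding G_def by blast
    let ?s = "\<lambda>k. (if k \<in> F then a k else 0) + (if k \<in> F' then a' k else 0)"
    have "x + x' = \<iota> (comb (F \<union> F') ?s)"
      unfolding * finite_sums_common[OF *(1,4), symmetric]
      using linear_add[OF bounded_linear.linear[OF \<iota>_linear]] by simp
    moreover have "y + y' = ?c (F \<union> F') ?s" unfolding * by simp
    ultimately show ?thesis using GI[of "F \<union> F'" ?s] *(1,4) by simp
  qed
  have scale: "(c *\<^sub>R x, c *\<^sub>R y) \<in> G" if "(x, y) \<in> G" for c x y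
  proof -
    obtain F a where *: "finite F" "x = \<iota> (comb F a)" "y = ?c F a"
      using \<open>(x, y) \<in> G\<close> unfolding G_def by blast
    have "c *\<^sub>R x = \<iota> (comb F (\<lambda>k. of_real c * a k))"
      unfolding * scaleR_scaleC bounded_clinearD(2)[OF \<iota>_clinear, symmetric]
      by (simp add: scaleC_sum_right scaleC_scaleC)
    moreover have "c *\<^sub>R y = ?c F (\<lambda>k. of_real c * a k)" unfolding * by (simp add: scaleR_conv_of_real)
    ultimately show ?thesis using GI[OF *(1), of "\<lambda>k. of_real c * a k"] by (simp only:)
  qed
  have bound: "norm y \<le> 1 / sqrt (weight m) * norm x" if "(x, y) \<in> G" for x y
  proof -
    obtain F a where *: "finite F" "x = \<iota> (comb F a)" "y = ?c F a"
      using \<open>(x, y) \<in> G\<close> unfolding G_def by blast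
    have "(norm y)\<^sup>2 * weight m \<le> (norm x)\<^sup>2"
    proof (cases "m \<in> F")
      case True
      then have "(norm y)\<^sup>2 * weight m = (\<Sum>k\<in>{m}. (cmod (a k))\<^sup>2 * weight k)" using * by simp
      also have "\<dots> \<le> (\<Sum>k\<in>F. (cmod (a k))\<^sup>2 * weight k)"
        using True *(1) weight_pos by (intro sum_mono2) (auto simp: less_imp_le)
      finally show ?thesis unfolding *(2) norm_\<iota>_sum[OF *(1)] .
    qed (simp add: *)
    then have "sqrt ((norm y)\<^sup>2 * weight m) \<le> sqrt ((norm x)\<^sup>2)" by (rule real_sqrt_le_mono)
    then have "norm y * sqrt (weight m) \<le> norm x" by (simp add: real_sqrt_mult)
    then show ?thesis using weight_pos[of m] by (simp add: pos_le_divide_eq)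
  qed
  have "\<iota> ` finite_sums \<subseteq> fst ` G"
  proof clarify
    fix x assume "x \<in> finite_sums"
    then obtain F a where *: "finite F" "x = comb F a" unfolding finite_sums_def by blast
    show "\<iota> x \<in> fst ` G" unfolding *(2) by (rule image_eqI[OF _ GI[OF *(1), of a]]) simp
  qed
  then have "closure (\<iota> ` finite_sums) \<subseteq> closure (fst ` G)" by (rule closure_mono)
  then have dense: "closure (fst ` G) = UNIV" unfolding closure_\<iota>_finite_sums by auto
  obtain f where f: "bounded_linear f" "\<And>x y. (x, y) \<in> G \<Longrightarrow> f x = y"
    using bounded_linear_extension[OF add scale bound dense] by blast
  have "f (\<iota> (comb F a)) = ?c F a" if "finite F" for F a
    by (rule f(2)[OF GI[OF that]])
  with f(1) show ?thesis by blast
qed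

definition coordinate :: "nat \<Rightarrow> 'k \<Rightarrow> complex"
  where "coordinate m = (SOME f. bounded_linear f \<and>
    (\<forall>F a. finite F \<longrightarrow> f (\<iota> (comb F a)) = (if m \<in> F then a m else 0)))"

lemma coordinate_linear: "bounded_linear (coordinate m)"
  and coordinate_sum: "finite F \<Longrightarrow> coordinate m (\<iota> (comb F a)) = (if m \<in> F then a m else 0)"
  using someI_ex[OF coordinate_exists[of m]] unfolding coordinate_def[symmetric] by blast+

lemma coordinate_basis: "coordinate m (\<iota> (\<psi> k)) = (if m = k then 1 else 0)"
  using coordinate_sum[of "{k}" m "\<lambda>_. 1"] by (simp add: scaleC_one)

lemma coordinate_scaleC: "coordinate m (c *\<^sub>C k) = c * coordinate m k"
proof (rule equal_on_\<iota>_finite_sums[where f = "\<lambda>k. coordinate m (c *\<^sub>C k)"])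
  show "bounded_linear (\<lambda>k. coordinate m (c *\<^sub>C k))"
    by (rule bounded_linear_compose[OF coordinate_linear
          bounded_bilinear.bounded_linear_right[OF bounded_bilinear_scaleC]])
  show "bounded_linear (\<lambda>k. c * coordinate m k)"
    by (intro bounded_linear_const_mult coordinate_linear)
  fix x assume "x \<in> finite_sums"
  then obtain F a where x: "finite F" "x = comb F a" unfolding finite_sums_def by blast
  have "c *\<^sub>C \<iota> x = \<iota> (comb F (\<lambda>k. c * a k))"
    unfolding x bounded_clinearD(2)[OF \<iota>_clinear, symmetric] by (simp add: scaleC_sum_right scaleC_scaleC)
  then show "coordinate m (c *\<^sub>C \<iota> x) = c * coordinate m (\<iota> x)"
    using coordinate_sum[OF x(1)] unfolding x(2) by simp
qed

text \<open>Bessel's inequality for the coordinates holds on finite sums and extends by density. Applied to the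
  difference of a finite sum and an approximated vector without coordinates, it shows that the
  vector is arbitrarily small.\<close>

lemma coordinate_eqI:
  assumes "\<And>m. coordinate m k = coordinate m k'"
  shows "k = k'"
proof -
  have bessel: "(\<Sum>m\<in>F. (cmod (coordinate m v))\<^sup>2 * weight m) \<le> (norm v)\<^sup>2" if F: "finite F" for F v
  proof (rule \<iota>_finite_sums_dense[of "\<lambda>v. (\<Sum>m\<in>F. (cmod (coordinate m v))\<^sup>2 * weight m) \<le> (norm v)\<^sup>2"])
    show "closed {v. (\<Sum>m\<in>F. (cmod (coordinate m v))\<^sup>2 * weight m) \<le> (norm v)\<^sup>2}"
      by (intro closed_Collect_le continuous_intros linear_continuous_on coordinate_linear)
    fix E :: "nat set" and a assume E: "finite E"
    have "(\<Sum>m\<in>F. (cmod (coordinate m (\<iota> (comb E a))))\<^sup>2 * weight m) = (\<Sum>m\<in>F \<inter> E. (cmod (a m))\<^sup>2 * weight m)"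
      unfolding coordinate_sum[OF E] using F by (intro sum.mono_neutral_cong_right) auto
    also have "\<dots> \<le> (\<Sum>m\<in>E. (cmod (a m))\<^sup>2 * weight m)"
      using E weight_pos by (intro sum_mono2) (auto simp: less_imp_le)
    finally show "(\<Sum>m\<in>F. (cmod (coordinate m (\<iota> (comb E a))))\<^sup>2 * weight m) \<le> (norm (\<iota> (comb E a)))\<^sup>2"
      unfolding norm_\<iota>_sum[OF E] .
  qed
  have small: "norm (k - k') < 2 * r" if r: "0 < r" for r
  proof -
    have "k - k' \<in> closure (\<iota> ` finite_sums)" unfolding closure_\<iota>_finite_sums by simp
    then obtain x where x: "x \<in> finite_sums" "dist (\<iota> x) (k - k') < r"
      using r unfolding closure_approachable by blast
    obtain F a where xF: "finite F" "x = comb F a" using x(1) unfolding finite_sums_def by blast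
    have coords: "coordinate m (\<iota> x - (k - k')) = a m" if "m \<in> F" for m
    proof -
      interpret bounded_linear "coordinate m" by (rule coordinate_linear)
      show ?thesis using that coordinate_sum[OF xF(1), of m a] assms[of m] unfolding xF(2) by (simp add: diff)
    qed
    have "(norm (\<iota> x))\<^sup>2 = (\<Sum>m\<in>F. (cmod (coordinate m (\<iota> x - (k - k'))))\<^sup>2 * weight m)"
      unfolding xF(2) norm_\<iota>_sum[OF xF(1)] using coords unfolding xF(2) by (intro sum.cong) auto
    also have "\<dots> \<le> (norm (\<iota> x - (k - k')))\<^sup>2" by (rule bessel[OF xF(1)])
    finally have "norm (\<iota> x) \<le> norm (\<iota> x - (k - k'))" by (rule power2_le_imp_le) simp
    moreover have "norm (k - k') \<le> norm (\<iota> x) + norm (\<iota> x - (k - k'))"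
      using norm_triangle_ineq4[of "\<iota> x" "\<iota> x - (k - k')"] by simp
    ultimately show ?thesis using x(2) by (simp add: dist_norm)
  qed
  have "norm (k - k') = 0"
  proof (rule ccontr)
    assume "norm (k - k') \<noteq> 0"
    then show False using small[of "norm (k - k') / 2"] by simp
  qed
  then show ?thesis by simp
qed

lemma riesz_constants:
  "\<exists>c C. 0 < c \<and> 0 < C \<and> (\<forall>F a. finite F \<longrightarrow>
    c * (\<Sum>m\<in>F. (cmod (a m))\<^sup>2) \<le> (norm (comb F a))\<^sup>2 \<and>
    (norm (comb F a))\<^sup>2 \<le> C * (\<Sum>m\<in>F. (cmod (a m))\<^sup>2))"
proof -
  obtain c C where cC: "0 < c" "0 < C" "\<forall>F a. finite F \<and> F \<subseteq> jordan_index N \<longrightarrow>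
        c * (\<Sum>i\<in>F. (cmod (a i))\<^sup>2) \<le> (norm (\<Sum>i\<in>F. a i *\<^sub>C \<phi> i))\<^sup>2 \<and>
        (norm (\<Sum>i\<in>F. a i *\<^sub>C \<phi> i))\<^sup>2 \<le> C * (\<Sum>i\<in>F. (cmod (a i))\<^sup>2)"
    using basis unfolding riesz_basis_def by blast
  let ?e' = "inv_into UNIV e"
  have inj: "inj_on e F" for F using e_inj by (auto simp: inj_on_def)
  have e': "?e' (e m) = m" for m by (rule inv_into_f_f[OF inj]) simp
  have sums: "(\<Sum>i\<in>e ` F. a (?e' i) *\<^sub>C \<phi> i) = comb F a"
    "(\<Sum>i\<in>e ` F. (cmod (a (?e' i)))\<^sup>2) = (\<Sum>m\<in>F. (cmod (a m))\<^sup>2)" for F a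
    by (simp_all add: sum.reindex[OF inj] e' \<psi>_def)
  show ?thesis
  proof (intro exI conjI allI impI)
    fix F :: "nat set" and a assume F: "finite F"
    then have "finite (e ` F) \<and> e ` F \<subseteq> jordan_index N" using e_in by auto
    from cC(3)[rule_format, OF this, of "\<lambda>i. a (?e' i)"]
    show "c * (\<Sum>m\<in>F. (cmod (a m))\<^sup>2) \<le> (norm (comb F a))\<^sup>2"
      "(norm (comb F a))\<^sup>2 \<le> C * (\<Sum>m\<in>F. (cmod (a m))\<^sup>2)"
      unfolding sums by auto
  qed (rule cC)+
qed

lemma coordinate_\<iota>_linear: "bounded_linear (\<lambda>x. coordinate m (\<iota> x))"
  by (rule bounded_linear_compose[OF coordinate_linear \<iota>_linear])

lemma coordinate_square_summable: "summable (\<lambda>m. (cmod (coordinate m (\<iota> x)))\<^sup>2)"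
proof -
  obtain c C where c: "0 < c"
    "\<And>F a. finite F \<Longrightarrow> c * (\<Sum>m\<in>F. (cmod (a m))\<^sup>2) \<le> (norm (comb F a))\<^sup>2"
    using riesz_constants by blast
  have bound: "c * (\<Sum>m\<in>F. (cmod (coordinate m (\<iota> x)))\<^sup>2) \<le> (norm x)\<^sup>2" if F: "finite F" for F
  proof (rule finite_sums_dense[of "\<lambda>x. c * (\<Sum>m\<in>F. (cmod (coordinate m (\<iota> x)))\<^sup>2) \<le> (norm x)\<^sup>2"])
    show "closed {x. c * (\<Sum>m\<in>F. (cmod (coordinate m (\<iota> x)))\<^sup>2) \<le> (norm x)\<^sup>2}"
      by (intro closed_Collect_le continuous_intros linear_continuous_on coordinate_\<iota>_linear)
    fix E :: "nat set" and a assume E: "finite E"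
    have "(\<Sum>m\<in>F. (cmod (coordinate m (\<iota> (comb E a))))\<^sup>2) = (\<Sum>m\<in>F \<inter> E. (cmod (a m))\<^sup>2)"
      unfolding coordinate_sum[OF E] using F by (intro sum.mono_neutral_cong_right) auto
    also have "\<dots> \<le> (\<Sum>m\<in>E. (cmod (a m))\<^sup>2)" using E by (intro sum_mono2) auto
    finally have "c * (\<Sum>m\<in>F. (cmod (coordinate m (\<iota> (comb E a))))\<^sup>2) \<le> c * (\<Sum>m\<in>E. (cmod (a m))\<^sup>2)"
      using c(1) by (intro mult_left_mono) auto
    then show "c * (\<Sum>m\<in>F. (cmod (coordinate m (\<iota> (comb E a))))\<^sup>2) \<le> (norm (comb E a))\<^sup>2"
      using c(2)[OF E, of a] by linarith
  qed
  show ?thesis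
  proof (rule bounded_imp_summable)
    show "(\<Sum>m\<le>n. (cmod (coordinate m (\<iota> x)))\<^sup>2) \<le> (norm x)\<^sup>2 / c" for n
      using bound[of "{..n}"] c(1) by (simp add: pos_le_divide_eq mult.commute)
  qed simp
qed

definition multiple_indices :: "nat set"
  where "multiple_indices = {m. N (fst (e m)) \<noteq> 1}"

lemma finite_multiple_indices: "finite multiple_indices"
proof -
  have "finite (e -` (SIGMA n:{n. N n \<noteq> 1}. {1..N n}))"
    using almost_all_simple e_inj by (intro finite_vimageI finite_SigmaI) (auto simp: inj_def)
  moreover have "multiple_indices \<subseteq> e -` (SIGMA n:{n. N n \<noteq> 1}. {1..N n})"
  proof
    fix m assume "m \<in> multiple_indices"
    then show "m \<in> e -` (SIGMA n:{n. N n \<noteq> 1}. {1..N n})"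
      using e_in[of m] unfolding multiple_indices_def jordan_index_def by (cases "e m") auto
  qed
  ultimately show ?thesis by (rule finite_subset[rotated])
qed

lemma \<psi>_neq_0: "\<psi> m \<noteq> 0"
proof
  assume "\<psi> m = 0"
  then have "(norm (\<iota> (comb {m} (\<lambda>k. 1))))\<^sup>2 = 0"
    using linear_0[OF bounded_linear.linear[OF \<iota>_linear]] by (simp add: scaleC_one)
  then show False using norm_\<iota>_sum[of "{m}" "\<lambda>_. 1"] weight_pos[of m] by simp
qed

lemma T_eigenvector: "0 \<le> t \<Longrightarrow> T t (\<phi> (n, 1)) = exp (ev n * of_real t) *\<^sub>C \<phi> (n, 1)"
  using T_flow[of 1 n t] block_size[of n] by (simp add: jordan_flow_def)

text \<open>The orbit of an eigenvector behaves exactly like \<open>exp (Re (ev n) * t)\<close>, and no orbit may exceed the bound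
  for the semigroup.\<close>

lemma Re_eigenvalue_le: "Re (ev n) \<le> - \<omega>"
proof (rule ccontr)
  assume "\<not> ?thesis"
  then have pos: "0 < Re (ev n) + \<omega>" by simp
  have "(n, 1) \<in> jordan_index N" using block_size by (simp add: jordan_index_def)
  then obtain m where "e m = (n, 1)" using e_surj by blast
  then have nz: "0 < norm (\<phi> (n, 1))" using \<psi>_neq_0[of m] unfolding \<psi>_def by simp
  \<comment> \<open>At this time the growth factor \<open>exp (\<bar>M\<bar> + 1)\<close> exceeds \<open>M\<close>.\<close>
  define t where "t = (\<bar>M\<bar> + 1) / (Re (ev n) + \<omega>)"
  have t: "0 \<le> t" unfolding t_def using pos by simp
  have "exp (Re (ev n) * t) * norm (\<phi> (n, 1)) \<le> M * exp (- \<omega> * t) * norm (\<phi> (n, 1))"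
    using stable[OF t, of "\<phi> (n, 1)"] unfolding T_eigenvector[OF t] norm_scaleC by (simp add: norm_exp_eq_Re)
  then have "exp (Re (ev n) * t) \<le> M * exp (- \<omega> * t)" using nz by (rule mult_right_le_imp_le)
  then have "exp (\<omega> * t) * exp (Re (ev n) * t) \<le> exp (\<omega> * t) * (M * exp (- \<omega> * t))"
    by (rule mult_left_mono) simp
  then have "exp ((Re (ev n) + \<omega>) * t) \<le> M" by (simp add: exp_add[symmetric] algebra_simps exp_minus)
  moreover have "(Re (ev n) + \<omega>) * t = \<bar>M\<bar> + 1" unfolding t_def using pos by simp
  ultimately have "exp (\<bar>M\<bar> + 1) \<le> M" by simp
  then show False using exp_ge_add_one_self[of "\<bar>M\<bar> + 1"] by linarith
qed

text \<open>On the simple eigenvectors the semigroup is diagonal and contracts the weighted norm. The finitely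
  many remaining vectors contribute an operator of finite rank, for which the decay in \<open>H\<close> suffices.\<close>

lemma norm_T_finite_sum:
  "\<exists>C>0. \<forall>F a t. finite F \<longrightarrow> 0 \<le> t \<longrightarrow>
    norm (\<iota> (T t (comb F a))) \<le> C * exp (- \<omega> * t) * norm (\<iota> (comb F a))"
proof -
  obtain Ki where Ki: "0 < Ki" "\<And>x. norm (\<iota> x) \<le> norm x * Ki"
    using bounded_linear.pos_bounded[OF \<iota>_linear] by blast
  let ?F0 = multiple_indices
  define r where "r m = \<bar>M\<bar> * norm (\<psi> m) * Ki / sqrt (weight m)" for m
  \<comment> \<open>\<open>1\<close> for the diagonal part, \<open>r m\<close> for each vector of a nontrivial block.\<close>
  define C where "C = 1 + (\<Sum>m\<in>?F0. r m)"
  have r_nonneg: "0 \<le> r m" for m unfolding r_def using Ki weight_pos[of m] by simp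
  have "0 \<le> (\<Sum>m\<in>?F0. r m)" by (intro sum_nonneg r_nonneg)
  then have C: "0 < C" unfolding C_def by simp
  have "norm (\<iota> (T t (comb F a))) \<le> C * exp (- \<omega> * t) * norm (\<iota> (comb F a))"
    if F: "finite F" and t: "0 \<le> t" for F a t
  proof -
    let ?n = "norm (\<iota> (comb F a))" and ?E = "exp (- \<omega> * t)"
    let ?g = "\<lambda>m. a m * exp (ev (fst (e m)) * of_real t)"
    have simple: "T t (\<psi> m) = exp (ev (fst (e m)) * of_real t) *\<^sub>C \<psi> m" if m: "m \<notin> ?F0" for m
    proof -
      have "e m = (fst (e m), 1)"
        using e_in[of m] m unfolding jordan_index_def multiple_indices_def by (cases "e m") auto
      then show ?thesis unfolding \<psi>_def using T_eigenvector[OF t, of "fst (e m)"] by metis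
    qed
    have "T t (comb F a) = (\<Sum>m\<in>F. a m *\<^sub>C T t (\<psi> m))"
      by (rule bounded_clinear_sum[OF T_clinear[OF t]])
    also have "\<dots> = (\<Sum>m\<in>F - ?F0. a m *\<^sub>C T t (\<psi> m)) + (\<Sum>m\<in>F \<inter> ?F0. a m *\<^sub>C T t (\<psi> m))"
      using F by (subst sum.Int_Diff[where B = ?F0]) (auto simp: add.commute)
    also have "(\<Sum>m\<in>F - ?F0. a m *\<^sub>C T t (\<psi> m)) = comb (F - ?F0) ?g"
      by (intro sum.cong refl) (simp add: simple scaleC_scaleC)
    finally have split: "\<iota> (T t (comb F a)) =
        \<iota> (comb (F - ?F0) ?g) + \<iota> (\<Sum>m\<in>F \<inter> ?F0. a m *\<^sub>C T t (\<psi> m))"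
      using linear_add[OF bounded_linear.linear[OF \<iota>_linear]] by simp
    have simple_le: "norm (\<iota> (comb (F - ?F0) ?g)) \<le> ?E * ?n"
    proof (rule power2_le_imp_le)
      have decay: "(cmod (?g m))\<^sup>2 \<le> ?E\<^sup>2 * (cmod (a m))\<^sup>2" for m
      proof -
        have "exp (Re (ev (fst (e m))) * t) \<le> ?E"
          using mult_right_mono[OF Re_eigenvalue_le t, of "fst (e m)"] by simp
        then have "cmod (?g m) \<le> ?E * cmod (a m)"
          by (simp add: norm_mult norm_exp_eq_Re mult.commute mult_left_mono)
        then have "(cmod (?g m))\<^sup>2 \<le> (?E * cmod (a m))\<^sup>2" by (intro power_mono) auto
        then show ?thesis by (simp only: power_mult_distrib)
      qed
      have "(norm (\<iota> (comb (F - ?F0) ?g)))\<^sup>2 = (\<Sum>m\<in>F - ?F0. (cmod (?g m))\<^sup>2 * weight m)"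
        using F by (intro norm_\<iota>_sum) simp
      also have "\<dots> \<le> (\<Sum>m\<in>F - ?F0. ?E\<^sup>2 * (cmod (a m))\<^sup>2 * weight m)"
        using weight_pos by (intro sum_mono mult_right_mono decay) (auto simp: less_imp_le)
      also have "\<dots> \<le> (\<Sum>m\<in>F. ?E\<^sup>2 * (cmod (a m))\<^sup>2 * weight m)"
        using F weight_pos by (intro sum_mono2) (auto simp: less_imp_le)
      also have "\<dots> = ?E\<^sup>2 * ?n\<^sup>2"
        unfolding norm_\<iota>_sum[OF F] by (simp add: sum_distrib_left mult.assoc)
      finally show "(norm (\<iota> (comb (F - ?F0) ?g)))\<^sup>2 \<le> (?E * ?n)\<^sup>2"
        by (simp only: power_mult_distrib)
    qed simp
    have multiple_le: "norm (\<iota> (\<Sum>m\<in>F \<inter> ?F0. a m *\<^sub>C T t (\<psi> m))) \<le> (\<Sum>m\<in>?F0. r m) * (?E * ?n)"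
    proof -
      have "norm (\<iota> (\<Sum>m\<in>F \<inter> ?F0. a m *\<^sub>C T t (\<psi> m))) = norm (\<Sum>m\<in>F \<inter> ?F0. a m *\<^sub>C \<iota> (T t (\<psi> m)))"
        unfolding bounded_clinear_sum[OF \<iota>_clinear] ..
      also have "\<dots> \<le> (\<Sum>m\<in>F \<inter> ?F0. r m * (?E * ?n))"
      proof (rule sum_norm_le)
        fix m assume m: "m \<in> F \<inter> ?F0"
        have "(cmod (a m))\<^sup>2 * weight m = (\<Sum>k\<in>{m}. (cmod (a k))\<^sup>2 * weight k)" by simp
        also have "\<dots> \<le> (\<Sum>k\<in>F. (cmod (a k))\<^sup>2 * weight k)"
          using m F weight_pos by (intro sum_mono2) (auto simp: less_imp_le)
        finally have "(cmod (a m))\<^sup>2 * weight m \<le> ?n\<^sup>2" unfolding norm_\<iota>_sum[OF F] .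
        then have "sqrt ((cmod (a m))\<^sup>2 * weight m) \<le> sqrt (?n\<^sup>2)" by (rule real_sqrt_le_mono)
        then have a_le: "cmod (a m) \<le> ?n / sqrt (weight m)"
          using weight_pos[of m] by (simp add: real_sqrt_mult pos_le_divide_eq)
        have "norm (T t (\<psi> m)) \<le> \<bar>M\<bar> * ?E * norm (\<psi> m)"
          using stable[OF t, of "\<psi> m"] by (rule order_trans) (intro mult_right_mono, auto)
        then have "norm (T t (\<psi> m)) * Ki \<le> \<bar>M\<bar> * ?E * norm (\<psi> m) * Ki" using Ki(1) by (intro mult_right_mono) auto
        then have "norm (\<iota> (T t (\<psi> m))) \<le> \<bar>M\<bar> * ?E * norm (\<psi> m) * Ki" using Ki(2)[of "T t (\<psi> m)"] by linarith
        then have "cmod (a m) * norm (\<iota> (T t (\<psi> m))) \<le> ?n / sqrt (weight m) * (\<bar>M\<bar> * ?E * norm (\<psi> m) * Ki)"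
          using a_le weight_pos[of m] by (intro mult_mono) auto
        then show "norm (a m *\<^sub>C \<iota> (T t (\<psi> m))) \<le> r m * (?E * ?n)"
          unfolding norm_scaleC r_def by (simp add: mult_ac)
      qed
      also have "\<dots> \<le> (\<Sum>m\<in>?F0. r m * (?E * ?n))"
        using finite_multiple_indices r_nonneg by (intro sum_mono2) auto
      finally show ?thesis by (simp only: sum_distrib_right)
    qed
    have "norm (\<iota> (T t (comb F a))) \<le> ?E * ?n + (\<Sum>m\<in>?F0. r m) * (?E * ?n)"
      unfolding split by (rule norm_triangle_le[OF add_mono[OF simple_le multiple_le]])
    also have "\<dots> = C * ?E * ?n" unfolding C_def by (simp add: algebra_simps)
    finally show ?thesis .
  qed
  with C show ?thesis by blast
qed

text \<open>The extension to the whole of the extended space agrees with \<open>T t\<close> on all of \<open>H\<close>, as finite sums are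
  dense in \<open>H\<close> too.\<close>

lemma extension_exists:
  assumes t: "0 \<le> t" and bound: "\<And>x. x \<in> finite_sums \<Longrightarrow> norm (\<iota> (T t x)) \<le> C * norm (\<iota> x)"
  shows "\<exists>S. bounded_clinear S \<and> (\<forall>x. S (\<iota> x) = \<iota> (T t x)) \<and> (\<forall>k. norm (S k) \<le> C * norm k)"
proof -
  define G where "G = (\<lambda>x. (\<iota> x, \<iota> (T t x))) ` finite_sums"
  have span: "x + y \<in> finite_sums" "c *\<^sub>R x \<in> finite_sums" if xy: "x \<in> finite_sums" "y \<in> finite_sums" for x y c
  proof -
    obtain F a F' a' where *: "finite F" "x = comb F a" "finite F'" "y = comb F' a'"
      using xy unfolding finite_sums_def by blast
    show "x + y \<in> finite_sums"
      unfolding *(2,4) finite_sums_common[OF *(1,3)] by (rule finite_sumsI) (simp add: *)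
    have "c *\<^sub>R x = comb F (\<lambda>m. of_real c * a m)"
      unfolding * scaleR_scaleC by (simp add: scaleC_sum_right scaleC_scaleC)
    then show "c *\<^sub>R x \<in> finite_sums" using finite_sumsI[OF *(1)] by simp
  qed
  have lin: "bounded_linear (\<lambda>x. \<iota> (T t x))" by (rule bounded_linear_compose[OF \<iota>_linear T_linear[OF t]])
  have add: "(x + x', y + y') \<in> G" if "(x, y) \<in> G" "(x', y') \<in> G" for x y x' y'
  proof -
    obtain p q where "p \<in> finite_sums" "q \<in> finite_sums" "x = \<iota> p" "y = \<iota> (T t p)" "x' = \<iota> q" "y' = \<iota> (T t q)"
      using \<open>(x, y) \<in> G\<close> \<open>(x', y') \<in> G\<close> unfolding G_def by blast
    then show ?thesis unfolding G_def using span(1)[of p q]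
        linear_add[OF bounded_linear.linear[OF \<iota>_linear], of p q] linear_add[OF bounded_linear.linear[OF lin], of p q]
      by (intro image_eqI[of _ _ "p + q"]) auto
  qed
  have scale: "(c *\<^sub>R x, c *\<^sub>R y) \<in> G" if "(x, y) \<in> G" for c x y
  proof -
    obtain p where "p \<in> finite_sums" "x = \<iota> p" "y = \<iota> (T t p)"
      using \<open>(x, y) \<in> G\<close> unfolding G_def by blast
    then show ?thesis unfolding G_def using span(2)[of p p c]
        linear_scale[OF bounded_linear.linear[OF \<iota>_linear], of c p] linear_scale[OF bounded_linear.linear[OF lin], of c p]
      by (intro image_eqI[of _ _ "c *\<^sub>R p"]) auto
  qed
  have bound_G: "norm y \<le> C * norm x" if "(x, y) \<in> G" for x y
    using that bound unfolding G_def by auto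
  have "fst ` G = \<iota> ` finite_sums" unfolding G_def by (simp add: image_image)
  then have dense: "closure (fst ` G) = UNIV" by (simp add: closure_\<iota>_finite_sums)
  obtain S where S: "bounded_linear S" "\<And>x y. (x, y) \<in> G \<Longrightarrow> S x = y" "\<And>k. norm (S k) \<le> C * norm k"
    using bounded_linear_extension[OF add scale bound_G dense] by blast
  have S_\<iota>: "S (\<iota> x) = \<iota> (T t x)" for x
    by (rule equal_on_finite_sums[OF bounded_linear_compose[OF S(1) \<iota>_linear] lin])
      (rule S(2), simp add: G_def)
  have S_scaleC: "S (c *\<^sub>C k) = c *\<^sub>C S k" for c k
  proof (rule equal_on_\<iota>_finite_sums[where f = "\<lambda>k. S (c *\<^sub>C k)" and g = "\<lambda>k. c *\<^sub>C S k"])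
    note right = bounded_bilinear.bounded_linear_right[OF bounded_bilinear_scaleC, of c]
    show "bounded_linear (\<lambda>k. S (c *\<^sub>C k))" by (rule bounded_linear_compose[OF S(1) right])
    show "bounded_linear (\<lambda>k. c *\<^sub>C S k)" by (rule bounded_linear_compose[OF right S(1)])
    show "S (c *\<^sub>C \<iota> x) = c *\<^sub>C S (\<iota> x)" for x
      unfolding bounded_clinearD(2)[OF \<iota>_clinear, symmetric] S_\<iota> bounded_clinearD(2)[OF T_clinear[OF t]] ..
  qed
  show ?thesis using S(1,3) S_\<iota> S_scaleC unfolding bounded_clinear_def by blast
qed

definition T_ext :: "real \<Rightarrow> 'k \<Rightarrow> 'k" where "T_ext t = extend_op \<iota> (T t)"

text \<open>The semigroup on the extended space inherits the exponential decay, which makes the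
  controllability integral converge for all square-integrable inputs.\<close>

lemma T_ext_extends:
  "\<exists>C>0. \<forall>t\<ge>0. bounded_clinear (T_ext t) \<and> (\<forall>x. T_ext t (\<iota> x) = \<iota> (T t x)) \<and>
    (\<forall>k. norm (T_ext t k) \<le> C * exp (- \<omega> * t) * norm k)"
proof -
  obtain C where C: "0 < C" "\<And>F a t. finite F \<Longrightarrow> 0 \<le> t \<Longrightarrow>
    norm (\<iota> (T t (comb F a))) \<le> C * exp (- \<omega> * t) * norm (\<iota> (comb F a))"
    using norm_T_finite_sum by blast
  have "bounded_clinear (T_ext t) \<and> (\<forall>x. T_ext t (\<iota> x) = \<iota> (T t x)) \<and>
      (\<forall>k. norm (T_ext t k) \<le> C * exp (- \<omega> * t) * norm k)" if t: "0 \<le> t" for t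
  proof -
    have bound: "norm (\<iota> (T t x)) \<le> C * exp (- \<omega> * t) * norm (\<iota> x)" if "x \<in> finite_sums" for x
      using that C(2)[OF _ t] unfolding finite_sums_def by blast
    from extension_exists[OF t bound] obtain S where S: "bounded_clinear S" "\<And>x. S (\<iota> x) = \<iota> (T t x)"
      "\<And>k. norm (S k) \<le> C * exp (- \<omega> * t) * norm k" by blast
    have "T_ext t = S" unfolding T_ext_def extend_op_def
    proof (rule the_equality)
      fix S' assume S': "bounded_clinear S' \<and> (\<forall>x. S' (\<iota> x) = \<iota> (T t x))"
      show "S' = S"
        using equal_on_\<iota>_finite_sums[of S' S] S' S bounded_clinearD(1) by (intro ext) auto
    qed (use S in auto)
    then show ?thesis using S by simp
  qed
  then show ?thesis using C(1) by blast
qed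

definition control_vector :: 'k
  where "control_vector = (\<Sum>\<^sub>\<infinity>i\<in>jordan_index N. b i *\<^sub>C \<iota> (\<phi> i))"

text \<open>The weights of the extended space are chosen for this: the \<open>m\<close>-th term has norm at most
  \<open>1 / (m + 1)\<close>.\<close>

lemma control_vector_tendsto: "(\<lambda>n. \<iota> (comb {..<n} \<beta>)) \<longlonglongrightarrow> control_vector"
proof -
  obtain s where s: "((\<lambda>m. \<beta> m *\<^sub>C \<iota> (\<psi> m)) has_sum s) UNIV"
  proof (rule has_sum_of_square_bound[of "\<lambda>m. \<beta> m *\<^sub>C \<iota> (\<psi> m)" "\<lambda>m. 1 / (real (Suc m))\<^sup>2"])
    show "(norm (\<Sum>m\<in>F. \<beta> m *\<^sub>C \<iota> (\<psi> m)))\<^sup>2 \<le> (\<Sum>m\<in>F. 1 / (real (Suc m))\<^sup>2)" if "finite F" for F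
    proof -
      have le: "(cmod (\<beta> m))\<^sup>2 * weight m \<le> 1 / (real (Suc m))\<^sup>2" for m
      proof -
        have "(cmod (\<beta> m))\<^sup>2 / (1 + (cmod (\<beta> m))\<^sup>2) \<le> 1"
          by (subst pos_divide_le_eq) (auto intro: add_pos_nonneg)
        then have "1 / (real (Suc m))\<^sup>2 * ((cmod (\<beta> m))\<^sup>2 / (1 + (cmod (\<beta> m))\<^sup>2)) \<le> 1 / (real (Suc m))\<^sup>2 * 1"
          by (intro mult_left_mono) auto
        then show ?thesis unfolding weight_def by (simp add: mult_ac)
      qed
      show ?thesis
        unfolding bounded_clinear_sum[OF \<iota>_clinear, symmetric] norm_\<iota>_sum[OF that] by (intro sum_mono le)
    qed
    have "summable (\<lambda>m. inverse ((real m)\<^sup>2))" by (rule inverse_power_summable) simp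
    then show "summable (\<lambda>m. 1 / (real (Suc m))\<^sup>2)"
      by (subst (asm) summable_Suc_iff[symmetric]) (simp add: inverse_eq_divide)
  qed auto
  have "control_vector = (\<Sum>\<^sub>\<infinity>m. \<beta> m *\<^sub>C \<iota> (\<psi> m))"
    unfolding control_vector_def \<beta>_def \<psi>_def by (rule infsum_reindex_bij_betw[OF enumeration, symmetric])
  also have "\<dots> = s" using s by (rule infsumI)
  finally have "(\<lambda>m. \<beta> m *\<^sub>C \<iota> (\<psi> m)) sums control_vector" using has_sum_imp_sums[OF s] by simp
  then show ?thesis unfolding sums_def bounded_clinear_sum[OF \<iota>_clinear] .
qed

lemma control_op_eq: "control_op \<iota> (jordan_index N) \<phi> b z = z *\<^sub>C control_vector"
  unfolding control_op_def control_vector_def ..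

lemma T_ext_control_vector_tendsto:
  assumes t: "0 \<le> t"
  shows "(\<lambda>n. \<iota> (T t (comb {..<n} \<beta>))) \<longlonglongrightarrow> T_ext t control_vector"
proof -
  have C: "bounded_clinear (T_ext t)" "\<And>x. T_ext t (\<iota> x) = \<iota> (T t x)" using T_ext_extends t by blast+
  have "(\<lambda>n. T_ext t (\<iota> (comb {..<n} \<beta>))) \<longlonglongrightarrow> T_ext t control_vector"
    by (rule bounded_linear.tendsto[OF bounded_clinearD(1)[OF C(1)] control_vector_tendsto])
  then show ?thesis unfolding C(2) .
qed

lemma T_ext_control_vector_measurable: "(\<lambda>t. T_ext t control_vector) \<in> borel_measurable halfline"
proof (rule borel_measurable_LIMSEQ_metric)
  show "(\<lambda>t. \<iota> (T t (comb {..<n} \<beta>))) \<in> borel_measurable halfline" for n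
  proof -
    have "continuous_on {0<..} (\<lambda>t. T t (\<psi> m))" for m
      unfolding continuous_on_eq_continuous_at[OF open_greaterThan] \<psi>_def
      using T_differentiable[OF e_in] by auto
    then have "continuous_on {0<..} (\<lambda>t. \<Sum>m<n. \<beta> m *\<^sub>C \<iota> (T t (\<psi> m)))"
      by (intro continuous_on_sum bounded_bilinear.continuous_on[OF bounded_bilinear_scaleC] continuous_on_const
          bounded_linear.continuous_on[OF \<iota>_linear])
    moreover have "\<iota> (T t (comb {..<n} \<beta>)) = (\<Sum>m<n. \<beta> m *\<^sub>C \<iota> (T t (\<psi> m)))" if "t \<in> {0<..}" for t
      using that by (simp add: bounded_clinear_sum[OF T_clinear] bounded_clinear_sum[OF \<iota>_clinear])
    ultimately have "continuous_on {0<..} (\<lambda>t. \<iota> (T t (comb {..<n} \<beta>)))"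
      by (rule continuous_on_eq[OF _ sym])
    then have "(\<lambda>t. \<iota> (T t (comb {..<n} \<beta>))) \<in> borel_measurable (restrict_space borel {0<..})"
      by (rule borel_measurable_continuous_on_restrict)
    then show ?thesis
      by (simp add: measurable_cong_sets[OF sets_restrict_space_cong[OF sets_lborel] refl])
  qed
  show "(\<lambda>n. \<iota> (T t (comb {..<n} \<beta>))) \<longlonglongrightarrow> T_ext t control_vector" if "t \<in> space halfline" for t
    using that by (intro T_ext_control_vector_tendsto) (simp add: space_restrict_space)
qed

lemma coordinate_T_basis:
  assumes t: "0 \<le> t" and m: "e m = (n, l)"
  shows "coordinate m (\<iota> (T t (\<psi> k))) =
    (if fst (e k) = n \<and> l \<le> snd (e k) then exp (ev n * of_real t) * of_real (t ^ (snd (e k) - l)) / fact (snd (e k) - l) else 0)"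
proof -
  obtain n' j where k: "e k = (n', j)" by (cases "e k")
  have j: "1 \<le> j" "j \<le> N n'" using e_in[of k] unfolding k jordan_index_def by auto
  have l: "1 \<le> l" using e_in[of m] unfolding m jordan_index_def by auto
  let ?c = "\<lambda>i. exp (ev n' * of_real t) * of_real (t ^ (j - i)) / fact (j - i)"
  interpret lin: bounded_linear "coordinate m" by (rule coordinate_linear)
  have basis_coord: "coordinate m (\<iota> (\<phi> (n', i))) = (if n' = n \<and> i = l then 1 else 0)" if i: "i \<in> {1..j}" for i
  proof -
    have "(n', i) \<in> jordan_index N" using i j unfolding jordan_index_def by auto
    then obtain k' where k': "e k' = (n', i)" using e_surj by blast
    have "m = k' \<longleftrightarrow> n' = n \<and> i = l" using e_inj[of m k'] unfolding m k' by auto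
    then show ?thesis using coordinate_basis[of m k'] unfolding \<psi>_def k' by simp
  qed
  have "coordinate m (\<iota> (T t (\<psi> k))) = (\<Sum>i\<in>{1..j}. ?c i * coordinate m (\<iota> (\<phi> (n', i))))"
    unfolding \<psi>_def k T_flow[OF j t] jordan_flow_def bounded_clinear_sum[OF \<iota>_clinear] lin.sum coordinate_scaleC ..
  also have "\<dots> = (\<Sum>i\<in>{1..j}. if i = l then (if n' = n then ?c l else 0) else 0)"
    using basis_coord by (intro sum.cong refl) auto
  also have "\<dots> = (if n' = n \<and> l \<le> j then ?c l else 0)" using l by simp
  finally show ?thesis unfolding k by auto
qed

lemma coordinate_T_ext_control_vector:
  assumes t: "0 \<le> t" and m: "e m = (n, l)"
  shows "coordinate m (T_ext t control_vector) =
    (\<Sum>j\<in>{l..N n}. b (n, j) * (exp (ev n * of_real t) * of_real (t ^ (j - l)) / fact (j - l)))"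
proof -
  let ?c = "\<lambda>j. b (n, j) * (exp (ev n * of_real t) * of_real (t ^ (j - l)) / fact (j - l))"
  interpret lin: bounded_linear "coordinate m" by (rule coordinate_linear)
  have l: "1 \<le> l" using e_in[of m] unfolding m jordan_index_def by auto
  let ?J = "{k. fst (e k) = n \<and> l \<le> snd (e k)}"
  have bij: "bij_betw (\<lambda>k. snd (e k)) ?J {l..N n}"
  proof (rule bij_betw_imageI)
    show "inj_on (\<lambda>k. snd (e k)) ?J"
    proof (rule inj_onI)
      fix k k' assume "k \<in> ?J" "k' \<in> ?J" "snd (e k) = snd (e k')"
      then have "e k = e k'" by (simp add: prod_eq_iff)
      then show "k = k'" by (simp add: e_inj)
    qed
    show "(\<lambda>k. snd (e k)) ` ?J = {l..N n}"
    proof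
      show "(\<lambda>k. snd (e k)) ` ?J \<subseteq> {l..N n}"
      proof clarify
        fix k assume "l \<le> snd (e k)" "n = fst (e k)"
        then show "snd (e k) \<in> {l..N (fst (e k))}"
          using e_in[of k] unfolding jordan_index_def by (cases "e k") auto
      qed
      show "{l..N n} \<subseteq> (\<lambda>k. snd (e k)) ` ?J"
      proof
        fix j assume j: "j \<in> {l..N n}"
        then have "(n, j) \<in> jordan_index N" using l unfolding jordan_index_def by auto
        then obtain k where "e k = (n, j)" using e_surj by blast
        then show "j \<in> (\<lambda>k. snd (e k)) ` ?J" using j by (intro image_eqI[of _ _ k]) auto
      qed
    qed
  qed
  have finJ: "finite ?J" using bij_betw_finite[OF bij] by simp
  then obtain L where L: "?J \<subseteq> {..<L}" using finite_nat_iff_bounded by blast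
  have partial: "coordinate m (\<iota> (T t (comb {..<K} \<beta>))) = (\<Sum>j\<in>{l..N n}. ?c j)" if K: "L \<le> K" for K
  proof -
    have "coordinate m (\<iota> (T t (comb {..<K} \<beta>))) = (\<Sum>k<K. \<beta> k * coordinate m (\<iota> (T t (\<psi> k))))"
      unfolding bounded_clinear_sum[OF T_clinear[OF t]] bounded_clinear_sum[OF \<iota>_clinear] lin.sum coordinate_scaleC ..
    also have "\<dots> = (\<Sum>k\<in>?J. ?c (snd (e k)))"
    proof (rule sum.mono_neutral_cong_right)
      show "?J \<subseteq> {..<K}" using L K by auto
      show "\<forall>k\<in>{..<K} - ?J. \<beta> k * coordinate m (\<iota> (T t (\<psi> k))) = 0"
        by (auto simp: coordinate_T_basis[OF t m])
      show "\<beta> k * coordinate m (\<iota> (T t (\<psi> k))) = ?c (snd (e k))" if "k \<in> ?J" for k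
      proof -
        have "e k = (n, snd (e k))" using that by (simp add: prod_eq_iff)
        then have "\<beta> k = b (n, snd (e k))" unfolding \<beta>_def by simp
        then show ?thesis using that by (simp add: coordinate_T_basis[OF t m])
      qed
    qed simp
    also have "\<dots> = (\<Sum>j\<in>{l..N n}. ?c j)" by (rule sum.reindex_bij_betw[OF bij])
    finally show ?thesis .
  qed
  have "(\<lambda>K. coordinate m (\<iota> (T t (comb {..<K} \<beta>)))) \<longlonglongrightarrow> coordinate m (T_ext t control_vector)"
    by (rule lin.tendsto[OF T_ext_control_vector_tendsto[OF t]])
  moreover have "(\<lambda>K. coordinate m (\<iota> (T t (comb {..<K} \<beta>)))) \<longlonglongrightarrow> (\<Sum>j\<in>{l..N n}. ?c j)"
    by (rule tendsto_eventually[OF eventually_mono[OF eventually_ge_at_top[of L] partial]])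
  ultimately show ?thesis by (rule LIMSEQ_unique)
qed
end

section \<open>The controllability operator as a moment map\<close>

context extended_jordan_system
begin

abbreviation z :: "nat \<Rightarrow> complex" where "z \<equiv> \<lambda>n. - ev n"

lemma z_pos: "0 < Re (z n)"
  using Re_eigenvalue_le[of n] \<omega> by simp

lemma control_integrand_integrable:
  assumes u: "u \<in> L2 halfline"
  shows "integrable halfline (\<lambda>s. u s *\<^sub>C T_ext s control_vector)"
proof -
  obtain C where C: "0 < C" "\<And>t k. 0 \<le> t \<Longrightarrow> norm (T_ext t k) \<le> C * exp (- \<omega> * t) * norm k"
    using T_ext_extends by blast
  let ?g = "\<lambda>s. C * norm control_vector * norm (u s * exp (- (of_real \<omega> * of_real s)))"
  show ?thesis
  proof (rule Bochner_Integration.integrable_bound)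
    have "(\<lambda>s. exp (- (complex_of_real \<omega> * of_real s))) \<in> L2 halfline"
      using \<omega> by (intro exp_L2_halfline) simp
    then show "integrable halfline ?g"
      using u by (intro integrable_mult_right integrable_norm L2_integrable_mult)
    have "continuous_on UNIV (\<lambda>p :: complex \<times> 'k. fst p *\<^sub>C snd p)"
      by (intro bounded_bilinear.continuous_on[OF bounded_bilinear_scaleC] continuous_intros)
    then show "(\<lambda>s. u s *\<^sub>C T_ext s control_vector) \<in> borel_measurable halfline"
      by (intro borel_measurable_continuous_Pair[OF L2_measurable[OF u] T_ext_control_vector_measurable])
    show "AE s in halfline. norm (u s *\<^sub>C T_ext s control_vector) \<le> norm (?g s)"
    proof (rule AE_I2)
      fix s assume "s \<in> space halfline"
      then have s: "0 \<le> s" by (simp add: space_restrict_space)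
      have "cmod (u s) * norm (T_ext s control_vector) \<le> cmod (u s) * (C * exp (- \<omega> * s) * norm control_vector)"
        by (intro mult_left_mono C(2)[OF s]) simp
      also have "\<dots> = ?g s" by (simp add: norm_mult norm_exp_eq_Re)
      also have "\<dots> \<le> norm (?g s)" by simp
      finally show "norm (u s *\<^sub>C T_ext s control_vector) \<le> norm (?g s)" by (simp only: norm_scaleC)
    qed
  qed
qed

lemma controllability_op_eq:
  "controllability_op (\<lambda>s. extend_op \<iota> (T s)) (control_op \<iota> (jordan_index N) \<phi> b) u =
    (\<integral>s. u s *\<^sub>C T_ext s control_vector \<partial>halfline)"
  unfolding controllability_op_def control_op_eq integral_halfline_eq[symmetric] T_ext_def[symmetric]
proof (rule Bochner_Integration.integral_cong[OF refl])
  fix s assume "s \<in> space halfline"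
  then have "0 \<le> s" by (simp add: space_restrict_space)
  then have "bounded_clinear (T_ext s)" using T_ext_extends by blast
  then show "T_ext s (u s *\<^sub>C control_vector) = u s *\<^sub>C T_ext s control_vector"
    by (rule bounded_clinearD(2))
qed

lemma coordinate_controllability_op:
  assumes u: "u \<in> L2 halfline"
  shows "coordinate m (\<integral>s. u s *\<^sub>C T_ext s control_vector \<partial>halfline) = block_output N b z u (e m)"
proof -
  obtain n l where m: "e m = (n, l)" by (cases "e m")
  let ?k = "\<lambda>j s. of_real (s ^ (j - l)) * exp (- (z n * of_real s)) * u s"
  have "coordinate m (\<integral>s. u s *\<^sub>C T_ext s control_vector \<partial>halfline) =
      (\<integral>s. coordinate m (u s *\<^sub>C T_ext s control_vector) \<partial>halfline)"
    by (rule integral_bounded_linear[OF coordinate_linear control_integrand_integrable[OF u], symmetric])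
  also have "\<dots> = (\<integral>s. (\<Sum>j\<in>{l..N n}. b (n, j) / fact (j - l) * ?k j s) \<partial>halfline)"
  proof (rule Bochner_Integration.integral_cong[OF refl])
    fix s assume "s \<in> space halfline"
    then have s: "0 \<le> s" by (simp add: space_restrict_space)
    show "coordinate m (u s *\<^sub>C T_ext s control_vector) = (\<Sum>j\<in>{l..N n}. b (n, j) / fact (j - l) * ?k j s)"
      unfolding coordinate_scaleC coordinate_T_ext_control_vector[OF s m] sum_distrib_left
      by (intro sum.cong refl) (simp add: mult_ac)
  qed
  also have "\<dots> = (\<Sum>j\<in>{l..N n}. \<integral>s. b (n, j) / fact (j - l) * ?k j s \<partial>halfline)"
    by (intro Bochner_Integration.integral_sum integrable_mult_right moment_integrable u z_pos)
  also have "\<dots> = block_output N b z u (e m)"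
    unfolding m block_output_def prod.case moment_def by (intro sum.cong refl integral_mult_right_zero)
  finally show ?thesis .
qed

text \<open>Coordinates are bounded functionals, so they may be taken inside the integral, and they
  separate the points of the extended space.\<close>

lemma exactly_controllable_iff:
  "exactly_controllable \<iota> T (control_op \<iota> (jordan_index N) \<phi> b) \<longleftrightarrow>
    (\<forall>x. \<exists>u\<in>L2 halfline. \<forall>m. block_output N b z u (e m) = coordinate m (\<iota> x))"
proof -
  have eq: "\<iota> x = controllability_op (\<lambda>s. extend_op \<iota> (T s)) (control_op \<iota> (jordan_index N) \<phi> b) u \<longleftrightarrow>
      (\<forall>m. block_output N b z u (e m) = coordinate m (\<iota> x))" if "u \<in> L2 halfline" for x u
    unfolding controllability_op_eq coordinate_controllability_op[OF that, symmetric]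
    using coordinate_eqI[of "\<iota> x"] by metis
  have "exactly_controllable \<iota> T (control_op \<iota> (jordan_index N) \<phi> b) \<longleftrightarrow> (\<forall>x. \<exists>u\<in>L2 halfline.
      \<iota> x = controllability_op (\<lambda>s. extend_op \<iota> (T s)) (control_op \<iota> (jordan_index N) \<phi> b) u)"
    unfolding exactly_controllable_def L2_halfline_eq by blast
  then show ?thesis by (simp add: eq cong: bex_cong)
qed

lemma block_end_index:
  obtains top where "\<And>n. e (top n) = (n, N n)" "inj top"
proof -
  have "\<forall>n. \<exists>m. e m = (n, N n)"
    using block_size e_surj by (simp add: jordan_index_def)
  then obtain top where top: "\<And>n. e (top n) = (n, N n)" by metis
  then have "inj top" by (metis injI prod.inject)
  with top show thesis by (rule that)
qed

text \<open>The coordinates at the ends of the blocks form a moment problem with simple nodes.\<close>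

lemma lower_bound_of_controllability:
  assumes "exactly_controllable \<iota> T (control_op \<iota> (jordan_index N) \<phi> b)"
  shows "riesz_lower_bound z (\<lambda>n. b (n, N n))"
proof -
  obtain top where top: "\<And>n. e (top n) = (n, N n)" "inj top" by (rule block_end_index) blast
  obtain C where C: "0 < C"
    "\<And>F a. finite F \<Longrightarrow> (norm (comb F a))\<^sup>2 \<le> C * (\<Sum>m\<in>F. (cmod (a m))\<^sup>2)"
    using riesz_constants by blast
  show ?thesis
  proof (rule lower_bound_of_interpolation[of z "\<lambda>n x. coordinate (top n) (\<iota> x)" _ C])
    show "0 < Re (z n)" for n by (rule z_pos)
    show "bounded_linear (\<lambda>x. coordinate (top n) (\<iota> x))" for n by (rule coordinate_\<iota>_linear)
    show "\<exists>u\<in>L2 halfline. \<forall>n. b (n, N n) * moment 0 (z n) u = coordinate (top n) (\<iota> x)" for x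
    proof -
      obtain u where u: "u \<in> L2 halfline" "\<And>m. block_output N b z u (e m) = coordinate m (\<iota> x)"
        using assms unfolding exactly_controllable_iff by blast
      have "b (n, N n) * moment 0 (z n) u = coordinate (top n) (\<iota> x)" for n
        using u(2)[of "top n"] unfolding top(1) block_output_top .
      with u(1) show ?thesis by blast
    qed
    show "\<exists>x. (norm x)\<^sup>2 \<le> C * (\<Sum>n<K. (cmod (a n))\<^sup>2) \<and> (\<forall>n<K. coordinate (top n) (\<iota> x) = a n)" for K a
    proof -
      let ?F = "top ` {..<K}" and ?a = "\<lambda>m. a (fst (e m))"
      let ?x = "comb ?F ?a"
      have "(\<Sum>m\<in>?F. (cmod (?a m))\<^sup>2) = (\<Sum>n<K. (cmod (a n))\<^sup>2)"
        using top by (subst sum.reindex) (auto intro: inj_on_subset)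
      then have "(norm ?x)\<^sup>2 \<le> C * (\<Sum>n<K. (cmod (a n))\<^sup>2)" using C(2)[of ?F ?a] by simp
      moreover have "coordinate (top n) (\<iota> ?x) = a n" if "n < K" for n
        using coordinate_sum[of ?F "top n" ?a] that by (simp add: top(1))
      ultimately show ?thesis by blast
    qed
  qed
qed

lemma controllability_of_lower_bound:
  assumes inj: "inj ev" and lb: "riesz_lower_bound z (\<lambda>n. b (n, N n))"
  shows "exactly_controllable \<iota> T (control_op \<iota> (jordan_index N) \<phi> b)"
  unfolding exactly_controllable_iff
proof
  fix x
  obtain top where top: "\<And>n. e (top n) = (n, N n)" "inj top" by (rule block_end_index) blast
  have inj_z: "inj z" using inj by (auto simp: inj_def)
  define y where "y i = coordinate (inv_into UNIV e i) (\<iota> x)" for i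
  have y_e: "y (e m) = coordinate m (\<iota> x)" for m
    unfolding y_def using e_inj by (simp add: inj_def)
  have "summable ((\<lambda>m. (cmod (coordinate m (\<iota> x)))\<^sup>2) \<circ> top)"
    by (rule summable_reindex[OF coordinate_square_summable top(2)]) simp
  then have y_summable: "summable (\<lambda>n. (cmod (y (n, N n)))\<^sup>2)"
    unfolding top(1)[symmetric] y_e by (simp add: comp_def)
  have simple: "\<exists>u\<in>L2 halfline. \<forall>n. b (n, N n) * moment 0 (z n) u = y n"
    if "summable (\<lambda>n. (cmod (y n))\<^sup>2)" for y
    by (rule interpolation_of_lower_bound[OF inj_z z_pos lb that]) blast
  obtain u where "u \<in> L2 halfline" "\<And>i. i \<in> jordan_index N \<Longrightarrow> block_output N b z u i = y i"
    by (rule block_interpolation[OF inj_z z_pos block_size almost_all_simple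
          riesz_lower_bound_imp_neq_0[OF inj_z z_pos lb] simple y_summable]) auto
  then show "\<exists>u\<in>L2 halfline. \<forall>m. block_output N b z u (e m) = coordinate m (\<iota> x)"
    using e_in y_e by metis
qed

end

lemma control_measure_eq_mcphail:
  "control_measure ev \<beta> = mcphail_measure (\<lambda>n. - ev n) \<beta>"
proof -
  have "cmod ((ev k - ev n) / (ev k + cnj (ev n))) = cmod ((- ev n - - ev k) / (- ev n + cnj (- ev k)))" for k n
  proof -
    have "cmod (ev k + cnj (ev n)) = cmod (cnj (ev k + cnj (ev n)))" by (simp only: complex_mod_cnj)
    also have "\<dots> = cmod (- ev n + cnj (- ev k))"
      using norm_minus_cancel[of "- ev n + cnj (- ev k)"] by (simp add: add.commute)
    finally show ?thesis by (simp add: norm_divide add.commute)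
  qed
  then have "(\<lambda>K. \<Prod>k\<in>{..<K} - {n}. cmod ((ev k - ev n) / (ev k + cnj (ev n)))) =
      partial_dist (\<lambda>n. - ev n) n" for n
    unfolding partial_dist_def by (intro ext prod.cong refl)
  then have "blaschke_dist ev n = dist_limit (\<lambda>n. - ev n) n" for n
    unfolding blaschke_dist_def dist_limit_def by (simp only:)
  then show ?thesis unfolding control_measure_def mcphail_measure_def by simp
qed

theorem theorem3p2:
  fixes T :: "real \<Rightarrow> 'h::complex_hilbert \<Rightarrow> 'h"
    and D :: "'h set" and A :: "'h \<Rightarrow> 'h"
    and ev :: "nat \<Rightarrow> complex" and N :: "nat \<Rightarrow> nat"
    and \<phi> :: "nat \<times> nat \<Rightarrow> 'h" and b :: "nat \<times> nat \<Rightarrow> complex"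
    and e :: "nat \<Rightarrow> nat \<times> nat"
    and \<iota> :: "'h \<Rightarrow> 'k::{complex_banach, second_countable_topology}"
  assumes infinite_dim: "\<forall>S::'h set. finite S \<longrightarrow> cspan S \<noteq> UNIV"
    and semigroup: "C0_semigroup T"
    and stable: "exponentially_stable T"
    and generator: "is_generator D A T"
    and left_half_plane: "\<forall>n. Re (ev n) < 0"
    and distinct_eigenvalues: "inj ev"
    and block_size: "\<forall>n. N n \<ge> 1"
    and almost_all_simple: "finite {n. N n \<noteq> 1}"
    and basis: "riesz_basis (jordan_index N) \<phi>"
    and chains: "\<forall>n. jordan_chain D A (ev n) (N n) (\<lambda>j. \<phi> (n, j))"
    and enumeration: "bij_betw e UNIV (jordan_index N)"
    and extended_space: "is_extended_space (\<phi> \<circ> e) (b \<circ> e) \<iota>"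
  shows "exactly_controllable \<iota> T (control_op \<iota> (jordan_index N) \<phi> b)
    \<longleftrightarrow> carleson_measure (control_measure ev (\<lambda>n. b (n, N n)))"
proof -
  obtain M \<omega> where "0 < \<omega>" "\<And>t x. 0 \<le> t \<Longrightarrow> norm (T t x) \<le> M * exp (- \<omega> * t) * norm x"
    using stable unfolding exponentially_stable_def by blast
  then interpret stable_semigroup T M \<omega>
    using semigroup by unfold_locales
  have gen: "((\<lambda>h. (1 / h) *\<^sub>R (T h (\<phi> (n, j)) - \<phi> (n, j))) \<longlongrightarrow>
      ev n *\<^sub>C \<phi> (n, j) + (if j = 1 then 0 else \<phi> (n, j - 1))) (at_right 0)"
    if j: "j \<in> {1..N n}" for n j
  proof -
    have chain: "jordan_chain D A (ev n) (N n) (\<lambda>j. \<phi> (n, j))" using chains by blast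
    then have "\<phi> (n, j) \<in> D" using j unfolding jordan_chain_def by blast
    then have "((\<lambda>h. (1 / h) *\<^sub>R (T h (\<phi> (n, j)) - \<phi> (n, j))) \<longlongrightarrow> A (\<phi> (n, j))) (at_right 0)"
      using generator unfolding is_generator_def by blast
    moreover have "A (\<phi> (n, j)) = ev n *\<^sub>C \<phi> (n, j) + (if j = 1 then 0 else \<phi> (n, j - 1))"
      using chain j unfolding jordan_chain_def by (cases "j = 1") auto
    ultimately show ?thesis by simp
  qed
  interpret extended_jordan_system T M \<omega> ev N \<phi> b e \<iota>
  proof
    show "T t (\<phi> (n, j)) = jordan_flow (ev n) (\<lambda>j. \<phi> (n, j)) j t" if "1 \<le> j" "j \<le> N n" "0 \<le> t" for n j t
      using T_jordan_chain[of "N n" "\<lambda>j. \<phi> (n, j)" "ev n" j t, OF gen] that by simp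
    show "isCont (\<lambda>t. T t (\<phi> i)) t" if "i \<in> jordan_index N" "0 < t" for i t
    proof -
      obtain n j where i: "i = (n, j)" "j \<in> {1..N n}" using \<open>i \<in> jordan_index N\<close> unfolding jordan_index_def by auto
      show ?thesis
        unfolding i(1) by (rule has_vector_derivative_continuous[OF T_has_vector_derivative[OF gen[OF i(2)] \<open>0 < t\<close>]])
    qed
  qed (use block_size almost_all_simple basis enumeration extended_space in auto)
  have inj_z: "inj z" using distinct_eigenvalues by (auto simp: inj_def)
  have "carleson_measure (mcphail_measure z (\<lambda>n. b (n, N n))) \<longleftrightarrow> riesz_lower_bound z (\<lambda>n. b (n, N n))"
    using carleson_of_lower_bound[OF inj_z z_pos] lower_bound_of_carleson[OF inj_z z_pos] by blast
  then show ?thesis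
    unfolding control_measure_eq_mcphail
    using lower_bound_of_controllability controllability_of_lower_bound[OF distinct_eigenvalues] by blast
qed

end
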